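(* For any $d\ge1$, the $d$-dimensional paperfolding structures have pure point diffraction spectrum, and the dynamical system of the translation action of $\mathbb{R}^d$ on the hull $\Omega_d^{pf}$ has pure point dynamical spectrum.
   Context: Crease patterns. For $\boldsymbol{x}\in\mathbb{Z}^d$ and $k\in\{1,\dots,d\}$ let $F_k(\boldsymbol{x})=\{y\in\mathbb{R}^d: y_k=x_k,\ x_i\le y_i\le x_i+1 \text{ for } i\ne k\}$ be the unit face perpendicular to the $k$-th axis. A crease pattern on a set of such faces assigns to each of them a sign $+$ (valley) or $-$ (crest). For a crease pattern $P$, $m_i'P$ denotes the pattern obtained by reflecting $P$ in the hyperplane $x_i=0$ and then exchanging all signs $+\leftrightarrow-$. The $m_i'$ are commuting involutions. For $\boldsymbol\phi\in\{1,-1\}^d$ put $M(\boldsymbol\phi)=\prod_{\{i:\phi_i=-1\}}m_i'$. Finite paperfolding structures. $S_d(n)$ is a crease pattern on the unit faces lying in $[-2^{n-1},2^{n-1}]^d$ but not in its boundary, defined recursively: $S_d(0)=\emptyset$, and $S_d(n+1)$ is obtained as follows. (i) A face $F_k(\boldsymbol{x})$ with $x_k=0$ gets the sign $\mathrm{sign}\big(\prod_{i<k}\sigma_i\big)$, where $\sigma_i=1$ if $x_i\ge0$ and $\sigma_i=-1$ if $x_i<0$ (empty product $=1$). (ii) For each $\boldsymbol\phi\in\{\pm1\}^d$, the faces with relative interior in the open orthant $\{\phi_iy_i>0\ \forall i\}$ carry the copy of $M(\boldsymbol\phi)S_d(n)$ translated so that its centre is $2^{n-1}\boldsymbol\phi$.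 The patterns $S_d(n)$ stabilise on growing cubes around the origin as $n\to\infty$; the $d$-dimensional paperfolding structure is the limiting pattern on all of $\mathbb{R}^d$. Hull. The hull $\Omega_d^{pf}$ is the closure of the $\mathbb{R}^d$-translation orbit of the $d$-dimensional paperfolding structure, in the topology in which two patterns are $\epsilon$-close if they agree in the ball $B_{1/\epsilon}$ centred at the origin, up to a translation of order $\epsilon$. It is compact, $\mathbb{R}^d$ acts on it continuously by translations, and this action is minimal and uniquely ergodic, with unique invariant probability measure $\mathbb{P}$. The elements of the hull are called the $d$-dimensional paperfolding structures. Spectra. The dynamical spectrum is pure point if $L^2(\Omega_d^{pf},\mathbb{P})$ is the closed linear span of the eigenfunctions of the unitary translation action of $\mathbb{R}^d$. A structure has pure point diffraction spectrum if, for weighted Dirac combs obtained by placing at the centre of each crease a point mass with a complex weight depending only on the orientation and sign of that crease, the diffraction measure (Fourier transform of the autocorrelation measure) is a pure point measure. *)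

theory Defs
  imports "HOL-Probability.Probability"
begin

section \<open>Crease patterns\<close>

text \<open>
  The coordinates of \<open>\<real>\<^sup>d\<close> are indexed by a finite linearly ordered type \<open>'d\<close>, with
  \<open>d = CARD('d) \<ge> 1\<close>; up to order isomorphism this is the index set \<open>{1, \<dots>, d}\<close>, and every
  \<open>d \<ge> 1\<close> occurs. The linear order is used only in the sign rule for the central faces.

  A triple \<open>(x, k, s)\<close> stands for the face perpendicular to the \<open>k\<close>-th axis with lowest corner \<open>x\<close>,
  carrying the sign \<open>s\<close>. Corners are real vectors because elements of the hull are
  translates of lattice patterns by arbitrary vectors.
\<close>

datatype crease = Valley | Crest

type_synonym 'd pattern = "((real^'d) \<times> 'd \<times> crease) set"

fun flip :: "crease \<Rightarrow> crease" where
  "flip Valley = Crest"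
| "flip Crest = Valley"

definition face :: "real^('d::finite) \<Rightarrow> 'd \<Rightarrow> (real^'d) set" where
  "face x k = {y. y $ k = x $ k \<and> (\<forall>i. i \<noteq> k \<longrightarrow> x $ i \<le> y $ i \<and> y $ i \<le> x $ i + 1)}"

text \<open>The relative interior of \<open>face x k\<close>:\<close>

definition open_face :: "real^('d::finite) \<Rightarrow> 'd \<Rightarrow> (real^'d) set" where
  "open_face x k = {y. y $ k = x $ k \<and> (\<forall>i. i \<noteq> k \<longrightarrow> x $ i < y $ i \<and> y $ i < x $ i + 1)}"

definition face_centre :: "real^('d::finite) \<Rightarrow> 'd \<Rightarrow> real^'d" where
  "face_centre x k = (\<chi> i. if i = k then x $ i else x $ i + 1/2)"

definition translate :: "real^('d::finite) \<Rightarrow> 'd pattern \<Rightarrow> 'd pattern" where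
  "translate t P = (\<lambda>(x, k, s). (x + t, k, s)) ` P"

text \<open>
  The lowest corner of the mirror image of \<open>face x k\<close> in the hyperplane \<open>{y. y $ i = 0}\<close>: for
  \<open>i \<noteq> k\<close> the interval \<open>[x\<^sub>i, x\<^sub>i + 1]\<close> is mapped to \<open>[- x\<^sub>i - 1, - x\<^sub>i]\<close>.
\<close>

definition reflect_corner :: "('d::finite) \<Rightarrow> 'd \<Rightarrow> real^'d \<Rightarrow> real^'d" where
  "reflect_corner i k x = (\<chi> j. if j = i then (if i = k then - x $ j else - x $ j - 1) else x $ j)"

definition reflect_flip :: "('d::finite) \<Rightarrow> 'd pattern \<Rightarrow> 'd pattern" where
  "reflect_flip i P = (\<lambda>(x, k, s). (reflect_corner i k x, k, flip s)) ` P"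

text \<open>
  The product of the commuting involutions \<open>reflect_flip i\<close> over all \<open>i\<close> with \<open>\<phi>\<^sub>i = -1\<close>,
  composed in increasing order of \<open>i\<close>.
\<close>

definition reflect_flips :: "real^('d::{finite,linorder}) \<Rightarrow> 'd pattern \<Rightarrow> 'd pattern" where
  "reflect_flips \<phi> = foldr reflect_flip (sorted_list_of_set {i. \<phi> $ i = -1})"

section \<open>Paperfolding structures\<close>

definition central_sign :: "real^('d::{finite,linorder}) \<Rightarrow> 'd \<Rightarrow> crease" where
  "central_sign x k =
     (if (\<Prod>i\<in>{..<k}. if x $ i \<ge> 0 then 1 else -1 :: int) > 0 then Valley else Crest)"

definition orthant :: "real^('d::finite) \<Rightarrow> (real^'d) set" where
  "orthant \<phi> = {y. \<forall>i. \<phi> $ i * y $ i > 0}"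

text \<open>
  \<open>finite_paperfolding n\<close> lives in the cube \<open>[-2\<^sup>n\<^sup>-\<^sup>1, 2\<^sup>n\<^sup>-\<^sup>1]\<^sup>d\<close>; hence the cube below is that of
  step \<open>n + 1\<close>. Its faces with \<open>x $ k = 0\<close> never lie in the boundary of the cube.
\<close>

primrec finite_paperfolding :: "nat \<Rightarrow> ('d::{finite,linorder}) pattern" where
  "finite_paperfolding 0 = {}"
| "finite_paperfolding (Suc n) =
     {(x, k, central_sign x k) | x k.
        (\<forall>i. x $ i \<in> \<int>) \<and> x $ k = 0 \<and> face x k \<subseteq> cbox (\<chi> i. - (2 ^ n)) (\<chi> i. 2 ^ n)}
     \<union> (\<Union>\<phi>\<in>{\<phi>. \<forall>i. \<phi> $ i \<in> {1, -1}}.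
          {(x, k, s). (x, k, s) \<in> translate ((2 ^ n / 2) *\<^sub>R \<phi>) (reflect_flips \<phi> (finite_paperfolding n))
                      \<and> open_face x k \<subseteq> orthant \<phi>})"

text \<open>
  The sign of each fixed face is the same in all \<open>finite_paperfolding n\<close> with \<open>n\<close> large enough.
\<close>

definition paperfolding_structure :: "('d::{finite,linorder}) pattern" where
  "paperfolding_structure = {c. \<forall>\<^sub>F n in sequentially. c \<in> finite_paperfolding n}"

section \<open>The hull\<close>

definition agree_on :: "(real^('d::finite)) set \<Rightarrow> 'd pattern \<Rightarrow> 'd pattern \<Rightarrow> bool" where
  "agree_on B P Q \<longleftrightarrow> (\<forall>x k s. face x k \<inter> B \<noteq> {} \<longrightarrow> ((x, k, s) \<in> P \<longleftrightarrow> (x, k, s) \<in> Q))"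

definition pattern_close :: "real \<Rightarrow> ('d::finite) pattern \<Rightarrow> 'd pattern \<Rightarrow> bool" where
  "pattern_close \<epsilon> P Q \<longleftrightarrow> (\<exists>t. norm t \<le> \<epsilon> \<and> agree_on (ball 0 (1 / \<epsilon>)) P (translate t Q))"

definition pattern_topology :: "('d::finite) pattern topology" where
  "pattern_topology =
     topology (\<lambda>U. \<forall>P\<in>U. \<exists>\<epsilon>>0. \<forall>Q. pattern_close \<epsilon> P Q \<longrightarrow> Q \<in> U)"

lemma pattern_close_mono:
  assumes "pattern_close \<epsilon> P Q" "0 < \<epsilon>" "\<epsilon> \<le> \<delta>"
  shows "pattern_close \<delta> P Q"
proof -
  from assms obtain t where t: "norm t \<le> \<epsilon>" "agree_on (ball 0 (1 / \<epsilon>)) P (translate t Q)"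
    by (auto simp: pattern_close_def)
  have "ball 0 (1 / \<delta>) \<subseteq> (ball 0 (1 / \<epsilon>) :: (real^'a) set)"
    using assms by (intro subset_ball) (simp add: frac_le)
  with t(2) have "agree_on (ball 0 (1 / \<delta>)) P (translate t Q)"
    unfolding agree_on_def by blast
  with t(1) assms(3) show ?thesis
    unfolding pattern_close_def by force
qed

lemma openin_pattern_topology:
  "openin pattern_topology U \<longleftrightarrow> (\<forall>P\<in>U. \<exists>\<epsilon>>0. \<forall>Q. pattern_close \<epsilon> P Q \<longrightarrow> Q \<in> U)"
proof -
  have "istopology (\<lambda>U :: ('a::finite) pattern set. \<forall>P\<in>U. \<exists>\<epsilon>>0. \<forall>Q. pattern_close \<epsilon> P Q \<longrightarrow> Q \<in> U)"
    unfolding istopology_def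
  proof (intro conjI allI impI ballI)
    fix S T :: "'a pattern set" and P
    assume S: "\<forall>P\<in>S. \<exists>\<epsilon>>0. \<forall>Q. pattern_close \<epsilon> P Q \<longrightarrow> Q \<in> S"
      and T: "\<forall>P\<in>T. \<exists>\<epsilon>>0. \<forall>Q. pattern_close \<epsilon> P Q \<longrightarrow> Q \<in> T" and P: "P \<in> S \<inter> T"
    from S P obtain \<epsilon> where \<epsilon>: "\<epsilon> > 0" "\<And>Q. pattern_close \<epsilon> P Q \<Longrightarrow> Q \<in> S" by blast
    from T P obtain \<delta> where \<delta>: "\<delta> > 0" "\<And>Q. pattern_close \<delta> P Q \<Longrightarrow> Q \<in> T" by blast
    have "min \<epsilon> \<delta> > 0" using \<epsilon>(1) \<delta>(1) by simp
    moreover have "Q \<in> S \<inter> T" if "pattern_close (min \<epsilon> \<delta>) P Q" for Q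
      using pattern_close_mono[OF that] \<epsilon> \<delta> by simp
    ultimately show "\<exists>\<epsilon>>0. \<forall>Q. pattern_close \<epsilon> P Q \<longrightarrow> Q \<in> S \<inter> T" by blast
  next
    fix K :: "'a pattern set set" and P
    assume K: "\<forall>S\<in>K. \<forall>P\<in>S. \<exists>\<epsilon>>0. \<forall>Q. pattern_close \<epsilon> P Q \<longrightarrow> Q \<in> S" and "P \<in> \<Union> K"
    then obtain S where S: "S \<in> K" "P \<in> S" by blast
    with K obtain \<epsilon> where "\<epsilon> > 0" "\<forall>Q. pattern_close \<epsilon> P Q \<longrightarrow> Q \<in> S" by blast
    with S show "\<exists>\<epsilon>>0. \<forall>Q. pattern_close \<epsilon> P Q \<longrightarrow> Q \<in> \<Union> K" by blast
  qed
  then show ?thesis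
    by (simp add: pattern_topology_def topology_inverse')
qed

definition paperfolding_hull :: "('d::{finite,linorder}) pattern set" where
  "paperfolding_hull = pattern_topology closure_of range (\<lambda>t. translate t paperfolding_structure)"

section \<open>Dynamical spectrum\<close>

definition invariant_hull_measure :: "('d::{finite,linorder}) pattern measure \<Rightarrow> bool" where
  "invariant_hull_measure M \<longleftrightarrow>
     prob_space M \<and>
     sets M = sets (sigma paperfolding_hull
                      {U. openin (subtopology pattern_topology paperfolding_hull) U}) \<and>
     (\<forall>t. translate t \<in> measurable M M \<and> distr M M (translate t) = M)"

definition square_integrable :: "'a measure \<Rightarrow> ('a \<Rightarrow> complex) \<Rightarrow> bool" where
  "square_integrable M f \<longleftrightarrow> f \<in> borel_measurable M \<and> integrable M (\<lambda>x. (cmod (f x))\<^sup>2)"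

text \<open>
  The eigenvalues of the unitary action are the continuous characters \<open>t \<mapsto> exp (2 \<pi> \<i> \<xi> \<bullet> t)\<close>. As
  identities in \<open>L\<^sup>2\<close>, the eigenvalue equations hold almost everywhere for each fixed \<open>t\<close>.
\<close>

definition eigenfunction :: "('d::finite) pattern measure \<Rightarrow> ('d pattern \<Rightarrow> complex) \<Rightarrow> bool" where
  "eigenfunction M f \<longleftrightarrow> square_integrable M f \<and> \<not> (AE P in M. f P = 0) \<and>
     (\<exists>\<xi>. \<forall>t. AE P in M. f (translate t P) = cis (2 * pi * (\<xi> \<bullet> t)) * f P)"

definition pure_point_dynamical_spectrum :: "('d::finite) pattern measure \<Rightarrow> bool" where
  "pure_point_dynamical_spectrum M \<longleftrightarrow>
     (\<forall>f. square_integrable M f \<longrightarrow> (\<forall>\<epsilon>>0. \<exists>E c. finite E \<and> (\<forall>e\<in>E. eigenfunction M e) \<and>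
        (\<integral>P. (cmod (f P - (\<Sum>e\<in>E. c e * e P)))\<^sup>2 \<partial>M) < \<epsilon>\<^sup>2))"

section \<open>Diffraction spectrum\<close>

text \<open>
  A complex Radon measure on \<open>\<real>\<^sup>d\<close> is represented by the functional it induces on the continuous
  functions with compact support.
\<close>

definition test_function :: "(real^('d::finite) \<Rightarrow> complex) \<Rightarrow> bool" where
  "test_function g \<longleftrightarrow> continuous_on UNIV g \<and> compact (closure {x. g x \<noteq> 0})"

definition creases_in_ball :: "('d::finite) pattern \<Rightarrow> real \<Rightarrow> 'd pattern" where
  "creases_in_ball P R = {(x, k, s). (x, k, s) \<in> P \<and> face_centre x k \<in> ball 0 R}"

text \<open>
  \<open>\<gamma>\<close> is the vague limit of \<open>(\<omega>\<^sub>R * \<omega>\<^sub>R\<^sup>~) / vol (B\<^sub>R)\<close>, where \<open>\<omega>\<^sub>R\<close> is the restriction to the ball \<open>B\<^sub>R\<close>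
  of the Dirac comb with weight \<open>w k s\<close> at the centre of each crease of orientation \<open>k\<close> and sign \<open>s\<close>.
  The sum is over pairs of creases, so weights of distinct creases with the same centre add up.
\<close>

definition is_autocorrelation ::
  "('d::finite) pattern \<Rightarrow> ('d \<Rightarrow> crease \<Rightarrow> complex) \<Rightarrow> ((real^'d \<Rightarrow> complex) \<Rightarrow> complex) \<Rightarrow> bool" where
  "is_autocorrelation P w \<gamma> \<longleftrightarrow>
     (\<forall>g. test_function g \<longrightarrow>
        ((\<lambda>R. (\<Sum>(x, k, s)\<in>creases_in_ball P R. \<Sum>(x', k', s')\<in>creases_in_ball P R.
                  w k s * cnj (w k' s') * g (face_centre x k - face_centre x' k'))
               / complex_of_real (measure lborel (ball (0 :: real^'d) R)))
          \<longlongrightarrow> \<gamma> g) at_top)"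

definition self_convolution :: "(real^('d::finite) \<Rightarrow> complex) \<Rightarrow> real^'d \<Rightarrow> complex" where
  "self_convolution f x = (\<integral>y. f y * cnj (f (y - x)) \<partial>lborel)"

definition inverse_fourier :: "(real^('d::finite) \<Rightarrow> complex) \<Rightarrow> real^'d \<Rightarrow> complex" where
  "inverse_fourier f \<xi> = (\<integral>x. f x * cis (2 * pi * (\<xi> \<bullet> x)) \<partial>lborel)"

text \<open>
  The Fourier transform of an unbounded measure is taken in the sense of Argabright and Gil de
  Lamadrid: \<open>D\<close> is the Fourier transform of \<open>\<gamma>\<close> if \<open>\<gamma> (f * f\<^sup>~) = \<integral> |f\<^sup>\<or>|\<^sup>2 dD\<close> for all continuous \<open>f\<close>
  with compact support, where \<open>f\<^sup>~ x = cnj (f (-x))\<close> and \<open>f\<^sup>\<or>\<close> is the inverse Fourier transform.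
  This determines \<open>D\<close> uniquely. An autocorrelation is positive definite, so its Fourier transform is
  a positive measure.
\<close>

definition is_fourier_transform ::
  "((real^('d::finite) \<Rightarrow> complex) \<Rightarrow> complex) \<Rightarrow> (real^'d) measure \<Rightarrow> bool" where
  "is_fourier_transform \<gamma> D \<longleftrightarrow>
     sets D = sets borel \<and> (\<forall>K. compact K \<longrightarrow> emeasure D K < \<infinity>) \<and>
     (\<forall>f. test_function f \<longrightarrow>
        integrable D (\<lambda>\<xi>. (cmod (inverse_fourier f \<xi>))\<^sup>2) \<and>
        complex_of_real (\<integral>\<xi>. (cmod (inverse_fourier f \<xi>))\<^sup>2 \<partial>D) = \<gamma> (self_convolution f))"

definition is_diffraction_measure ::
  "('d::finite) pattern \<Rightarrow> ('d \<Rightarrow> crease \<Rightarrow> complex) \<Rightarrow> (real^'d) measure \<Rightarrow> bool" where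
  "is_diffraction_measure P w D \<longleftrightarrow> (\<exists>\<gamma>. is_autocorrelation P w \<gamma> \<and> is_fourier_transform \<gamma> D)"

definition pure_point_measure :: "'a measure \<Rightarrow> bool" where
  "pure_point_measure D \<longleftrightarrow> (\<forall>A\<in>sets D. emeasure D A = (\<integral>\<^sup>+x\<in>A. emeasure D {x} \<partial>count_space UNIV))"

definition pure_point_diffraction_spectrum :: "('d::finite) pattern \<Rightarrow> bool" where
  "pure_point_diffraction_spectrum P \<longleftrightarrow>
     (\<forall>w. \<exists>D. is_diffraction_measure P w D \<and> pure_point_measure D)"

end

theory Submission
  imports Defs
begin

text \<open>
  The paperfolding structure is limit-periodic, and both spectra are read off from that.

  Let \<open>m\<close> be the corner of a face perpendicular to axis \<open>k\<close>, and let \<open>2\<^sup>v\<close> be the exact power of two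
  that divides \<open>m\<^sub>k \<noteq> 0\<close>. Unfolding the recursion shows that the sign of the face is a product over the
  coordinates \<open>i\<close> of \<open>\<plusminus>1\<close>, given by the binary digit of \<open>m\<^sub>i\<close> at position \<open>v\<close> for \<open>i < k\<close> and at position
  \<open>v + 1\<close> for \<open>i \<ge> k\<close> (\<open>layer_sign\<close>, \<open>paperfolding_structure_closed\<close>). Two facts follow. The faces with
  \<open>v < n\<close> form a pattern with period lattice \<open>2\<^sup>n\<^sup>+\<^sup>1\<int>\<^sup>d\<close>, and the remaining faces lie in hyperplanes at
  distance \<open>2\<^sup>n\<close> from each other, a set of small density (\<open>limit_sign_periodic\<close>). And moving \<open>m\<^sub>k\<close>
  by \<open>2\<^sup>v\<^sup>+\<^sup>1\<close> reverses the sign, so that a translation that matches the structure with itself on one large ball must lie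
  in \<open>2\<^sup>n\<int>\<^sup>d\<close> (\<open>recognizability\<close>). Hence every \<open>P\<close> in the hull has, for each \<open>n\<close>, an address
  \<open>\<tau>\<close> modulo \<open>2\<^sup>n\<int>\<^sup>d\<close>, and this \<open>\<tau>\<close> determines \<open>P\<close> outside the sparse hyperplanes.

  Diffraction. Smear the weighted comb of \<open>P\<close> with a test function \<open>f\<close> and call the result \<open>F\<close>. Off
  thin slabs around the sparse hyperplanes, \<open>F\<close> is a continuous periodic function, hence a uniform limit of
  trigonometric polynomials with frequencies in \<open>\<int>[1/2]\<^sup>d\<close>. So \<open>F\<close> is almost periodic in the sense of
  Besicovitch (\<open>almost_periodic_comb\<close>): means over balls exist and Parseval's identity holds
  (\<open>parseval\<close>). The autocorrelation evaluated at \<open>f * f\<^sup>~\<close> is the mean of \<open>|F|\<^sup>2\<close>, and the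
  Fourier--Bohr coefficients of \<open>F\<close> factor as \<open>A(\<xi>) f\<^sup>\<or>(\<xi>)\<close> with \<open>A\<close> independent of \<open>f\<close>. Parseval's identity
  therefore says that the diffraction measure is \<open>\<Sum>\<^sub>\<xi> |A(\<xi>)|\<^sup>2 \<delta>\<^sub>\<xi>\<close>.

  Dynamics. For \<open>\<xi> \<in> \<int>[1/2]\<^sup>d\<close> the character \<open>P \<mapsto> exp (2\<pi>\<i> \<xi> \<bullet> \<tau>)\<close> of the address is an
  eigenfunction. A pattern with arbitrarily far away sparse hyperplanes is determined by its addresses, in
  such a way that each neighbourhood contains a cylinder set given by the address modulo some \<open>2\<^sup>n\<close>
  (\<open>regular_point_cylinder\<close>). All other patterns form a null set for every invariant probability
  measure (\<open>slab_events_null\<close>). So open sets are almost increasing unions of cylinder sets, whose indicators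
  are \<open>L\<^sup>2\<close> limits of combinations of eigenfunctions by the Stone--Weierstrass theorem; indicators of Borel sets
  and then all of \<open>L\<^sup>2\<close> follow.

  That slabs are rare is seen in both parts by the same argument: a set with \<open>m\<close> disjoint
  translates has mean, or measure, at most \<open>1/m\<close> (\<open>slab_mean\<close>, \<open>slab_event_prob\<close>).
\<close>

section \<open>The signs of the paperfolding structure\<close>

definition lattice_point :: "('d \<Rightarrow> int) \<Rightarrow> real^('d::finite)" where
  "lattice_point m = (\<chi> i. of_int (m i))"

lemma lattice_point_nth [simp]: "lattice_point m $ i = of_int (m i)"
  by (simp add: lattice_point_def)

lemma lattice_point_inject [simp]: "lattice_point m = lattice_point m' \<longleftrightarrow> m = m'"
  by (auto simp: vec_eq_iff)

lemma Ints_imp_lattice_point: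
  assumes "\<And>i. x $ i \<in> \<int>"
  obtains m where "x = lattice_point m"
proof
  show "x = lattice_point (\<lambda>i. \<lfloor>x $ i\<rfloor>)"
    using assms by (simp add: vec_eq_iff)
qed

text \<open>
  The values \<open>\<plusminus>1\<close> turn the flips of signs into multiplications.
\<close>

fun crease_sign :: "crease \<Rightarrow> int" where
  "crease_sign Valley = 1" | "crease_sign Crest = -1"

lemma crease_sign_inject [simp]: "crease_sign s = crease_sign s' \<longleftrightarrow> s = s'"
  by (cases s; cases s') auto

lemma crease_sign_flip [simp]: "crease_sign (flip s) = - crease_sign s"
  by (cases s) auto

lemma crease_sign_flip_funpow: "crease_sign ((flip ^^ j) s) = (-1) ^ j * crease_sign s"
  by (induction j) auto

text \<open>
  The binary digit of \<open>x\<close> at position \<open>v\<close>, written multiplicatively; for negative \<open>x\<close> the digits are those of the two's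
  complement, so that the reflection \<open>x \<mapsto> - x - 1\<close> of a unit interval negates all of them.
\<close>

definition bit_sign :: "nat \<Rightarrow> int \<Rightarrow> int" where
  "bit_sign v x = (if odd (x div 2 ^ v) then 1 else - 1)"

lemma bit_sign_add_high:
  assumes "v < p" shows "bit_sign v (x + 2 ^ p * z) = bit_sign v x"
proof -
  have "(2::int) ^ p = 2 ^ v * 2 ^ (p - v)"
    using assms by (simp flip: power_add)
  then have "(x + 2 ^ p * z) div 2 ^ v = x div 2 ^ v + 2 ^ (p - v) * z"
    by (simp add: mult.assoc)
  moreover have "even ((2::int) ^ (p - v) * z)" using assms by simp
  ultimately show ?thesis by (simp add: bit_sign_def)
qed

lemma bit_sign_add_same: "bit_sign v (x + 2 ^ v) = - bit_sign v x"
  by (simp add: bit_sign_def)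

lemma bit_sign_complement: "bit_sign v (- x - 1) = - bit_sign v x"
proof -
  have "bit (- x - 1) v \<longleftrightarrow> \<not> bit x v"
    using bit_not_int_iff[of x v] by (simp add: not_int_def)
  then show ?thesis by (simp add: bit_sign_def bit_iff_odd)
qed

definition exact2 :: "nat \<Rightarrow> int \<Rightarrow> bool" where
  "exact2 v a \<longleftrightarrow> 2 ^ v dvd a \<and> \<not> 2 ^ Suc v dvd a"

lemma exact2_iff: "exact2 v a \<longleftrightarrow> (\<exists>c. odd c \<and> a = 2 ^ v * c)"
  by (auto simp: exact2_def dvd_def mult.assoc elim!: oddE)

lemma exact2_ex: assumes "a \<noteq> 0" shows "\<exists>v. exact2 v a"
proof -
  have "\<not> is_unit (2::int)" by simp
  from multiplicity_decompose'[OF assms this]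
  show ?thesis by (metis exact2_iff mult.commute)
qed

lemma exact2_unique: assumes "exact2 v a" "exact2 w a" shows "v = w"
proof (rule ccontr)
  assume "v \<noteq> w"
  then have "Suc v \<le> w \<or> Suc w \<le> v" by auto
  then show False using assms unfolding exact2_def by (meson dvd_trans le_imp_power_dvd)
qed

lemma exact2_less: assumes "exact2 v a" "\<bar>a\<bar> < 2 ^ N" shows "v < N"
proof (rule ccontr)
  assume "\<not> v < N"
  then have "(2::int) ^ N \<le> 2 ^ v" by simp
  moreover have "a \<noteq> 0" using assms(1) by (auto simp: exact2_def)
  then have "2 ^ v \<le> \<bar>a\<bar>" using assms(1) dvd_imp_le_int[of a "2 ^ v"] by (simp add: exact2_def)
  ultimately show False using assms(2) by linarith
qed

lemma exact2_add: assumes "v < p" shows "exact2 v (a + 2 ^ p * z) \<longleftrightarrow> exact2 v a"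
proof -
  have "(2::int) ^ v dvd 2 ^ p * z" "(2::int) ^ Suc v dvd 2 ^ p * z"
    using assms by (auto intro!: dvd_mult2 le_imp_power_dvd simp del: power_Suc)
  then show ?thesis unfolding exact2_def by (metis dvd_add_left_iff)
qed

lemma exact2_minus [simp]: "exact2 v (- a) \<longleftrightarrow> exact2 v a"
  by (simp add: exact2_def)

text \<open>
  Negation keeps the digits up to the lowest nonzero one, at position \<open>v\<close>, and reverses all higher ones.
\<close>

lemma bit_sign_minus: assumes "exact2 v a" shows "bit_sign (Suc v) (- a) = - bit_sign (Suc v) a"
proof -
  from assms obtain c where c: "odd c" "a = 2 ^ v * c" by (auto simp: exact2_iff)
  have *: "(2 ^ v * e) div 2 ^ Suc v = e div 2" for e :: int
    by (simp add: mult.commute[of 2])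
  have "-a = 2 ^ v * (- c)" using c by simp
  then have "(- a) div 2 ^ Suc v = (- c) div 2" "a div 2 ^ Suc v = c div 2" using c(2) * by metis+
  moreover have "(- c) div 2 = - (c div 2) - 1" using c(1) by presburger
  ultimately show ?thesis by (simp add: bit_sign_def)
qed

text \<open>
  In a window of length \<open>2\<^sup>N\<^sup>+\<^sup>1\<close> around \<open>0\<close>, the digit at position \<open>N\<close> is the sign bit. This is how the signs \<open>\<sigma>\<^sub>i\<close>
  and \<open>\<phi>\<^sub>i\<close> of the recursion turn into binary digits.
\<close>

lemma bit_sign_top:
  assumes "- (2 ^ N) \<le> x" "x < 2 ^ N" shows "bit_sign N x = (if x \<ge> 0 then -1 else 1)"
proof (cases "x \<ge> 0")
  case True
  then show ?thesis using assms by (simp add: bit_sign_def div_pos_pos_trivial)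
next
  case False
  then have "(x + 2 ^ N) div 2 ^ N = 0" using assms by (intro div_pos_pos_trivial) auto
  then have "x div 2 ^ N = -1" by simp
  then show ?thesis using False by (simp add: bit_sign_def)
qed

definition face_factor :: "nat \<Rightarrow> 'd::{finite,linorder} \<Rightarrow> 'd \<Rightarrow> int \<Rightarrow> int" where
  "face_factor v k i a = (if i < k then bit_sign v a else bit_sign (Suc v) a)"

text \<open>
  The sign of a face whose position \<open>m\<^sub>k\<close> is an odd multiple of \<open>2\<^sup>v\<close>. Such a face is a central face of a copy
  of the structure of level \<open>v + 1\<close>: the digits at position \<open>v\<close> tell on which side of the centre of the copy it lies,
  and the digits at position \<open>v + 1\<close> tell in which orthant of its parent the copy was placed.
\<close>

definition layer_sign :: "nat \<Rightarrow> 'd::{finite,linorder} \<Rightarrow> ('d \<Rightarrow> int) \<Rightarrow> int" where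
  "layer_sign v k m = (\<Prod>i\<in>UNIV. face_factor v k i (m i))"

lemma bit_sign_cases: "bit_sign v x = 1 \<or> bit_sign v x = - 1"
  by (simp add: bit_sign_def)

lemma layer_sign_cases: "layer_sign v k m = 1 \<or> layer_sign v k m = - 1"
proof -
  have "(\<Prod>i\<in>A. face_factor v k i (m i)) \<in> {1, -1}" if "finite A" for A
    using that
  proof (induction A rule: finite_induct)
    case (insert i A)
    then show ?case using bit_sign_cases[of v "m i"] bit_sign_cases[of "Suc v" "m i"]
      by (auto simp: face_factor_def)
  qed auto
  from this[of UNIV] show ?thesis by (simp add: layer_sign_def)
qed

text \<open>
  The joint action on corners of the reflections in the coordinates \<open>i \<in> J\<close>.
\<close>

definition reflected_corner :: "'d set \<Rightarrow> 'd \<Rightarrow> real^('d::finite) \<Rightarrow> real^'d" where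
  "reflected_corner J k x = (\<chi> j. if j \<in> J then (if j = k then - x $ j else - x $ j - 1) else x $ j)"

lemma foldr_reflect_flip:
  assumes "distinct l"
  shows "foldr reflect_flip l P = (\<lambda>(x, k, s). (reflected_corner (set l) k x, k, (flip ^^ length l) s)) ` P"
  using assms
proof (induction l)
  case Nil
  have "reflected_corner {} k x = x" for k :: 'a and x by (simp add: reflected_corner_def vec_eq_iff)
  then show ?case by (auto simp: image_iff)
next
  case (Cons i l)
  have "reflect_corner i k (reflected_corner (set l) k x) = reflected_corner (set (i # l)) k x" for k and x
    using Cons.prems by (auto simp: reflected_corner_def reflect_corner_def vec_eq_iff)
  then show ?case using Cons
    by (simp add: reflect_flip_def image_image case_prod_unfold)
qed

lemma reflect_flips_image:
  fixes \<phi> :: "real^('d::{finite,linorder})"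
  shows "reflect_flips \<phi> P = (\<lambda>(x, k, s). (reflected_corner {i. \<phi> $ i = -1} k x, k, (flip ^^ card {i. \<phi> $ i = -1}) s)) ` P"
  using foldr_reflect_flip[of "sorted_list_of_set {i. \<phi> $ i = -1}" P]
  by (simp add: reflect_flips_def)

lemma mem_translate: "(x, k, s) \<in> translate t P \<longleftrightarrow> (x - t, k, s) \<in> P"
  by (force simp: translate_def image_iff)

text \<open>
  The corner to which step (ii) of the recursion moves the face with corner \<open>m\<close>, in the copy for the orthant whose
  negative coordinates are \<open>J\<close>.
\<close>

definition copied_corner :: "nat \<Rightarrow> 'd set \<Rightarrow> 'd \<Rightarrow> ('d \<Rightarrow> int) \<Rightarrow> 'd \<Rightarrow> int" where
  "copied_corner N J k m i = (if i \<in> J then (if i = k then - m i else - m i - 1) - 2 ^ N else m i + 2 ^ N)"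

definition orthant_vector :: "'d set \<Rightarrow> real^('d::finite)" where
  "orthant_vector J = (\<chi> i. if i \<in> J then -1 else 1)"

lemma sign_vectors: "{\<phi> :: real^('d::finite). \<forall>i. \<phi> $ i \<in> {1, -1}} = range orthant_vector"
proof -
  have "\<phi> = orthant_vector {i. \<phi> $ i = -1}" if "\<forall>i. \<phi> $ i \<in> {1, -1}" for \<phi> :: "real^'d"
    using that by (auto simp: orthant_vector_def vec_eq_iff)
  then have "{\<phi> :: real^'d. \<forall>i. \<phi> $ i \<in> {1, -1}} \<subseteq> range orthant_vector" by blast
  moreover have "range orthant_vector \<subseteq> {\<phi> :: real^'d. \<forall>i. \<phi> $ i \<in> {1, -1}}"
    by (auto simp: orthant_vector_def)
  ultimately show ?thesis by blast
qed

lemma orthant_vector_neg [simp]: "{i. orthant_vector J $ i = -1} = J"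
  by (auto simp: orthant_vector_def)

lemma translate_reflected_corner:
  "(2 ^ Suc N / 2) *\<^sub>R orthant_vector J + reflected_corner J k (lattice_point m) = lattice_point (copied_corner N J k m)"
  by (auto simp: orthant_vector_def reflected_corner_def copied_corner_def vec_eq_iff)

text \<open>
  The interior faces of the cube \<open>[-2\<^sup>N, 2\<^sup>N]\<^sup>d\<close>.
\<close>

definition in_cube :: "nat \<Rightarrow> 'd \<Rightarrow> ('d \<Rightarrow> int) \<Rightarrow> bool" where
  "in_cube N k m \<longleftrightarrow> \<bar>m k\<bar> < 2 ^ N \<and> (\<forall>i. i \<noteq> k \<longrightarrow> - (2 ^ N) \<le> m i \<and> m i < 2 ^ N)"

text \<open>
  The sign in \<open>finite_paperfolding (Suc N)\<close>. It differs from the sign in the limit on the outermost layer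
  \<open>Suc v = N\<close>: its copies still have to be moved by one more step, which reverses the digits at position \<open>N\<close>.
\<close>

definition finite_sign :: "nat \<Rightarrow> 'd::{finite,linorder} \<Rightarrow> ('d \<Rightarrow> int) \<Rightarrow> crease \<Rightarrow> bool" where
  "finite_sign N k m s \<longleftrightarrow>
     (if m k = 0 then s = central_sign (lattice_point m) k
      else \<exists>v. exact2 v (m k) \<and>
             crease_sign s = (if Suc v = N then (-1) ^ card {k..} else 1) * layer_sign v k m)"

lemma prod_minus_on:
  "(\<Prod>i\<in>(UNIV :: 'd::finite set). if P i then -1 else 1 :: int) = (-1) ^ card {i. P i}"
  by (simp add: prod.If_cases)

lemma copied_corner_nonzero:
  assumes "in_cube N k m" shows "copied_corner N J k m k \<noteq> 0"
  using assms by (auto simp: copied_corner_def in_cube_def)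

lemma exact2_copied_corner:
  assumes "in_cube N k m" "m k \<noteq> 0" "exact2 v (m k)"
  shows "exact2 v (copied_corner N J k m k)" "v < N"
proof -
  show v: "v < N" using assms by (auto simp: in_cube_def intro: exact2_less)
  show "exact2 v (copied_corner N J k m k)"
    using exact2_add[OF v, of "m k" 1] exact2_add[OF v, of "- m k" "- 1"] assms(3)
    by (auto simp: copied_corner_def)
qed

text \<open>
  Coordinate by coordinate: a reflection negates one factor, and among the digits in use, the translation by
  \<open>\<plusminus>2\<^sup>N\<close> reverses only the one at position \<open>N\<close>, which is used exactly on the layer \<open>Suc v = N\<close> and by the coordinates \<open>i \<ge> k\<close>.
\<close>

lemma layer_sign_copied_corner:
  fixes m :: "'d::{finite,linorder} \<Rightarrow> int"
  assumes m: "in_cube N k m" "m k \<noteq> 0" and v: "exact2 v (m k)"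
  shows "layer_sign v k (copied_corner N J k m) =
    (-1) ^ card J * ((if Suc v = N then (-1) ^ card {k..} else 1) * layer_sign v k m)"
proof -
  have vN: "v < N" using exact2_copied_corner(2)[OF assms] .
  have *: "face_factor v k i (copied_corner N J k m i) =
    (if i \<in> J then -1 else 1) * ((if k \<le> i \<and> Suc v = N then -1 else 1) * face_factor v k i (m i))" for i
  proof -
    have low: "bit_sign w (a + 2 ^ N) = bit_sign w a" "bit_sign w (a - 2 ^ N) = bit_sign w a" if "w < N" for w a
      using bit_sign_add_high[OF that, of a 1] bit_sign_add_high[OF that, of a "-1"] by auto
    have top: "bit_sign N (a + 2 ^ N) = - bit_sign N a" "bit_sign N (a - 2 ^ N) = - bit_sign N a" for a
      using bit_sign_add_same[of N a] bit_sign_add_same[of N "a - 2 ^ N"] by auto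
    show ?thesis
    proof (cases "i < k")
      case True
      then show ?thesis using low[OF vN] by (auto simp: face_factor_def copied_corner_def bit_sign_complement)
    next
      case False
      show ?thesis
      proof (cases "Suc v = N")
        case True
        then show ?thesis using False top bit_sign_minus[OF v]
          by (auto simp: face_factor_def copied_corner_def bit_sign_complement)
      next
        case ne: False
        with vN have "Suc v < N" by simp
        then show ?thesis using False ne low[of "Suc v"] bit_sign_minus[OF v]
          by (auto simp: face_factor_def copied_corner_def bit_sign_complement)
      qed
    qed
  qed
  show ?thesis
    unfolding layer_sign_def * prod.distrib prod_minus_on by (auto simp: atLeast_def)
qed

lemma crease_sign_central:
  fixes m :: "'d::{finite,linorder} \<Rightarrow> int"
  shows "crease_sign (central_sign (lattice_point m) k) = (\<Prod>i\<in>UNIV. if i < k \<and> m i < 0 then -1 else 1)"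
proof -
  have "(\<Prod>i\<in>{..<k}. if lattice_point m $ i \<ge> 0 then 1 else -1 :: int) = (\<Prod>i\<in>UNIV. if i < k \<and> m i < 0 then -1 else 1)"
    by (rule prod.mono_neutral_cong_left) auto
  moreover have "(\<Prod>i\<in>UNIV. if i < k \<and> m i < 0 then -1 else 1 :: int) \<in> {1,-1}"
    unfolding prod_minus_on by (simp add: minus_one_power_iff)
  ultimately show ?thesis by (auto simp: central_sign_def)
qed

text \<open>
  The central faces of a copy become the new outermost layer. The position relative to the centre of the copy and the
  orthant become the digits at the positions \<open>N\<close> and \<open>Suc N\<close>.
\<close>

lemma layer_sign_copied_corner_central:
  fixes m :: "'d::{finite,linorder} \<Rightarrow> int"
  assumes m: "in_cube N k m" "m k = 0"
  shows "(-1) ^ card {k..} * layer_sign N k (copied_corner N J k m) =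
     (-1) ^ card J * crease_sign (central_sign (lattice_point m) k)"
proof -
  have *: "(if i \<ge> k then -1 else 1) * face_factor N k i (copied_corner N J k m i) =
    (if i \<in> J then -1 else 1) * (if i < k \<and> m i < 0 then -1 else 1)" for i
  proof (cases "i < k")
    case True
    then have "- (2 ^ N) \<le> m i" "m i < 2 ^ N" using m by (auto simp: in_cube_def)
    moreover have "bit_sign N (a + 2 ^ N) = - bit_sign N a" "bit_sign N (a - 2 ^ N) = - bit_sign N a" for a
      using bit_sign_add_same[of N a] bit_sign_add_same[of N "a - 2 ^ N"] by auto
    ultimately show ?thesis using True 
      by (auto simp: face_factor_def copied_corner_def bit_sign_complement bit_sign_top)
  next
    case False
    have "bit_sign (Suc N) a = (if a \<ge> 0 then -1 else 1)" if "- (2 ^ Suc N) \<le> a" "a < 2 ^ Suc N" for a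
      using bit_sign_top[OF that] .
    moreover have "- (2 ^ Suc N) \<le> copied_corner N J k m i" "copied_corner N J k m i < 2 ^ Suc N" "copied_corner N J k m i \<ge> 0 \<longleftrightarrow> i \<notin> J"
      using m by (auto simp: copied_corner_def in_cube_def dest!: spec[of _ i])
    ultimately show ?thesis using False by (auto simp: face_factor_def)
  qed
  have "(-1) ^ card {k..} * layer_sign N k (copied_corner N J k m) = (\<Prod>i\<in>UNIV. (if i \<ge> k then -1 else 1) * face_factor N k i (copied_corner N J k m i))"
    unfolding prod.distrib prod_minus_on layer_sign_def by (simp add: atLeast_def)
  also have "\<dots> = (-1) ^ card J * crease_sign (central_sign (lattice_point m) k)"
    unfolding * prod.distrib crease_sign_central prod_minus_on by simp
  finally show ?thesis .
qed

lemma finite_sign_copied_corner: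
  fixes m :: "'d::{finite,linorder} \<Rightarrow> int"
  assumes m: "in_cube N k m"
  shows "finite_sign N k m s \<longleftrightarrow> finite_sign (Suc N) k (copied_corner N J k m) ((flip ^^ card J) s)"
proof (cases "m k = 0")
  case True
  have ex: "exact2 w (copied_corner N J k m k) \<longleftrightarrow> w = N" for w
  proof -
    have "exact2 N (copied_corner N J k m k)"
      using True by (auto simp: copied_corner_def exact2_def)
    then show ?thesis using exact2_unique by blast
  qed
  have "finite_sign (Suc N) k (copied_corner N J k m) ((flip ^^ card J) s) \<longleftrightarrow>
     (-1) ^ card J * crease_sign s = (-1) ^ card {k..} * layer_sign N k (copied_corner N J k m)"
    using copied_corner_nonzero[OF m, of J] by (simp add: finite_sign_def ex crease_sign_flip_funpow)
  also have "\<dots> \<longleftrightarrow> crease_sign s = crease_sign (central_sign (lattice_point m) k)"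
    unfolding layer_sign_copied_corner_central[OF m True] by simp
  finally show ?thesis using True by (simp add: finite_sign_def)
next
  case False
  then obtain v where v: "exact2 v (m k)" using exact2_ex by blast
  note c = exact2_copied_corner[OF m False v]
  have ex: "exact2 w (m k) \<longleftrightarrow> w = v" "exact2 w (copied_corner N J k m k) \<longleftrightarrow> w = v" for w
    using v c(1)[of J] exact2_unique by blast+
  show ?thesis using copied_corner_nonzero[OF m, of J] False c(2)
    by (simp add: finite_sign_def ex crease_sign_flip_funpow layer_sign_copied_corner[OF m False v])
qed

lemma in_cube_copied_corner:
  assumes "in_cube N k m" shows "in_cube (Suc N) k (copied_corner N J k m)"
  using assms unfolding in_cube_def copied_corner_def
  by (auto simp: abs_if split: if_splits dest!: spec)

text \<open>
  Every face off the coordinate hyperplanes lies in the copy that belongs to its own orthant.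
\<close>

lemma copied_corner_surj:
  assumes "in_cube (Suc N) k m" "m k \<noteq> 0"
  obtains m' where "in_cube N k m'" "m = copied_corner N {i. m i < 0} k m'"
proof
  define m' where "m' i = (if m i < 0 then (if i = k then - m i - 2 ^ N else - m i - 1 - 2 ^ N) else m i - 2 ^ N)" for i
  show "m = copied_corner N {i. m i < 0} k m'"
    by (auto simp: copied_corner_def m'_def)
  show "in_cube N k m'"
    using assms unfolding in_cube_def m'_def by (auto simp: abs_if split: if_splits dest!: spec)
qed

lemma open_face_lattice_subset_orthant:
  assumes "m k \<noteq> 0"
  shows "open_face (lattice_point m) k \<subseteq> orthant (orthant_vector {i. m i < 0})"
proof
  fix y assume y: "y \<in> open_face (lattice_point m) k"
  have "orthant_vector {i. m i < 0} $ i * y $ i > 0" for i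
  proof (cases "i = k")
    case True
    then show ?thesis using y assms by (auto simp: open_face_def orthant_vector_def)
  next
    case False
    then have "of_int (m i) < y $ i" "y $ i < of_int (m i) + 1" using y by (auto simp: open_face_def)
    moreover have "m i < 0 \<Longrightarrow> of_int (m i) + 1 \<le> (0::real)" by linarith
    moreover have "\<not> m i < 0 \<Longrightarrow> of_int (m i) \<ge> (0::real)" by simp
    ultimately show ?thesis by (auto simp: orthant_vector_def)
  qed
  then show "y \<in> orthant (orthant_vector {i. m i < 0})" by (simp add: orthant_def)
qed

lemma face_lattice_subset_cube:
  assumes "m k = 0"
  shows "face (lattice_point m) k \<subseteq> cbox (\<chi> i. - (2 ^ N)) (\<chi> i. 2 ^ N) \<longleftrightarrow> in_cube N k m"
proof
  assume *: "face (lattice_point m) k \<subseteq> cbox (\<chi> i. - (2 ^ N)) (\<chi> i. 2 ^ N)"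
  have "lattice_point m \<in> face (lattice_point m) k"
    "(\<chi> i. if i = k then 0 else of_int (m i) + 1) \<in> face (lattice_point m) k"
    using assms by (auto simp: face_def)
  with * have a: "lattice_point m \<in> cbox (\<chi> i. - (2 ^ N)) (\<chi> i. 2 ^ N)"
    "(\<chi> i. (if i = k then 0 else of_int (m i) + 1 :: real)) \<in> cbox (\<chi> i. - (2 ^ N)) (\<chi> i. 2 ^ N)" by blast+
  have "- (2 ^ N) \<le> m i \<and> m i < 2 ^ N" if "i \<noteq> k" for i
  proof -
    have "- (2 ^ N) \<le> real_of_int (m i)" "real_of_int (m i) + 1 \<le> 2 ^ N"
      using a that by (auto simp: mem_box_cart dest!: spec[of _ i])
    then have "real_of_int (- (2 ^ N)) \<le> real_of_int (m i)" "real_of_int (m i + 1) \<le> real_of_int (2 ^ N)" by auto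
    then show ?thesis unfolding of_int_le_iff by simp
  qed
  then show "in_cube N k m" using assms by (simp add: in_cube_def)
next
  assume *: "in_cube N k m"
  show "face (lattice_point m) k \<subseteq> cbox (\<chi> i. - (2 ^ N)) (\<chi> i. 2 ^ N)"
  proof
    fix y assume y: "y \<in> face (lattice_point m) k"
    have "- (2 ^ N) \<le> y $ i \<and> y $ i \<le> 2 ^ N" for i
    proof (cases "i = k")
      case True
      then show ?thesis using y assms by (simp add: face_def)
    next
      case False
      then have "- (2 ^ N) \<le> m i" "m i + 1 \<le> 2 ^ N" using * by (auto simp: in_cube_def)
      then have "real_of_int (- (2 ^ N)) \<le> real_of_int (m i)" "real_of_int (m i + 1) \<le> real_of_int (2 ^ N)"
        unfolding of_int_le_iff by auto
      then show ?thesis using y False by (auto simp: face_def dest!: spec[of _ i])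
    qed
    then show "y \<in> cbox (\<chi> i. - (2 ^ N)) (\<chi> i. 2 ^ N)" by (simp add: mem_box_cart)
  qed
qed

definition signed_lattice_faces ::
  "('d::finite \<Rightarrow> ('d \<Rightarrow> int) \<Rightarrow> crease \<Rightarrow> bool) \<Rightarrow> 'd pattern" where
  "signed_lattice_faces Q = {(lattice_point m, k, s) | m k s. Q k m s}"

lemma mem_signed_lattice_faces:
  "(lattice_point m, k, s) \<in> signed_lattice_faces Q \<longleftrightarrow> Q k m s"
  by (auto simp: signed_lattice_faces_def)

lemma finite_paperfolding_closed:
  "(finite_paperfolding (Suc N) :: ('d::{finite,linorder}) pattern) =
     signed_lattice_faces (\<lambda>k m s. in_cube N k m \<and> finite_sign N k m s)"
proof (induction N)
  case 0
  have nz: "in_cube 0 k m \<Longrightarrow> m k = 0" for m :: "'d \<Rightarrow> int" and k by (simp add: in_cube_def)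
  have "(finite_paperfolding (Suc 0) :: 'd pattern) =
    {(x, k, central_sign x k) | x k.
        (\<forall>i. x $ i \<in> \<int>) \<and> x $ k = 0 \<and> face x k \<subseteq> cbox (\<chi> i. - (2 ^ 0)) (\<chi> i. 2 ^ 0)}"
    unfolding finite_paperfolding.simps reflect_flips_image translate_def by auto
  also have "\<dots> = signed_lattice_faces (\<lambda>k m s. in_cube 0 k m \<and> finite_sign 0 k m s)" (is "?A = ?B")
  proof (intro set_eqI iffI)
    fix c assume "c \<in> ?A"
    then obtain x k where c: "c = (x, k, central_sign x k)" "\<forall>i. x $ i \<in> \<int>" "x $ k = 0"
      "face x k \<subseteq> cbox (\<chi> i. - (2 ^ 0)) (\<chi> i. 2 ^ 0)" by blast
    from c(2) obtain m where m: "x = lattice_point m" using Ints_imp_lattice_point by blast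
    with c(3,4) have "m k = 0" "in_cube 0 k m" using face_lattice_subset_cube[of m k 0] by auto
    then show "c \<in> ?B" unfolding c(1) m mem_signed_lattice_faces by (simp add: finite_sign_def)
  next
    fix c assume "c \<in> ?B"
    then obtain m k s where c: "c = (lattice_point m, k, s)" "in_cube 0 k m" "finite_sign 0 k m s"
      by (auto simp: signed_lattice_faces_def)
    then show "c \<in> ?A" using nz[OF c(2)] face_lattice_subset_cube[of m k 0] by (auto simp: finite_sign_def)
  qed
  finally show ?case .
next
  case (Suc N)
  show ?case (is "?A = ?B")
  proof (intro set_eqI iffI)
    fix c assume "c \<in> ?A"
    then consider x k where "c = (x, k, central_sign x k)" "\<forall>i. x $ i \<in> \<int>" "x $ k = 0"
      "face x k \<subseteq> cbox (\<chi> i. - (2 ^ Suc N)) (\<chi> i. 2 ^ Suc N)"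
      | J where "c \<in> translate ((2 ^ Suc N / 2) *\<^sub>R orthant_vector J) (reflect_flips (orthant_vector J) (finite_paperfolding (Suc N)))"
      unfolding finite_paperfolding.simps(2)[of "Suc N"] sign_vectors by blast
    then show "c \<in> ?B"
    proof cases
      case (1 x k)
      from 1(2) obtain m where m: "x = lattice_point m" using Ints_imp_lattice_point by blast
      with 1(3,4) have "m k = 0" "in_cube (Suc N) k m" using face_lattice_subset_cube[of m k "Suc N"] by auto
      then show "c \<in> ?B" unfolding 1(1) m mem_signed_lattice_faces by (simp add: finite_sign_def)
    next
      case (2 J)
      then obtain x k s where "(x, k, s) \<in> finite_paperfolding (Suc N)"
        and c: "c = (reflected_corner J k x + (2 ^ Suc N / 2) *\<^sub>R orthant_vector J, k, (flip ^^ card J) s)"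
        unfolding translate_def reflect_flips_image by auto
      then obtain m where m: "x = lattice_point m" "in_cube N k m" "finite_sign N k m s"
        unfolding Suc.IH by (auto simp: signed_lattice_faces_def)
      have "c = (lattice_point (copied_corner N J k m), k, (flip ^^ card J) s)"
        unfolding c m(1) translate_reflected_corner[symmetric] by (simp add: add.commute)
      then show ?thesis using in_cube_copied_corner[OF m(2)] finite_sign_copied_corner[OF m(2)] m(3)
        by (simp add: mem_signed_lattice_faces)
    qed
  next
    fix c assume "c \<in> ?B"
    then obtain m k s where c: "c = (lattice_point m, k, s)" "in_cube (Suc N) k m" "finite_sign (Suc N) k m s"
      by (auto simp: signed_lattice_faces_def)
    show "c \<in> ?A"
    proof (cases "m k = 0")
      case True
      then have "s = central_sign (lattice_point m) k" "lattice_point m $ k = 0" "\<forall>i. lattice_point m $ i \<in> \<int>"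
        using c(3) by (simp_all add: finite_sign_def)
      moreover have "face (lattice_point m) k \<subseteq> cbox (\<chi> i. - (2 ^ Suc N)) (\<chi> i. 2 ^ Suc N)"
        using face_lattice_subset_cube[of m k "Suc N"] True c(2) by blast
      ultimately show ?thesis
        unfolding finite_paperfolding.simps(2)[of "Suc N"] c(1) by blast
    next
      case False
      define J where "J = {i. m i < 0}"
      obtain m' where m': "in_cube N k m'" "m = copied_corner N J k m'"
        using copied_corner_surj[OF c(2) False] unfolding J_def by blast
      define s' where "s' = (flip ^^ card J) s"
      have s: "s = (flip ^^ card J) s'"
        unfolding s'_def crease_sign_inject[symmetric] crease_sign_flip_funpow by simp
      have "(lattice_point m', k, s') \<in> finite_paperfolding (Suc N)"
        unfolding Suc.IH mem_signed_lattice_faces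
        using m' finite_sign_copied_corner[OF m'(1), of s' J] c(3) s by simp
      then have "(reflected_corner J k (lattice_point m'), k, s) \<in> reflect_flips (orthant_vector J) (finite_paperfolding (Suc N))"
        unfolding reflect_flips_image orthant_vector_neg by (rule rev_image_eqI) (simp add: s)
      then have "c \<in> translate ((2 ^ Suc N / 2) *\<^sub>R orthant_vector J) (reflect_flips (orthant_vector J) (finite_paperfolding (Suc N)))"
        unfolding c(1) mem_translate m'(2) translate_reflected_corner[symmetric] by simp
      moreover have "open_face (lattice_point m) k \<subseteq> orthant (orthant_vector J)"
        using open_face_lattice_subset_orthant[of m k] False unfolding J_def by simp
      ultimately show ?thesis
        unfolding finite_paperfolding.simps(2)[of "Suc N"] sign_vectors c(1) by blast
    qed
  qed
qed

definition limit_sign :: "'d::{finite,linorder} \<Rightarrow> ('d \<Rightarrow> int) \<Rightarrow> crease \<Rightarrow> bool" where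
  "limit_sign k m s \<longleftrightarrow>
     (if m k = 0 then s = central_sign (lattice_point m) k
      else \<exists>v. exact2 v (m k) \<and> crease_sign s = layer_sign v k m)"

lemma eventually_in_cube:
  "\<forall>\<^sub>F N in sequentially. in_cube N k (m :: 'd::finite \<Rightarrow> int)"
proof -
  have "\<forall>\<^sub>F N in sequentially. \<bar>m i\<bar> < 2 ^ N" for i
  proof -
    have "\<bar>m i\<bar> < 2 ^ N" if "N \<ge> nat \<bar>m i\<bar>" for N
    proof -
      have "nat \<bar>m i\<bar> < 2 ^ N" using that by (meson less_exp order_le_less_trans)
      then show ?thesis by (simp add: nat_less_iff)
    qed
    then show ?thesis by (auto simp: eventually_sequentially)
  qed
  then have "\<forall>\<^sub>F N in sequentially. \<forall>i. \<bar>m i\<bar> < 2 ^ N" by (rule eventually_all_finite)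
  then show ?thesis
  proof eventually_elim
    case (elim N)
    then have "- (2 ^ N) \<le> m i" "m i < 2 ^ N" for i using spec[of _ i, OF elim] by linarith+
    then show ?case using elim by (simp add: in_cube_def)
  qed
qed

lemma paperfolding_structure_closed:
  "(paperfolding_structure :: ('d::{finite,linorder}) pattern) = signed_lattice_faces limit_sign"
proof (intro set_eqI)
  fix c :: "(real^'d::{finite,linorder}) \<times> 'd \<times> crease"
  have ev: "\<forall>\<^sub>F N in sequentially. (in_cube N k m \<and> finite_sign N k m s) = limit_sign k m s"
    for k m s
  proof (cases "m k = 0")
    case True
    show ?thesis using eventually_in_cube[of k m] by eventually_elim (simp add: True finite_sign_def limit_sign_def)
  next
    case False
    then obtain v where v: "exact2 v (m k)" using exact2_ex by blast
    have ex: "exact2 w (m k) \<longleftrightarrow> w = v" for w using v exact2_unique by blast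
    show ?thesis using eventually_in_cube[of k m] eventually_gt_at_top[of "Suc v"]
      by eventually_elim (simp add: False finite_sign_def limit_sign_def ex)
  qed
  have "c \<in> paperfolding_structure \<longleftrightarrow> (\<forall>\<^sub>F N in sequentially. c \<in> finite_paperfolding (Suc N))"
    unfolding paperfolding_structure_def mem_Collect_eq
    by (rule eventually_sequentially_Suc[symmetric])
  also have "\<dots> \<longleftrightarrow> c \<in> signed_lattice_faces limit_sign"
  proof (cases "\<exists>m. fst c = lattice_point m")
    case True
    then obtain m k s where c: "c = (lattice_point m, k, s)" by (cases c) auto
    have "(\<forall>\<^sub>F N in sequentially. in_cube N k m \<and> finite_sign N k m s) \<longleftrightarrow> (\<forall>\<^sub>F N in sequentially. limit_sign k m s)"
      by (rule eventually_cong) (use ev in auto)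
    then show ?thesis
      unfolding finite_paperfolding_closed c mem_signed_lattice_faces by simp
  next
    case False
    then have "c \<notin> signed_lattice_faces Q" for Q :: "'d \<Rightarrow> ('d \<Rightarrow> int) \<Rightarrow> crease \<Rightarrow> bool"
      by (auto simp: signed_lattice_faces_def)
    then show ?thesis unfolding finite_paperfolding_closed by simp
  qed
  finally show "c \<in> paperfolding_structure \<longleftrightarrow> c \<in> signed_lattice_faces limit_sign" .
qed

lemma limit_sign_ex1: "\<exists>!s. limit_sign k m s"
proof (cases "m k = 0")
  case False
  then obtain v where v: "exact2 v (m k)" using exact2_ex by blast
  have ex: "exact2 w (m k) \<longleftrightarrow> w = v" for w using v exact2_unique by blast
  have "\<exists>s. crease_sign s = layer_sign v k m"
    using layer_sign_cases[of v k m] crease_sign.simps by metis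
  then show ?thesis using False ex crease_sign_inject unfolding limit_sign_def by metis
qed (simp add: limit_sign_def)

text \<open>
  Raising \<open>m\<^sub>k\<close> by \<open>2\<^sup>v\<^sup>+\<^sup>1\<close> reverses one digit, at position \<open>v + 1\<close> of \<open>m\<^sub>k\<close>; this is the folding in alternate
  directions along the \<open>k\<close>-th axis, and the source of aperiodicity.
\<close>

lemma limit_sign_flip:
  assumes "exact2 v (m k)" "limit_sign k m s"
  shows "limit_sign k (m(k := m k + 2 ^ Suc v)) (flip s)"
proof -
  have e: "exact2 v (m k + 2 ^ Suc v)" using exact2_add[of v "Suc v" "m k" 1] assms(1) by simp
  have nz: "m k \<noteq> 0" "m k + 2 ^ Suc v \<noteq> 0" using assms(1) e unfolding exact2_def by (metis dvd_0_right)+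
  have s: "crease_sign s = layer_sign v k m"
    using assms nz exact2_unique by (auto simp: limit_sign_def)
  have "layer_sign v k (m(k := m k + 2 ^ Suc v)) = - layer_sign v k m"
    unfolding layer_sign_def
    by (subst (1 2) prod.remove[of _ k])
       (auto simp: face_factor_def bit_sign_add_same simp del: power_Suc intro!: prod.cong)
  then show ?thesis using e nz s by (auto simp: limit_sign_def simp del: power_Suc)
qed

text \<open>
  If \<open>2\<^sup>n\<close> does not divide \<open>m\<^sub>k\<close>, the sign depends on digits at positions at most \<open>n\<close> only.
\<close>

lemma limit_sign_periodic:
  assumes "\<not> 2 ^ n dvd m k"
  shows "limit_sign k (\<lambda>i. m i + 2 ^ Suc n * z i) s \<longleftrightarrow> limit_sign k m s"
proof -
  have nz: "m k \<noteq> 0" using assms by auto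
  then obtain v where v: "exact2 v (m k)" using exact2_ex by blast
  have vn: "v < n" using assms v unfolding exact2_def by (meson dvd_trans le_imp_power_dvd not_le)
  have e: "exact2 v (m k + 2 ^ Suc n * z k)" using exact2_add[of v "Suc n"] v vn by simp
  then have nz': "m k + 2 ^ Suc n * z k \<noteq> 0" by (auto simp: exact2_def)
  have ex: "exact2 w (m k) \<longleftrightarrow> w = v" "exact2 w (m k + 2 ^ Suc n * z k) \<longleftrightarrow> w = v" for w
    using v e exact2_unique by blast+
  have "layer_sign v k (\<lambda>i. m i + 2 ^ Suc n * z i) = layer_sign v k m"
    using vn unfolding layer_sign_def face_factor_def
    by (intro prod.cong) (auto simp: bit_sign_add_high simp del: power_Suc)
  then show ?thesis using nz nz' ex by (simp add: limit_sign_def del: power_Suc)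
qed


section \<open>Patterns of the hull and recognizability\<close>

lemma lattice_point_add: "lattice_point m + lattice_point m' = lattice_point (\<lambda>i. m i + m' i)"
  by (simp add: vec_eq_iff)

lemma agree_on_sym: "agree_on B P Q \<Longrightarrow> agree_on B Q P"
  by (auto simp: agree_on_def)

lemma agree_on_trans: "agree_on B P Q \<Longrightarrow> agree_on B Q V \<Longrightarrow> agree_on B P V"
  by (auto simp: agree_on_def)

lemma agree_on_subset: "agree_on B P Q \<Longrightarrow> A \<subseteq> B \<Longrightarrow> agree_on A P Q"
  unfolding agree_on_def by blast

lemma face_translate: "y \<in> face (x + t) k \<longleftrightarrow> y - t \<in> face x k"
  by (auto simp: face_def algebra_simps)

lemma translate_translate [simp]: "translate s (translate t P) = translate (s + t) P"
  by (auto simp: translate_def image_image case_prod_unfold add_ac)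

lemma agree_on_translate:
  assumes "agree_on B P Q" "(\<lambda>y. y - t) ` A \<subseteq> B"
  shows "agree_on A (translate t P) (translate t Q)"
  unfolding agree_on_def mem_translate
proof (intro allI impI)
  fix x k s assume "face x k \<inter> A \<noteq> {}"
  then obtain y where "y \<in> A" "y \<in> face x k" by blast
  then have "y - t \<in> face (x - t) k" "y - t \<in> B"
    using face_translate[of y "x - t" t k] assms(2) by auto
  then show "((x - t, k, s) \<in> P) = ((x - t, k, s) \<in> Q)" using assms(1) unfolding agree_on_def by blast
qed

lemma agree_on_ball_translate:
  assumes "agree_on (ball 0 (R + norm t)) P Q"
  shows "agree_on (ball 0 R) (translate t P) (translate t Q)"
proof (rule agree_on_translate[OF assms])
  show "(\<lambda>y. y - t) ` ball 0 R \<subseteq> ball 0 (R + norm t)"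
  proof
    fix z assume "z \<in> (\<lambda>y. y - t) ` ball 0 R"
    then obtain y where "z = y - t" "norm y < R" by auto
    then show "z \<in> ball 0 (R + norm t)" using norm_triangle_ineq4[of y t] by simp
  qed
qed

text \<open>
  The property of the hull that the proofs use: every patch occurs in the paperfolding structure. The translation
  of size \<open>\<epsilon>\<close> in the topology is absorbed into \<open>u\<close>.
\<close>

definition locally_paperfolding :: "('d::{finite,linorder}) pattern \<Rightarrow> bool" where
  "locally_paperfolding P \<longleftrightarrow> (\<forall>R. \<exists>u. agree_on (ball 0 R) P (translate u paperfolding_structure))"

lemma topspace_pattern_topology [simp]: "topspace pattern_topology = (UNIV :: ('d::finite) pattern set)"
proof -
  have "openin pattern_topology (UNIV :: 'd pattern set)"
    unfolding openin_pattern_topology by (auto intro: zero_less_one)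
  then show ?thesis using openin_subset by blast
qed

lemma pattern_close_locally_paperfolding:
  assumes "pattern_close \<epsilon> P Q" "locally_paperfolding Q" "\<epsilon> > 0" "R \<le> 1 / \<epsilon>"
  shows "\<exists>u. agree_on (ball 0 R) P (translate u paperfolding_structure)"
proof -
  from assms(1) obtain t where t: "agree_on (ball 0 (1 / \<epsilon>)) P (translate t Q)"
    by (auto simp: pattern_close_def)
  obtain u where "agree_on (ball 0 (R + norm t)) Q (translate u paperfolding_structure)"
    using assms(2) unfolding locally_paperfolding_def by blast
  from agree_on_ball_translate[OF this]
  have "agree_on (ball 0 R) (translate t Q) (translate (t + u) paperfolding_structure)" by simp
  moreover have "agree_on (ball 0 R) P (translate t Q)"
    using agree_on_subset[OF t] assms(4) by (simp add: subset_ball)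
  ultimately show ?thesis using agree_on_trans by blast
qed

text \<open>
  The locally paperfolding patterns contain the orbit and are closed, so they contain its closure.
\<close>

lemma hull_locally_paperfolding:
  assumes "P \<in> paperfolding_hull" shows "locally_paperfolding P"
proof -
  have "closedin pattern_topology {P :: 'a pattern. locally_paperfolding P}"
    unfolding closedin_def openin_pattern_topology topspace_pattern_topology
  proof (intro conjI ballI)
    fix P :: "'a pattern" assume "P \<in> UNIV - {P. locally_paperfolding P}"
    then obtain R where R: "\<And>u. \<not> agree_on (ball 0 R) P (translate u paperfolding_structure)"
      by (auto simp: locally_paperfolding_def)
    define \<epsilon> where "\<epsilon> = 1 / (\<bar>R\<bar> + 1)"
    have \<epsilon>: "\<epsilon> > 0" "R \<le> 1 / \<epsilon>" by (auto simp: \<epsilon>_def)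
    have "Q \<in> UNIV - {P. locally_paperfolding P}" if "pattern_close \<epsilon> P Q" for Q
      using pattern_close_locally_paperfolding[OF that _ \<epsilon>] R by auto
    with \<epsilon>(1) show "\<exists>\<epsilon>>0. \<forall>Q. pattern_close \<epsilon> P Q \<longrightarrow> Q \<in> UNIV - {P. locally_paperfolding P}" by blast
  qed auto
  moreover have "range (\<lambda>t. translate t paperfolding_structure) \<subseteq> {P :: 'a pattern. locally_paperfolding P}"
  proof (intro image_subsetI CollectI)
    fix t :: "real^('a::{finite,linorder})"
    have "agree_on B (translate t paperfolding_structure) (translate t paperfolding_structure)" for B
      by (simp add: agree_on_def)
    then show "locally_paperfolding (translate t paperfolding_structure)"
      unfolding locally_paperfolding_def by blast
  qed
  ultimately show ?thesis
    using closure_of_minimal[of "range (\<lambda>t. translate t paperfolding_structure)" "{P :: 'a pattern. locally_paperfolding P}" pattern_topology] assms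
    unfolding paperfolding_hull_def by blast
qed

definition dyadic_lattice :: "nat \<Rightarrow> (real^('d::finite)) set" where
  "dyadic_lattice n = {t. \<forall>i. t $ i / 2 ^ n \<in> \<int>}"

lemma dyadic_lattice_add: "s \<in> dyadic_lattice n \<Longrightarrow> t \<in> dyadic_lattice n \<Longrightarrow> s + t \<in> dyadic_lattice n"
  by (auto simp: dyadic_lattice_def add_divide_distrib)

lemma dyadic_lattice_minus: "s \<in> dyadic_lattice n \<Longrightarrow> - s \<in> dyadic_lattice n"
  by (auto simp: dyadic_lattice_def)

lemma dyadic_lattice_0 [simp]: "0 \<in> dyadic_lattice n"
  by (auto simp: dyadic_lattice_def)

lemma dyadic_lattice_diff_sym: "s - t \<in> dyadic_lattice n \<Longrightarrow> t - s \<in> dyadic_lattice n"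
  using dyadic_lattice_minus[of "s - t"] by simp

lemma dyadic_lattice_diff_trans:
  "s - t \<in> dyadic_lattice n \<Longrightarrow> t - r \<in> dyadic_lattice n \<Longrightarrow> s - r \<in> dyadic_lattice n"
  using dyadic_lattice_add[of "s - t" n "t - r"] by simp

lemma dyadic_lattice_mono: assumes "m \<le> n" shows "dyadic_lattice n \<subseteq> dyadic_lattice m"
proof
  fix t :: "real^'d" assume t: "t \<in> dyadic_lattice n"
  have "t $ i / 2 ^ m \<in> \<int>" for i
  proof -
    have "(2::real) ^ n = 2 ^ m * 2 ^ (n - m)" using assms by (simp flip: power_add)
    then have "t $ i / 2 ^ m = (t $ i / 2 ^ n) * 2 ^ (n - m)" by (simp add: field_simps)
    also have "\<dots> \<in> \<int>" using t by (intro Ints_mult Ints_power) (auto simp: dyadic_lattice_def)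
    finally show ?thesis .
  qed
  then show "t \<in> dyadic_lattice m" by (simp add: dyadic_lattice_def)
qed

lemma dyadic_latticeE:
  assumes "t \<in> dyadic_lattice n"
  obtains z where "t = lattice_point (\<lambda>i. 2 ^ n * z i)"
proof
  show "t = lattice_point (\<lambda>i. 2 ^ n * \<lfloor>t $ i / 2 ^ n\<rfloor>)"
    using assms by (simp add: dyadic_lattice_def vec_eq_iff of_int_floor field_simps)
qed

lemma dyadic_latticeI: "lattice_point (\<lambda>i. 2 ^ n * z i) \<in> dyadic_lattice n"
  by (simp add: dyadic_lattice_def)

lemma dyadic_lattice_iff:
  "lattice_point m \<in> dyadic_lattice n \<longleftrightarrow> (\<forall>i. 2 ^ n dvd m i)"
proof
  assume "lattice_point m \<in> dyadic_lattice n"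
  then obtain z where "lattice_point m = lattice_point (\<lambda>i. 2 ^ n * z i)" by (elim dyadic_latticeE)
  then show "\<forall>i. 2 ^ n dvd m i" by simp
next
  assume "\<forall>i. 2 ^ n dvd m i"
  then have "m = (\<lambda>i. 2 ^ n * (m i div 2 ^ n))" by simp
  then show "lattice_point m \<in> dyadic_lattice n" using dyadic_latticeI by metis
qed

lemma mem_paperfolding_structure:
  "(lattice_point m, k, s) \<in> paperfolding_structure \<longleftrightarrow> limit_sign k m s"
  by (simp add: paperfolding_structure_closed mem_signed_lattice_faces)

lemma paperfolding_structure_lattice:
  "(x, k, s) \<in> paperfolding_structure \<Longrightarrow> \<exists>m. x = lattice_point m"
  by (auto simp: paperfolding_structure_closed signed_lattice_faces_def)

text \<open>
  Large enough for a ball to contain three faces whose distances are \<open>2\<^sup>n\<close> and \<open>2\<^sup>n\<^sup>+\<^sup>1\<close> in a given residue class.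
\<close>

definition recognition_radius :: "('d::finite) itself \<Rightarrow> nat \<Rightarrow> real" where
  "recognition_radius _ n = real CARD('d) * 2 ^ (n + 3) + 1"

lemma corner_in_face [simp]: "x \<in> face x k"
  by (simp add: face_def)

lemma norm_le_card: fixes x :: "real^'d::finite"
  assumes "\<And>i. \<bar>x $ i\<bar> \<le> b" shows "norm x \<le> real CARD('d) * b"
proof -
  have "norm x \<le> (\<Sum>i\<in>UNIV. \<bar>x $ i\<bar>)" by (rule norm_le_l1_cart)
  also have "\<dots> \<le> (\<Sum>i\<in>(UNIV::'d set). b)" by (intro sum_mono assms)
  finally show ?thesis by simp
qed

text \<open>
  Suppose that \<open>\<delta>\<^sub>k\<close> is an odd multiple of \<open>2\<^sup>j\<close>. Choose a face in the ball whose position is an odd multiple of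
  \<open>2\<^sup>j\<^sup>+\<^sup>1\<close> in the first copy; in the second copy it is an odd multiple of \<open>2\<^sup>j\<close>. Moving the face twice by
  \<open>2\<^sup>j\<^sup>+\<^sup>1\<close> along the \<open>k\<close>-th axis reverses its sign twice according to the second copy, but once according to
  the first.
\<close>

lemma recognizability_step:
  fixes u u' :: "real^'d::{finite,linorder}"
  assumes agr: "agree_on (ball 0 R) (translate u paperfolding_structure) (translate u' paperfolding_structure)"
    and R: "R \<ge> recognition_radius TYPE('d) n" and j: "j < n" and d: "u - u' = lattice_point \<delta>" "\<And>i. 2 ^ j dvd \<delta> i"
  shows "2 ^ Suc j dvd \<delta> k"
proof (rule ccontr)
  assume nd: "\<not> 2 ^ Suc j dvd \<delta> k"
  (* The face x, next to the origin after translation by u; y c is its c-fold shift by 2^(j+1). *)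
  define q where "q = \<lfloor>- (u $ k) / 2 ^ (j+2)\<rfloor>"
  define x where "x i = (if i = k then 2 ^ (j+2) * q + 2 ^ Suc j else \<lfloor>- (u $ i)\<rfloor>)" for i
  have ex: "exact2 (Suc j) (x k)"
  proof -
    have "exact2 (Suc j) (2 ^ Suc j)" by (simp add: exact2_def)
    then have "exact2 (Suc j) (2 ^ Suc j + 2 ^ (j+2) * q)" by (subst exact2_add) auto
    then show ?thesis by (simp add: x_def add.commute)
  qed
  define y where "y c = x(k := x k + 2 ^ Suc j * c)" for c :: int
  have bound: "lattice_point (y c) + u \<in> ball 0 R" if c: "c \<in> {0..2}" for c
  proof -
    have "\<bar>(lattice_point (y c) + u) $ i\<bar> \<le> 2 ^ (n + 3)" for i
    proof (cases "i = k")
      case True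
      have q: "of_int q \<le> - (u $ k) / 2 ^ (j+2)" "- (u $ k) / 2 ^ (j+2) < of_int q + 1"
        unfolding q_def by linarith+
      have a: "2 ^ (j+2) * of_int q \<le> - (u $ k)" "- (u $ k) < 2 ^ (j+2) * of_int q + 2 ^ (j+2)"
        using q by (simp_all add: field_simps)
      have "(lattice_point (y c) + u) $ i = 2 ^ (j+2) * of_int q + 2 ^ Suc j + 2 ^ Suc j * of_int c + u $ k"
        using True by (simp add: y_def x_def)
      moreover have "0 \<le> 2 ^ Suc j * real_of_int c" "2 ^ Suc j * real_of_int c \<le> 2 ^ Suc j * 2" using c by auto
      moreover have "(2::real) ^ (j+2) = 2 * 2 ^ Suc j" "(0::real) < 2 ^ Suc j" by simp_all
      ultimately have "\<bar>(lattice_point (y c) + u) $ i\<bar> \<le> 4 * 2 ^ Suc j" using a by linarith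
      also have "\<dots> \<le> 2 ^ (n+3)"
        using power_increasing[of "Suc j" n "2::real"] j by (simp add: power_add)
      finally show ?thesis .
    next
      case False
      then have "(lattice_point (y c) + u) $ i = of_int \<lfloor>- (u $ i)\<rfloor> + u $ i"
        by (simp add: y_def x_def)
      then have "\<bar>(lattice_point (y c) + u) $ i\<bar> \<le> 1" by linarith
      also have "\<dots> \<le> 2 ^ (n+3)" by simp
      finally show ?thesis .
    qed
    from norm_le_card[of "lattice_point (y c) + u", OF this] show ?thesis
      using R by (simp add: recognition_radius_def)
  qed
  have agree: "limit_sign k (y c) s \<longleftrightarrow> limit_sign k (\<lambda>i. y c i + \<delta> i) s" if "c \<in> {0..2}" for c s
  proof -
    have "face (lattice_point (y c) + u) k \<inter> ball 0 R \<noteq> {}"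
      using bound[OF that] corner_in_face by blast
    then have "(lattice_point (y c) + u, k, s) \<in> translate u paperfolding_structure \<longleftrightarrow>
      (lattice_point (y c) + u, k, s) \<in> translate u' paperfolding_structure"
      using agr unfolding agree_on_def by blast
    then show ?thesis
      unfolding mem_translate add_diff_cancel_right' add_diff_eq[symmetric] d(1) lattice_point_add mem_paperfolding_structure .
  qed
  have nd': "\<not> 2 ^ Suc j dvd y c k + \<delta> k" for c
  proof -
    have "2 ^ Suc j dvd y c k" using ex unfolding y_def exact2_def by simp
    then show ?thesis using nd by (metis dvd_add_right_iff)
  qed
  have ex': "exact2 j (y c k + \<delta> k)" for c
  proof -
    have "2 ^ Suc j dvd y c k" using ex unfolding y_def exact2_def by simp
    then have "2 ^ j dvd y c k" by (meson dvd_trans le_imp_power_dvd lessI less_imp_le)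
    then show ?thesis using d(2)[of k] nd'[of c] unfolding exact2_def by simp
  qed
  obtain s where s: "limit_sign k (y 0) s" using limit_sign_ex1 by blast
  have step: "limit_sign k (\<lambda>i. y (c + 1) i + \<delta> i) (flip s)" if "limit_sign k (\<lambda>i. y c i + \<delta> i) s" for c s
  proof -
    have "(\<lambda>i. y c i + \<delta> i)(k := y c k + \<delta> k + 2 ^ Suc j) = (\<lambda>i. y (c + 1) i + \<delta> i)"
      by (auto simp: y_def algebra_simps)
    then show ?thesis using limit_sign_flip[of j "\<lambda>i. y c i + \<delta> i" k s] ex'[of c] that by simp
  qed
  have "limit_sign k (\<lambda>i. y (0 + 1 + 1) i + \<delta> i) (flip (flip s))"
    using step[OF step[of 0]] agree[of 0 s] s by (simp only: atLeastAtMost_iff) simp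
  moreover have "flip (flip s) = s" by (cases s) auto
  ultimately have "limit_sign k (y 2) s" using agree[of 2 s] by simp
  moreover have "limit_sign k (y 2) (flip s)"
  proof -
    have "(y 0)(k := y 0 k + 2 ^ Suc (Suc j)) = y 2" by (auto simp: y_def)
    then show ?thesis using limit_sign_flip[of "Suc j" "y 0" k s] ex s by (simp add: y_def)
  qed
  ultimately have "s = flip s" using limit_sign_ex1 by blast
  then show False by (cases s) auto
qed

text \<open>
  Matching one face shows that the translations differ by an integer vector; then its divisibility by powers of two
  increases one step at a time.
\<close>

lemma recognizability:
  fixes u u' :: "real^'d::{finite,linorder}"
  assumes agr: "agree_on (ball 0 R) (translate u paperfolding_structure) (translate u' paperfolding_structure)"
    and R: "R \<ge> recognition_radius TYPE('d) n"
  shows "u - u' \<in> dyadic_lattice n"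
proof -
  define m where "m i = \<lfloor>- (u $ i)\<rfloor>" for i
  have "norm (lattice_point m + u) \<le> real CARD('d) * 1"
    by (rule norm_le_card) (simp add: m_def, linarith)
  also have "real CARD('d) * 1 \<le> real CARD('d) * 2 ^ (n + 3)" by (intro mult_left_mono) simp_all
  also have "\<dots> < R" using R by (simp add: recognition_radius_def)
  finally have "lattice_point m + u \<in> ball 0 R" by simp
  then have meet: "face (lattice_point m + u) k \<inter> ball 0 R \<noteq> {}" for k using corner_in_face by blast
  obtain k :: 'd where True by simp
  obtain s where "limit_sign k m s" using limit_sign_ex1 by blast
  then have "(lattice_point m + u, k, s) \<in> translate u paperfolding_structure"
    by (simp add: mem_translate mem_paperfolding_structure)
  with agr meet have "(lattice_point m + u, k, s) \<in> translate u' paperfolding_structure"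
    unfolding agree_on_def by blast
  then obtain m' where "lattice_point m + u - u' = lattice_point m'"
    unfolding mem_translate using paperfolding_structure_lattice by blast
  then have "u - u' = lattice_point (\<lambda>i. m' i - m i)"
    by (simp add: vec_eq_iff algebra_simps)
  then obtain \<delta> where \<delta>: "u - u' = lattice_point \<delta>" by blast
  have "j \<le> n \<Longrightarrow> \<forall>i. 2 ^ j dvd \<delta> i" for j
  proof (induction j)
    case (Suc j)
    then show ?case using recognizability_step[OF agr R _ \<delta>, of j] by auto
  qed simp
  from this[of n] show ?thesis unfolding \<delta> dyadic_lattice_iff by simp
qed

section \<open>Addresses\<close>

text \<open>
  An address of \<open>P\<close> is a translation under which \<open>P\<close> agrees with the paperfolding structure up to
  \<open>2\<^sup>n\<int>\<^sup>d\<close>, on all balls. Over all \<open>n\<close>, the addresses are the coordinates of \<open>P\<close> in the maximal equicontinuous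
  factor, the \<open>d\<close>-dimensional dyadic solenoid.
\<close>

definition address :: "nat \<Rightarrow> real^('d::{finite,linorder}) \<Rightarrow> 'd pattern \<Rightarrow> bool" where
  "address n \<tau> P \<longleftrightarrow>
     (\<forall>R. \<exists>u. u - \<tau> \<in> dyadic_lattice n \<and> agree_on (ball 0 R) P (translate u paperfolding_structure))"

text \<open>
  The translations that fit \<open>P\<close> on larger and larger balls are congruent to the first one by recognizability.
\<close>

lemma address_exists:
  fixes P :: "('d::{finite,linorder}) pattern"
  assumes "locally_paperfolding P" shows "\<exists>\<tau>. address n \<tau> P"
proof -
  let ?r = "recognition_radius TYPE('d) n"
  obtain \<tau> where \<tau>: "agree_on (ball 0 ?r) P (translate \<tau> paperfolding_structure)"
    using assms unfolding locally_paperfolding_def by blast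
  have "\<exists>u. u - \<tau> \<in> dyadic_lattice n \<and> agree_on (ball 0 R) P (translate u paperfolding_structure)" for R
  proof -
    obtain u where u: "agree_on (ball 0 (max R ?r)) P (translate u paperfolding_structure)"
      using assms unfolding locally_paperfolding_def by blast
    have "agree_on (ball 0 ?r) P (translate u paperfolding_structure)"
      "agree_on (ball 0 R) P (translate u paperfolding_structure)"
      by (auto intro: agree_on_subset[OF u])
    from this(1) have "agree_on (ball 0 ?r) (translate u paperfolding_structure) (translate \<tau> paperfolding_structure)"
      using \<tau> by (blast intro: agree_on_sym agree_on_trans)
    then have "u - \<tau> \<in> dyadic_lattice n" by (rule recognizability) simp
    then show ?thesis using \<open>agree_on (ball 0 R) P (translate u paperfolding_structure)\<close> by blast
  qed
  then show ?thesis unfolding address_def by blast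
qed

text \<open>
  Addresses are continuous: they can be read off from one ball.
\<close>

lemma address_agree:
  fixes P Q :: "('d::{finite,linorder}) pattern"
  assumes "address n \<tau> P" "address n \<tau>' Q" "agree_on (ball 0 R) P Q" "R \<ge> recognition_radius TYPE('d) n"
  shows "\<tau> - \<tau>' \<in> dyadic_lattice n"
proof -
  obtain u u' where u: "u - \<tau> \<in> dyadic_lattice n" "agree_on (ball 0 R) P (translate u paperfolding_structure)"
    and u': "u' - \<tau>' \<in> dyadic_lattice n" "agree_on (ball 0 R) Q (translate u' paperfolding_structure)"
    using assms(1,2) unfolding address_def by blast
  have "agree_on (ball 0 R) (translate u paperfolding_structure) (translate u' paperfolding_structure)"
    by (rule agree_on_trans[OF agree_on_sym[OF u(2)] agree_on_trans[OF assms(3) u'(2)]])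
  then have "u - u' \<in> dyadic_lattice n" using assms(4) by (rule recognizability)
  then show ?thesis
    by (rule dyadic_lattice_diff_trans[OF dyadic_lattice_diff_trans[OF dyadic_lattice_diff_sym[OF u(1)]] u'(1)])
qed

lemma address_unique:
  assumes "address n \<tau> P" "address n \<tau>' P" shows "\<tau> - \<tau>' \<in> dyadic_lattice n"
  using address_agree[OF assms, of "recognition_radius TYPE('a) n"] by (simp add: agree_on_def)

lemma address_mono: assumes "address n \<tau> P" "m \<le> n" shows "address m \<tau> P"
  using assms dyadic_lattice_mono unfolding address_def by blast

lemma address_cong: assumes "address n \<tau> P" "\<tau> - \<tau>' \<in> dyadic_lattice n" shows "address n \<tau>' P"
  using assms dyadic_lattice_diff_trans unfolding address_def by blast

lemma address_translate:
  assumes "address n \<tau> P" shows "address n (t + \<tau>) (translate t P)"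
  unfolding address_def
proof
  fix R
  obtain u where u: "u - \<tau> \<in> dyadic_lattice n" "agree_on (ball 0 (R + norm t)) P (translate u paperfolding_structure)"
    using assms unfolding address_def by blast
  have "agree_on (ball 0 R) (translate t P) (translate (t + u) paperfolding_structure)"
    using agree_on_ball_translate[OF u(2)] by simp
  moreover have "(t + u) - (t + \<tau>) \<in> dyadic_lattice n" using u(1) by simp
  ultimately show "\<exists>u. u - (t + \<tau>) \<in> dyadic_lattice n \<and> agree_on (ball 0 R) (translate t P) (translate u paperfolding_structure)"
    by blast
qed

lemma paperfolding_structure_translate_periodic:
  assumes t: "t \<in> dyadic_lattice (Suc n)" and k: "x $ k / 2 ^ n \<notin> \<int>"
  shows "(x + t, k, s) \<in> paperfolding_structure \<longleftrightarrow> (x, k, s) \<in> paperfolding_structure"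
proof -
  obtain z where z: "t = lattice_point (\<lambda>i. 2 ^ Suc n * z i)" using t by (elim dyadic_latticeE)
  show ?thesis
  proof (cases "\<exists>m. x = lattice_point m")
    case True
    then obtain m where m: "x = lattice_point m" by blast
    have "\<not> 2 ^ n dvd m k"
    proof
      assume "2 ^ n dvd m k"
      then obtain c where "m k = 2 ^ n * c" by blast
      then have "x $ k / 2 ^ n = of_int c" using m by simp
      then show False using k by simp
    qed
    then show ?thesis unfolding m z lattice_point_add mem_paperfolding_structure by (rule limit_sign_periodic)
  next
    case False
    moreover have "\<nexists>m. x + t = lattice_point m"
    proof
      assume "\<exists>m. x + t = lattice_point m"
      then obtain m where "x + t = lattice_point m" by blast
      then have "x = lattice_point (\<lambda>i. m i - 2 ^ Suc n * z i)" by (simp add: z vec_eq_iff algebra_simps)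
      then show False using False by blast
    qed
    ultimately show ?thesis using paperfolding_structure_lattice by blast
  qed
qed

text \<open>
  The address modulo \<open>2\<^sup>n\<^sup>+\<^sup>1\<close> determines all faces outside the hyperplanes of spacing \<open>2\<^sup>n\<close>.
\<close>

lemma address_off_slab:
  assumes "address (Suc n) \<tau> P" and k: "(x - \<tau>) $ k / 2 ^ n \<notin> \<int>"
  shows "(x, k, s) \<in> P \<longleftrightarrow> (x - \<tau>, k, s) \<in> paperfolding_structure"
proof -
  obtain u where u: "u - \<tau> \<in> dyadic_lattice (Suc n)" 
    "agree_on (ball 0 (norm x + 1)) P (translate u paperfolding_structure)"
    using assms(1) unfolding address_def by blast
  have "x \<in> ball 0 (norm x + 1)" by simp
  then have "face x k \<inter> ball 0 (norm x + 1) \<noteq> {}" using corner_in_face by blast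
  with u(2) have "(x, k, s) \<in> P \<longleftrightarrow> (x - u, k, s) \<in> paperfolding_structure"
    unfolding agree_on_def mem_translate by blast
  moreover have "x - u = x - \<tau> + - (u - \<tau>)" by simp
  ultimately show ?thesis
    using paperfolding_structure_translate_periodic[OF dyadic_lattice_minus[OF u(1)] k, of s] by metis
qed

lemma address_corner:
  assumes "address n \<tau> P" "(x, k, s) \<in> P" shows "x - \<tau> \<in> dyadic_lattice 0"
proof -
  obtain u where u: "u - \<tau> \<in> dyadic_lattice n" 
    "agree_on (ball 0 (norm x + 1)) P (translate u paperfolding_structure)"
    using assms(1) unfolding address_def by blast
  have "x \<in> ball 0 (norm x + 1)" by simp
  then have "face x k \<inter> ball 0 (norm x + 1) \<noteq> {}" using corner_in_face by blast
  with u(2) assms(2) have "(x - u, k, s) \<in> paperfolding_structure"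
    unfolding agree_on_def mem_translate by blast
  then obtain m where "x - u = lattice_point m" using paperfolding_structure_lattice by blast
  then have "x - u \<in> dyadic_lattice 0" by (simp add: dyadic_lattice_def)
  moreover have "u - \<tau> \<in> dyadic_lattice 0" using u(1) dyadic_lattice_mono by blast
  ultimately show ?thesis using dyadic_lattice_diff_trans by blast
qed


section \<open>Trigonometric polynomials\<close>

definition character :: "real^('d::finite) \<Rightarrow> real^'d \<Rightarrow> complex" where
  "character \<xi> y = cis (2 * pi * (\<xi> \<bullet> y))"

lemma character_add: "character (\<xi> + \<eta>) y = character \<xi> y * character \<eta> y"
  by (simp add: character_def cis_mult inner_add_left distrib_left)

lemma character_add_right: "character \<xi> (x + y) = character \<xi> x * character \<xi> y"
  by (simp add: character_def cis_mult inner_add_right distrib_left)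

lemma cnj_character: "cnj (character \<xi> y) = character (- \<xi>) y"
  by (simp add: character_def cis_cnj)

lemma character_0 [simp]: "character 0 y = 1"
  by (simp add: character_def)

lemma norm_character [simp]: "cmod (character \<xi> y) = 1"
  by (simp add: character_def)

lemma character_mult_minus [simp]: "character \<xi> y * character (- \<xi>) y = 1" "character (- \<xi>) y * character \<xi> y = 1"
  by (simp_all flip: character_add)

lemma continuous_on_character [continuous_intros]: "continuous_on A (character \<xi>)"
  unfolding character_def by (intro continuous_intros)

lemma borel_measurable_character [measurable]: "character \<xi> \<in> borel_measurable borel"
  by (rule borel_measurable_continuous_onI) (rule continuous_on_character)

lemma cis_eq_iff: "cis a = cis b \<longleftrightarrow> (\<exists>z::int. a = b + 2 * pi * of_int z)"
proof -
  have "cis a = cis b \<longleftrightarrow> (\<exists>z::int. \<i> * complex_of_real a = \<i> * complex_of_real b + of_int (2 * z) * pi * \<i>)"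
    unfolding cis_conv_exp exp_eq ..
  also have "\<dots> \<longleftrightarrow> (\<exists>z::int. a = b + 2 * pi * of_int z)"
    by (intro ex_cong1) (auto simp: complex_eq_iff)
  finally show ?thesis .
qed

lemma cis_turn_eq_iff:
  "cis (2 * pi * (a / 2 ^ n)) = cis (2 * pi * (b / 2 ^ n)) \<longleftrightarrow> (\<exists>z::int. a = b + of_int z * 2 ^ n)"
  unfolding cis_eq_iff
proof (intro ex_cong1)
  fix z :: int
  have "2 * pi * (a / 2 ^ n) = 2 * pi * (b / 2 ^ n) + 2 * pi * of_int z \<longleftrightarrow>
    2 * pi * (a / 2 ^ n) = 2 * pi * (b / 2 ^ n + of_int z)" by (simp add: algebra_simps)
  also have "\<dots> \<longleftrightarrow> a / 2 ^ n = b / 2 ^ n + of_int z" unfolding mult_cancel_left by simp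
  also have "\<dots> \<longleftrightarrow> a = b + of_int z * 2 ^ n" by (simp add: field_simps)
  finally show "2 * pi * (a / 2 ^ n) = 2 * pi * (b / 2 ^ n) + 2 * pi * of_int z \<longleftrightarrow> a = b + of_int z * 2 ^ n" .
qed

inductive trig_poly :: "(real^('d::finite)) set \<Rightarrow> (real^'d \<Rightarrow> complex) \<Rightarrow> bool" for \<Gamma> where
  zero: "trig_poly \<Gamma> (\<lambda>y. 0)"
| add_term: "trig_poly \<Gamma> T \<Longrightarrow> \<xi> \<in> \<Gamma> \<Longrightarrow> trig_poly \<Gamma> (\<lambda>y. c * character \<xi> y + T y)"

text \<open>
  Terms with equal frequency are collected, so that coefficients can be compared.
\<close>

lemma trig_poly_sum_form:
  assumes "trig_poly \<Gamma> T"
  shows "\<exists>X c. finite X \<and> X \<subseteq> \<Gamma> \<and> T = (\<lambda>y. \<Sum>\<xi>\<in>X. c \<xi> * character \<xi> y)"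
  using assms
proof induction
  case zero
  show ?case by (rule exI[of _ "{}"]) auto
next
  case (add_term T \<xi> a)
  then obtain X c where X: "finite X" "X \<subseteq> \<Gamma>" "T = (\<lambda>y. \<Sum>\<xi>\<in>X. c \<xi> * character \<xi> y)" by blast
  define c' where "c' \<eta> = (if \<eta> \<in> X then c \<eta> else 0) + (if \<eta> = \<xi> then a else 0)" for \<eta>
  have "a * character \<xi> y + T y = (\<Sum>\<eta>\<in>insert \<xi> X. c' \<eta> * character \<eta> y)" for y
  proof -
    have "(\<Sum>\<eta>\<in>insert \<xi> X. c' \<eta> * character \<eta> y) =
      (\<Sum>\<eta>\<in>insert \<xi> X. if \<eta> \<in> X then c \<eta> * character \<eta> y else 0) + (\<Sum>\<eta>\<in>insert \<xi> X. if \<eta> = \<xi> then a * character \<eta> y else 0)"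
      unfolding sum.distrib[symmetric] by (rule sum.cong) (auto simp: c'_def algebra_simps)
    also have "(\<Sum>\<eta>\<in>insert \<xi> X. if \<eta> \<in> X then c \<eta> * character \<eta> y else 0) = T y"
      unfolding X(3) using X(1) by (intro sum.mono_neutral_cong_right) auto
    also have "(\<Sum>\<eta>\<in>insert \<xi> X. if \<eta> = \<xi> then a * character \<eta> y else 0) = a * character \<xi> y"
      using X(1) by (simp add: sum.delta)
    finally show ?thesis by simp
  qed
  then show ?case using X add_term by (intro exI[of _ "insert \<xi> X"] exI[of _ c']) auto
qed

lemma trig_poly_char: assumes "\<xi> \<in> \<Gamma>" shows "trig_poly \<Gamma> (\<lambda>y. c * character \<xi> y)"
  using trig_poly.add_term[OF trig_poly.zero assms, of c] by simp

lemma trig_poly_add: "trig_poly \<Gamma> S \<Longrightarrow> trig_poly \<Gamma> T \<Longrightarrow> trig_poly \<Gamma> (\<lambda>y. S y + T y)"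
proof (induction rule: trig_poly.induct)
  case (add_term S \<xi> c)
  then show ?case using trig_poly.add_term[of \<Gamma> "\<lambda>y. S y + T y" \<xi> c] by (simp add: add.assoc)
qed simp

lemma trig_poly_sum: "finite A \<Longrightarrow> (\<And>a. a \<in> A \<Longrightarrow> trig_poly \<Gamma> (T a)) \<Longrightarrow> trig_poly \<Gamma> (\<lambda>y. \<Sum>a\<in>A. T a y)"
  by (induction A rule: finite_induct) (auto intro: trig_poly.zero trig_poly_add)

lemma trig_poly_mult_char:
  assumes "trig_poly \<Gamma> T" "\<xi> \<in> \<Gamma>" "\<And>\<eta> \<zeta>. \<eta> \<in> \<Gamma> \<Longrightarrow> \<zeta> \<in> \<Gamma> \<Longrightarrow> \<eta> + \<zeta> \<in> \<Gamma>"
  shows "trig_poly \<Gamma> (\<lambda>y. c * character \<xi> y * T y)"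
  using assms(1)
proof induction
  case zero
  then show ?case using trig_poly.zero[of \<Gamma>] by simp
next
  case (add_term T \<eta> a)
  have "c * character \<xi> y * (a * character \<eta> y + T y) = c * a * character (\<xi> + \<eta>) y + c * character \<xi> y * T y" for y
    by (simp add: character_add algebra_simps)
  then show ?case
    using trig_poly.add_term[OF add_term.IH assms(3)[OF assms(2) add_term.hyps(2)], of "c * a"] by presburger
qed

lemma trig_poly_mult:
  assumes "trig_poly \<Gamma> S" "trig_poly \<Gamma> T" "\<And>\<eta> \<zeta>. \<eta> \<in> \<Gamma> \<Longrightarrow> \<zeta> \<in> \<Gamma> \<Longrightarrow> \<eta> + \<zeta> \<in> \<Gamma>"
  shows "trig_poly \<Gamma> (\<lambda>y. S y * T y)"
  using assms(1)
proof induction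
  case (add_term S \<xi> c)
  then show ?case using trig_poly_add[OF trig_poly_mult_char[OF assms(2) _ assms(3), of \<xi> c] add_term.IH]
    by (simp add: algebra_simps)
qed (simp add: trig_poly.zero)

lemma trig_poly_cnj:
  assumes "trig_poly \<Gamma> T" "\<And>\<xi>. \<xi> \<in> \<Gamma> \<Longrightarrow> - \<xi> \<in> \<Gamma>"
  shows "trig_poly \<Gamma> (\<lambda>y. cnj (T y))"
  using assms(1)
proof induction
  case (add_term T \<xi> c)
  then show ?case using trig_poly.add_term[OF add_term.IH assms(2)[OF add_term.hyps(2)], of "cnj c"]
    by (simp add: cnj_character)
qed (simp add: trig_poly.zero)

lemma trig_poly_mono: "trig_poly \<Gamma> T \<Longrightarrow> \<Gamma> \<subseteq> \<Delta> \<Longrightarrow> trig_poly \<Delta> T"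
  by (induction rule: trig_poly.induct) (auto intro: trig_poly.intros)

text \<open>
  The dual lattice of \<open>2\<^sup>n\<int>\<^sup>d\<close>.
\<close>

definition frequencies :: "nat \<Rightarrow> (real^('d::finite)) set" where
  "frequencies n = {\<xi>. \<forall>i. 2 ^ n * \<xi> $ i \<in> \<int>}"

lemma frequencies_add: "\<xi> \<in> frequencies n \<Longrightarrow> \<eta> \<in> frequencies n \<Longrightarrow> \<xi> + \<eta> \<in> frequencies n"
  by (auto simp: frequencies_def distrib_left)

lemma frequencies_minus: "\<xi> \<in> frequencies n \<Longrightarrow> - \<xi> \<in> frequencies n"
  by (auto simp: frequencies_def)

lemma frequencies_0 [simp]: "0 \<in> frequencies n"
  by (auto simp: frequencies_def)

lemma frequencies_mono: assumes "m \<le> n" shows "frequencies m \<subseteq> frequencies n"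
proof
  fix \<xi> :: "real^'d" assume t: "\<xi> \<in> frequencies m"
  have "2 ^ n * \<xi> $ i \<in> \<int>" for i
  proof -
    have "(2::real) ^ n = 2 ^ (n - m) * 2 ^ m" using assms by (simp flip: power_add)
    then have "2 ^ n * \<xi> $ i = 2 ^ (n - m) * (2 ^ m * \<xi> $ i)" by simp
    also have "\<dots> \<in> \<int>" 
      by (rule Ints_mult[OF Ints_power[OF Ints_numeral]]) (use t in \<open>simp add: frequencies_def\<close>)
    finally show ?thesis .
  qed
  then show "\<xi> \<in> frequencies n" by (simp add: frequencies_def)
qed

lemma frequency_lattice_inner:
  assumes "\<xi> \<in> frequencies n" "t \<in> dyadic_lattice n" shows "\<xi> \<bullet> t \<in> \<int>"
proof -
  have "\<xi> $ i * t $ i \<in> \<int>" for i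
  proof -
    have "\<xi> $ i * t $ i = (2 ^ n * \<xi> $ i) * (t $ i / 2 ^ n)" by simp
    also have "\<dots> \<in> \<int>" 
      by (rule Ints_mult) (use assms in \<open>simp_all add: frequencies_def dyadic_lattice_def\<close>)
    finally show ?thesis .
  qed
  then show ?thesis by (simp add: inner_vec_def Ints_sum)
qed

lemma character_periodic:
  assumes "\<xi> \<in> frequencies n" "t \<in> dyadic_lattice n" shows "character \<xi> t = 1"
proof -
  obtain z where "\<xi> \<bullet> t = of_int z" using frequency_lattice_inner[OF assms] by (elim Ints_cases)
  then show ?thesis using cis_eq_iff[of "2 * pi * of_int z" 0] by (simp add: character_def)
qed

lemma character_cong:
  assumes "\<xi> \<in> frequencies n" "s - t \<in> dyadic_lattice n" shows "character \<xi> s = character \<xi> t"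
  using character_periodic[OF assms] character_add_right[of \<xi> t "s - t"] by simp

definition torus :: "(complex^('d::finite)) set" where
  "torus = {z. \<forall>i. cmod (z $ i) = 1}"

text \<open>
  An embedding of the torus \<open>\<real>\<^sup>d / 2\<^sup>n\<int>\<^sup>d\<close> into a Euclidean space, which makes the Stone--Weierstrass theorem for
  polynomial functions applicable.
\<close>

definition torus_map :: "nat \<Rightarrow> real^('d::finite) \<Rightarrow> complex^'d" where
  "torus_map n y = (\<chi> i. cis (2 * pi * (y $ i / 2 ^ n)))"

lemma torus_map_in_torus [simp]: "torus_map n y \<in> torus"
  by (simp add: torus_def torus_map_def)

lemma torus_map_eq_iff: "torus_map n y = torus_map n y' \<longleftrightarrow> y - y' \<in> dyadic_lattice n"
proof -
  have "(\<exists>z::int. a = b + of_int z * 2 ^ n) \<longleftrightarrow> (a - b) / 2 ^ n \<in> \<int>" for a b :: real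
  proof
    assume "(a - b) / 2 ^ n \<in> \<int>"
    then obtain z where "(a - b) / 2 ^ n = of_int z" by (elim Ints_cases)
    then show "\<exists>z::int. a = b + of_int z * 2 ^ n" by (intro exI[of _ z]) (simp add: field_simps)
  qed auto
  then show ?thesis by (simp only: torus_map_def vec_eq_iff vec_lambda_beta cis_turn_eq_iff dyadic_lattice_def
      mem_Collect_eq vector_minus_component)
qed

lemma continuous_on_torus_map [continuous_intros]: "continuous_on A (torus_map n)"
  unfolding torus_map_def by (intro continuous_intros) auto

lemma torus_map_surj: "torus = torus_map n ` cbox 0 (\<chi> i. 2 ^ n)"
proof (intro subset_antisym subsetI)
  fix z :: "complex^'d" assume z: "z \<in> torus"
  have "\<exists>a. 0 \<le> a \<and> a \<le> 2 ^ n \<and> z $ i = cis (2 * pi * (a / 2 ^ n))" for i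
  proof -
    have "cmod (z $ i) = 1" using z by (simp add: torus_def)
    then obtain t where t: "0 \<le> t" "t < 2 * pi" "z $ i = Complex (cos t) (sin t)"
      using complex_unimodular_polar by metis
    have "t / (2 * pi) * 2 ^ n \<le> 1 * 2 ^ n" using t by (intro mult_right_mono) auto
    then show ?thesis using t by (intro exI[of _ "t / (2 * pi) * 2 ^ n"]) (auto simp: complex_eq_iff)
  qed
  then obtain a where "\<And>i. 0 \<le> a i \<and> a i \<le> 2 ^ n \<and> z $ i = cis (2 * pi * (a i / 2 ^ n))" by metis
  then have "z = torus_map n (\<chi> i. a i)" "(\<chi> i. a i) \<in> cbox 0 (\<chi> i. 2 ^ n)"
    by (simp_all add: torus_map_def vec_eq_iff mem_box_cart)
  then show "z \<in> torus_map n ` cbox 0 (\<chi> i. 2 ^ n)" by blast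
qed auto

lemma compact_torus: "compact (torus :: (complex^'d::finite) set)"
  unfolding torus_map_surj[of 0] by (intro compact_continuous_image continuous_on_torus_map compact_cbox)

text \<open>
  The real and imaginary parts of the coordinates of \<open>torus_map\<close> are trigonometric polynomials, and these form an algebra.
\<close>

lemma trig_poly_polynomial_torus_map:
  assumes "real_polynomial_function (p :: complex^('d::finite) \<Rightarrow> real)"
  shows "trig_poly (frequencies n) (\<lambda>y. complex_of_real (p (torus_map n y)))"
  using assms
proof induction
  case (const c)
  show ?case using trig_poly_char[OF frequencies_0, of n "of_real c"] by simp
next
  case (add f g)
  then show ?case using trig_poly_add by simp
next
  case (mult f g)
  then show ?case using trig_poly_mult[OF mult.IH frequencies_add] by simp
next
  case (linear f)
  have coord: "trig_poly (frequencies n) (\<lambda>y. complex_of_real (torus_map n y \<bullet> b))" if b': "b \<in> Basis" for b :: "complex^'d"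
  proof -
    obtain i u where b: "b = axis i u" "u \<in> Basis" using b' unfolding Basis_vec_def by blast
    define \<xi> :: "real^'d" where "\<xi> = axis i (1 / 2 ^ n)"
    have \<xi>: "\<xi> \<in> frequencies n" "- \<xi> \<in> frequencies n"
      by (auto simp: \<xi>_def frequencies_def axis_def)
    have ch: "torus_map n y $ i = character \<xi> y" for y
      by (simp add: torus_map_def character_def \<xi>_def inner_axis')
    have "u = 1 \<or> u = \<i>" using b(2) by (auto simp: Basis_complex_def)
    then show ?thesis
    proof
      assume "u = 1"
      then have "complex_of_real (torus_map n y \<bullet> b) = 1 / 2 * character \<xi> y + (1 / 2) * character (- \<xi>) y" for y
        unfolding b inner_axis ch cnj_character[symmetric] by (simp add: complex_eq_iff inner_complex_def)
      then show ?thesis using trig_poly_add[OF trig_poly_char[OF \<xi>(1)] trig_poly_char[OF \<xi>(2)], of "1/2" "1/2"] by simp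
    next
      assume "u = \<i>"
      then have "complex_of_real (torus_map n y \<bullet> b) = (- \<i> / 2) * character \<xi> y + (\<i> / 2) * character (- \<xi>) y" for y
        unfolding b inner_axis ch cnj_character[symmetric] by (simp add: complex_eq_iff inner_complex_def)
      then show ?thesis using trig_poly_add[OF trig_poly_char[OF \<xi>(1)] trig_poly_char[OF \<xi>(2)], of "- \<i> / 2" "\<i> / 2"] by simp
    qed
  qed
  have "complex_of_real (f (torus_map n y)) =
    (\<Sum>b\<in>Basis. complex_of_real (f b) * character 0 y * complex_of_real (torus_map n y \<bullet> b))" for y
  proof -
    interpret f: bounded_linear f by (rule linear)
    have "f (torus_map n y) = f (\<Sum>b\<in>Basis. (torus_map n y \<bullet> b) *\<^sub>R b)" by (simp add: euclidean_representation)
    then show ?thesis by (simp add: f.sum f.scaleR mult.commute)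
  qed
  moreover have "trig_poly (frequencies n) (\<lambda>y. \<Sum>b\<in>Basis. complex_of_real (f b) * character 0 y * complex_of_real (torus_map n y \<bullet> b))"
    by (intro trig_poly_sum trig_poly_mult_char coord frequencies_add frequencies_0) auto
  ultimately show ?case by simp
qed

lemma torus_function_approx:
  fixes g :: "complex^('d::finite) \<Rightarrow> complex"
  assumes g: "continuous_on torus g" and \<epsilon>: "\<epsilon> > 0"
  shows "\<exists>T. trig_poly (frequencies n) T \<and> (\<forall>y. cmod (g (torus_map n y) - T y) < \<epsilon>)"
proof -
  have c: "continuous_on torus (\<lambda>z. Re (g z))" "continuous_on torus (\<lambda>z. Im (g z))"
    using g by (auto intro!: continuous_intros)
  have e: "0 < \<epsilon> / 2" using \<epsilon> by simp
  obtain p where p: "real_polynomial_function p" "\<And>z. z \<in> torus \<Longrightarrow> \<bar>Re (g z) - p z\<bar> < \<epsilon> / 2"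
    using Stone_Weierstrass_real_polynomial_function[OF compact_torus c(1) e] by blast
  obtain q where q: "real_polynomial_function q" "\<And>z. z \<in> torus \<Longrightarrow> \<bar>Im (g z) - q z\<bar> < \<epsilon> / 2"
    using Stone_Weierstrass_real_polynomial_function[OF compact_torus c(2) e] by blast
  define T where "T y = complex_of_real (p (torus_map n y)) + \<i> * character 0 y * complex_of_real (q (torus_map n y))" for y
  have "trig_poly (frequencies n) T"
    unfolding T_def by (intro trig_poly_add trig_poly_mult_char trig_poly_polynomial_torus_map p q frequencies_add frequencies_0)
  moreover have "cmod (g (torus_map n y) - T y) < \<epsilon>" for y
  proof -
    have "cmod (g (torus_map n y) - T y) \<le> \<bar>Re (g (torus_map n y) - T y)\<bar> + \<bar>Im (g (torus_map n y) - T y)\<bar>"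
      by (rule cmod_le)
    also have "\<dots> < \<epsilon> / 2 + \<epsilon> / 2"
      using p(2)[of "torus_map n y"] q(2)[of "torus_map n y"] by (intro add_strict_mono) (simp_all add: T_def)
    finally show ?thesis by simp
  qed
  ultimately show ?thesis by blast
qed

text \<open>
  The torus map is a quotient map, because it maps compact sets to closed sets.
\<close>

lemma periodic_function_factors:
  fixes F :: "real^('d::finite) \<Rightarrow> complex"
  assumes F: "continuous_on UNIV F" and per: "\<And>y t. t \<in> dyadic_lattice n \<Longrightarrow> F (y + t) = F y"
  shows "\<exists>g. continuous_on torus g \<and> (\<forall>y. F y = g (torus_map n y))"
proof -
  define g where "g z = F (SOME y. torus_map n y = z)" for z
  have g: "g (torus_map n y) = F y" for y
  proof -
    have "torus_map n (SOME y'. torus_map n y' = torus_map n y) = torus_map n y"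
      by (rule someI[of "\<lambda>y'. torus_map n y' = torus_map n y"]) simp
    then have "(SOME y'. torus_map n y' = torus_map n y) - y \<in> dyadic_lattice n" (is "?y - y \<in> _")
      by (simp add: torus_map_eq_iff)
    from per[OF this, of y] show ?thesis by (simp add: g_def)
  qed
  let ?C = "cbox 0 (\<chi> i. 2 ^ n) :: (real^'d) set"
  have "continuous_on torus g"
    unfolding continuous_on_closed_invariant
  proof (intro allI impI)
    fix B :: "complex set" assume B: "closed B"
    show "\<exists>A. closed A \<and> A \<inter> torus = g -` B \<inter> torus"
    proof (intro exI conjI)
      have "closed (F -` B)" using F B by (simp add: continuous_on_closed_vimage)
      then have "compact (?C \<inter> F -` B)" by (intro compact_Int_closed compact_cbox)
      then show "closed (torus_map n ` (?C \<inter> F -` B))"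
        by (intro compact_imp_closed compact_continuous_image continuous_on_torus_map)
      show "torus_map n ` (?C \<inter> F -` B) \<inter> torus = g -` B \<inter> torus"
        unfolding torus_map_surj[of n] by (auto simp: g simp flip: g)
    qed
  qed
  then show ?thesis using g by metis
qed

lemma periodic_function_approx:
  fixes F :: "real^('d::finite) \<Rightarrow> complex"
  assumes "continuous_on UNIV F" "\<And>y t. t \<in> dyadic_lattice n \<Longrightarrow> F (y + t) = F y" "\<epsilon> > 0"
  shows "\<exists>T. trig_poly (frequencies n) T \<and> (\<forall>y. cmod (F y - T y) < \<epsilon>)"
  using periodic_function_factors[OF assms(1,2)] torus_function_approx[OF _ assms(3)] by metis


section \<open>Means over balls\<close>

definition ball_volume :: "'a::euclidean_space itself \<Rightarrow> real \<Rightarrow> real" where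
  "ball_volume _ R = measure lborel (ball (0::'a) R)"

lemma ball_volume_eq: "R \<ge> 0 \<Longrightarrow> ball_volume TYPE('a::euclidean_space) R = unit_ball_vol DIM('a) * R ^ DIM('a)"
  by (simp add: ball_volume_def content_ball)

lemma ball_volume_pos: "R > 0 \<Longrightarrow> ball_volume TYPE('a::euclidean_space) R > 0"
  by (simp add: ball_volume_eq)

lemma ball_volume_nonneg [simp]: "ball_volume TYPE('a::euclidean_space) R \<ge> 0"
  by (simp add: ball_volume_def)

lemma emeasure_ball_less_top: "emeasure lborel (ball (c::'a::euclidean_space) R) < top"
  using emeasure_lborel_ball_finite[of c R] by (simp add: infinity_ennreal_def)

lemma borel_measurable_cnj [measurable (raw)]:
  "f \<in> borel_measurable M \<Longrightarrow> (\<lambda>x. cnj (f x)) \<in> borel_measurable M"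
  by (rule borel_measurable_continuous_on[where f=cnj]) (auto intro!: continuous_intros)

text \<open>
  Balls are Folner sets: boundary effects vanish in the mean.
\<close>

lemma shell_volume_tendsto:
  "((\<lambda>R. (ball_volume TYPE('a::euclidean_space) (R + a) - ball_volume TYPE('a) (R - a)) / ball_volume TYPE('a) R) \<longlongrightarrow> 0) at_top"
proof -
  have "((\<lambda>R. (1 + a / R) ^ DIM('a) - (1 - a / R) ^ DIM('a)) \<longlongrightarrow> (1 + 0) ^ DIM('a) - (1 - 0) ^ DIM('a)) at_top"
    by (intro tendsto_intros tendsto_divide_0[OF tendsto_const] filterlim_at_top_imp_at_infinity filterlim_ident)
  moreover have "\<forall>\<^sub>F R in at_top. (1 + a / R) ^ DIM('a) - (1 - a / R) ^ DIM('a) =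
     (ball_volume TYPE('a) (R + a) - ball_volume TYPE('a) (R - a)) / ball_volume TYPE('a) R"
    using eventually_gt_at_top[of "\<bar>a\<bar>"]
  proof eventually_elim
    case (elim R)
    then have R: "R > 0" "R + a \<ge> 0" "R - a \<ge> 0" by auto
    have "1 + a / R = (R + a) / R" "1 - a / R = (R - a) / R" using R by (simp_all add: field_simps)
    moreover have "unit_ball_vol (real DIM('a)) \<noteq> 0"
      using unit_ball_vol_pos[of "real DIM('a)"] by linarith
    ultimately show ?case using R
      by (simp add: ball_volume_eq power_divide diff_divide_distrib right_diff_distrib[symmetric] flip: diff_divide_distrib)
  qed
  ultimately have "((\<lambda>R. (ball_volume TYPE('a) (R + a) - ball_volume TYPE('a) (R - a)) / ball_volume TYPE('a) R)
      \<longlongrightarrow> (1 + 0) ^ DIM('a) - (1 - 0) ^ DIM('a)) at_top"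
    by (rule Lim_transform_eventually)
  then show ?thesis by simp
qed

definition ball_mean :: "real \<Rightarrow> ('a::euclidean_space \<Rightarrow> 'b::{banach,second_countable_topology}) \<Rightarrow> 'b" where
  "ball_mean R h = (\<integral>y\<in>ball 0 R. h y \<partial>lborel) /\<^sub>R ball_volume TYPE('a) R"

definition bounded_measurable :: "('a::euclidean_space \<Rightarrow> 'b::{banach,second_countable_topology}) \<Rightarrow> bool" where
  "bounded_measurable h \<longleftrightarrow> h \<in> borel_measurable borel \<and> (\<exists>K. \<forall>y. norm (h y) \<le> K)"

lemma bounded_measurableI: "h \<in> borel_measurable borel \<Longrightarrow> (\<And>y. norm (h y) \<le> K) \<Longrightarrow> bounded_measurable h"
  by (auto simp: bounded_measurable_def)

lemma bounded_measurable_set_integrable: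
  assumes "bounded_measurable h" shows "set_integrable lborel (ball (0::'a::euclidean_space) R) h"
proof -
  obtain K where "h \<in> borel_measurable borel" "\<And>y. norm (h y) \<le> K"
    using assms by (auto simp: bounded_measurable_def)
  then show ?thesis unfolding set_integrable_def
    by (intro integrableI_bounded_set_indicator[of _ _ _ K]) (auto simp: emeasure_ball_less_top)
qed

lemma bounded_measurable_add [intro!]:
  assumes "bounded_measurable f" "bounded_measurable g" shows "bounded_measurable (\<lambda>y. f y + g y)"
proof -
  obtain K L where "f \<in> borel_measurable borel" "\<And>y. norm (f y) \<le> K" "g \<in> borel_measurable borel" "\<And>y. norm (g y) \<le> L"
    using assms by (auto simp: bounded_measurable_def)
  then show ?thesis
    by (intro bounded_measurableI[of _ "K + L"] order.trans[OF norm_triangle_ineq add_mono]) auto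
qed

lemma bounded_measurable_diff [intro!]:
  assumes "bounded_measurable f" "bounded_measurable g" shows "bounded_measurable (\<lambda>y. f y - g y)"
proof -
  obtain K L where "f \<in> borel_measurable borel" "\<And>y. norm (f y) \<le> K" "g \<in> borel_measurable borel" "\<And>y. norm (g y) \<le> L"
    using assms by (auto simp: bounded_measurable_def)
  then show ?thesis
    by (intro bounded_measurableI[of _ "K + L"] order.trans[OF norm_triangle_ineq4 add_mono]) auto
qed

lemma bounded_measurable_mult [intro!]:
  fixes f g :: "'a::euclidean_space \<Rightarrow> 'b::{banach,second_countable_topology,real_normed_algebra}"
  assumes "bounded_measurable f" "bounded_measurable g" shows "bounded_measurable (\<lambda>y. f y * g y)"
proof -
  obtain K L where "f \<in> borel_measurable borel" "\<And>y. norm (f y) \<le> K" "g \<in> borel_measurable borel" "\<And>y. norm (g y) \<le> L"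
    using assms by (auto simp: bounded_measurable_def)
  then show ?thesis
    by (intro bounded_measurableI[of _ "K * L"] borel_measurable_times)
      (auto intro!: order.trans[OF norm_mult_ineq] mult_mono' order.trans[OF norm_ge_zero])
qed

lemma bounded_measurable_const [intro!, simp]: "bounded_measurable (\<lambda>y. c)"
  by (rule bounded_measurableI) auto

lemma bounded_measurable_norm [intro!]: "bounded_measurable f \<Longrightarrow> bounded_measurable (\<lambda>y. norm (f y))"
  by (auto simp: bounded_measurable_def)

lemma bounded_measurable_cnj [intro!]: "bounded_measurable f \<Longrightarrow> bounded_measurable (\<lambda>y. cnj (f y))"
  by (auto simp: bounded_measurable_def)

lemma bounded_measurable_sum [intro!]:
  "(\<And>a. a \<in> A \<Longrightarrow> bounded_measurable (f a)) \<Longrightarrow> bounded_measurable (\<lambda>y. \<Sum>a\<in>A. f a y)"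
  by (induction A rule: infinite_finite_induct) auto

lemma bounded_measurable_shift:
  assumes "bounded_measurable f" shows "bounded_measurable (\<lambda>y. f (y + t))"
proof -
  obtain K where [measurable]: "f \<in> borel_measurable borel" and "\<And>y. norm (f y) \<le> K"
    using assms by (auto simp: bounded_measurable_def)
  then show ?thesis by (intro bounded_measurableI[of _ K]) auto
qed

lemma ball_mean_add:
  "bounded_measurable f \<Longrightarrow> bounded_measurable g \<Longrightarrow> ball_mean R (\<lambda>y. f y + g y) = ball_mean R f + ball_mean R g"
  by (simp add: ball_mean_def bounded_measurable_set_integrable set_integral_add scaleR_add_right)

lemma ball_mean_diff:
  "bounded_measurable f \<Longrightarrow> bounded_measurable g \<Longrightarrow> ball_mean R (\<lambda>y. f y - g y) = ball_mean R f - ball_mean R g"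
  by (simp add: ball_mean_def bounded_measurable_set_integrable set_integral_diff scaleR_diff_right)

lemma ball_mean_mult_left:
  fixes c :: "'b::{real_normed_field,banach,second_countable_topology}"
  shows "ball_mean R (\<lambda>y. c * f y) = c * ball_mean R f"
  by (simp add: ball_mean_def)

lemma ball_mean_of_real: "ball_mean R (\<lambda>y. complex_of_real (f y)) = complex_of_real (ball_mean R f)"
  by (simp add: ball_mean_def set_integral_complex_of_real scaleR_conv_of_real)

lemma ball_mean_sum:
  "(\<And>a. a \<in> A \<Longrightarrow> bounded_measurable (f a)) \<Longrightarrow> ball_mean R (\<lambda>y. \<Sum>a\<in>A. f a y) = (\<Sum>a\<in>A. ball_mean R (f a))"
proof (induction A rule: infinite_finite_induct)
  case (insert a A)
  then show ?case by (simp add: ball_mean_add bounded_measurable_sum)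
qed (auto simp: ball_mean_def)

lemma ball_mean_mono:
  fixes f g :: "'a::euclidean_space \<Rightarrow> real"
  shows "bounded_measurable f \<Longrightarrow> bounded_measurable g \<Longrightarrow> (\<And>y. f y \<le> g y) \<Longrightarrow> ball_mean R f \<le> ball_mean R g"
  unfolding ball_mean_def
  by (intro scaleR_left_mono set_integral_mono bounded_measurable_set_integrable) auto

lemma norm_ball_mean: "norm (ball_mean R f) \<le> ball_mean R (\<lambda>y. norm (f y))"
proof -
  have "norm (\<integral>y. indicator (ball 0 R) y *\<^sub>R f y \<partial>lborel) \<le> (\<integral>y. norm (indicator (ball 0 R) y *\<^sub>R f y) \<partial>lborel)"
    by (rule integral_norm_bound)
  also have "\<dots> = (\<integral>y\<in>ball 0 R. norm (f y) \<partial>lborel)" by (simp add: set_lebesgue_integral_def)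
  finally show ?thesis
    by (simp add: ball_mean_def set_lebesgue_integral_def divide_right_mono mult_left_mono)
qed

lemma ball_mean_const: assumes "R > 0" shows "ball_mean R (\<lambda>y::'a::euclidean_space. c) = c"
proof -
  have "(\<integral>y\<in>ball (0::'a) R. c \<partial>lborel) = measure lborel (ball (0::'a) R) *\<^sub>R c"
    using emeasure_ball_less_top[of "0::'a" R] by (intro set_integral_const) auto
  then show ?thesis
    using ball_volume_pos[OF assms, where 'a='a] by (simp add: ball_mean_def ball_volume_def)
qed

text \<open>
  For functions that vanish off the shell between two balls; this bounds every boundary effect below.
\<close>

lemma norm_integral_shell_le:
  fixes u :: "'a::euclidean_space \<Rightarrow> 'b::{banach,second_countable_topology}"
  assumes [measurable]: "u \<in> borel_measurable borel" and K: "\<And>y. norm (u y) \<le> K" and a: "a \<ge> 0"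
    and out: "\<And>y. norm y \<ge> R + a \<Longrightarrow> u y = 0" and inn: "\<And>y. norm y < R - a \<Longrightarrow> u y = 0"
  shows "norm (\<integral>y. u y \<partial>lborel) \<le> K * (ball_volume TYPE('a) (R + a) - ball_volume TYPE('a) (R - a))"
proof -
  have K0: "K \<ge> 0" using K[of 0] norm_ge_zero order.trans by blast
  have m: "emeasure lborel (ball (0::'a) r) < \<infinity>" for r by (rule emeasure_lborel_ball_finite)
  have sub: "ball (0::'a) (R - a) \<subseteq> ball 0 (R + a)" using a by (intro subset_ball) auto
  let ?S = "ball (0::'a) (R + a) - ball 0 (R - a)"
  have "emeasure lborel ?S \<le> emeasure lborel (ball (0::'a) (R + a))" by (rule emeasure_mono) auto
  then have fS: "emeasure lborel ?S < \<infinity>" using m[of "R + a"] by (rule le_less_trans)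
  have u: "u y = indicator ?S y *\<^sub>R u y" for y
    using out[of y] inn[of y] by (auto simp: indicator_def)
  have "integrable lborel (\<lambda>y. indicator ?S y *\<^sub>R u y)"
    using fS K by (intro integrableI_bounded_set_indicator[of _ _ _ K]) auto
  moreover have "u = (\<lambda>y. indicator ?S y *\<^sub>R u y)" using u by (rule ext)
  ultimately have iu: "integrable lborel u" by metis
  have "norm (\<integral>y. u y \<partial>lborel) \<le> (\<integral>y. norm (u y) \<partial>lborel)" by (rule integral_norm_bound)
  also have "\<dots> \<le> (\<integral>y. K * indicator ?S y \<partial>lborel)"
  proof (rule integral_mono)
    show "integrable lborel (\<lambda>y. norm (u y))" using iu by simp
    show "integrable lborel (\<lambda>y. K * indicator ?S y)" using fS by (intro integrable_mult_right integrable_real_indicator) auto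
    show "norm (u y) \<le> K * indicator ?S y" for y using K[of y] u[of y] by (cases "y \<in> ?S") auto
  qed
  also have "\<dots> = K * measure lborel ?S" by simp
  also have "measure lborel ?S = ball_volume TYPE('a) (R + a) - ball_volume TYPE('a) (R - a)"
    unfolding ball_volume_def using m sub by (intro measure_Diff) (auto simp: less_top)
  finally show ?thesis .
qed

lemma lborel_integral_shift:
  fixes h :: "'a::euclidean_space \<Rightarrow> 'b::{banach,second_countable_topology}"
  assumes [measurable]: "h \<in> borel_measurable borel"
  shows "(\<integral>y. h (y + t) \<partial>lborel) = (\<integral>y. h y \<partial>lborel)"
proof -
  have "(\<integral>y. h y \<partial>lborel) = (\<integral>y. h y \<partial>(distr lborel borel ((+) t)))" by (simp add: lborel_distr_plus)
  also have "\<dots> = (\<integral>y. h (t + y) \<partial>lborel)" by (subst integral_distr) auto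
  finally show ?thesis by (simp add: add.commute)
qed

lemma ball_mean_shift:
  fixes h :: "'a::euclidean_space \<Rightarrow> 'b::{banach,second_countable_topology}"
  assumes "bounded_measurable h"
  shows "((\<lambda>R. ball_mean R (\<lambda>y. h (y + t)) - ball_mean R h) \<longlongrightarrow> 0) at_top"
proof -
  obtain K where hm[measurable]: "h \<in> borel_measurable borel" and K: "\<And>y. norm (h y) \<le> K"
    using assms by (auto simp: bounded_measurable_def)
  have K0: "K \<ge> 0" using K[of 0] norm_ge_zero order.trans by blast
  let ?v = "ball_volume TYPE('a)"
  have bnd: "norm (ball_mean R (\<lambda>y. h (y + t)) - ball_mean R h) \<le> K * ((?v (R + norm t) - ?v (R - norm t)) / ?v R)" for R
  proof -
    let ?u = "\<lambda>y. indicator (ball 0 R) (y - t) *\<^sub>R h y - indicator (ball 0 R) y *\<^sub>R h y"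
    have "(\<integral>y\<in>ball 0 R. h (y + t) \<partial>lborel) = (\<integral>y. indicator (ball 0 R) (y - t) *\<^sub>R h y \<partial>lborel)"
    proof -
      have "(\<lambda>y. indicator (ball 0 R) (y - t) *\<^sub>R h y) \<in> borel_measurable borel"
        by (intro borel_measurable_scaleR measurable_compose[OF _ borel_measurable_indicator, of "\<lambda>y. y - t" _ borel]) auto
      from lborel_integral_shift[OF this, of t] show ?thesis by (simp add: set_lebesgue_integral_def)
    qed
    moreover have "integrable lborel (\<lambda>y. indicator (ball 0 R) (y - t) *\<^sub>R h y)"
    proof -
      have eq: "indicator (ball 0 R) (y - t) = (indicator (ball t R) y :: real)" for y
        by (auto simp: indicator_def dist_norm norm_minus_commute)
      show ?thesis unfolding eq
        using K by (intro integrableI_bounded_set_indicator[of _ _ _ K]) (auto simp: emeasure_ball_less_top)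
    qed
    moreover have "integrable lborel (\<lambda>y. indicator (ball 0 R) y *\<^sub>R h y)"
      using bounded_measurable_set_integrable[OF assms] by (simp add: set_integrable_def)
    ultimately have eq: "(\<integral>y\<in>ball 0 R. h (y + t) \<partial>lborel) - (\<integral>y\<in>ball 0 R. h y \<partial>lborel) = (\<integral>y. ?u y \<partial>lborel)"
      by (simp add: set_lebesgue_integral_def)
    have um: "?u \<in> borel_measurable borel"
    proof -
      have eq: "indicator (ball 0 R) (y - t) = (indicator (ball t R) y :: real)" for y
        by (auto simp: indicator_def dist_norm norm_minus_commute)
      have "ball t R \<in> sets borel" "ball 0 R \<in> sets (borel :: 'a measure)" by simp_all
      then show ?thesis unfolding eq
        by (intro borel_measurable_diff borel_measurable_scaleR borel_measurable_indicator hm)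
    qed
    have "norm (\<integral>y. ?u y \<partial>lborel) \<le> K * (?v (R + norm t) - ?v (R - norm t))"
    proof (rule norm_integral_shell_le)
      show "norm (?u y) \<le> K" for y using K[of y] K0 by (auto simp: indicator_def)
      show "?u y = 0" if "norm y \<ge> R + norm t" for y
      proof -
        have "\<not> norm y < R" "\<not> norm (y - t) < R"
          using that norm_triangle_ineq2[of y t] norm_ge_zero[of t] by linarith+
        then show ?thesis by (simp add: indicator_def)
      qed
      show "?u y = 0" if "norm y < R - norm t" for y
      proof -
        have "norm y < R" "norm (y - t) < R"
          using that norm_triangle_ineq4[of y t] norm_ge_zero[of t] by linarith+
        then show ?thesis by (simp add: indicator_def)
      qed
    qed (simp_all add: um)
    then have "norm ((\<integral>y. ?u y \<partial>lborel) /\<^sub>R ?v R) \<le> K * (?v (R + norm t) - ?v (R - norm t)) / ?v R"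
      by (simp add: divide_right_mono field_simps)
    then show ?thesis by (simp add: ball_mean_def eq[symmetric] scaleR_diff_right)
  qed
  have "((\<lambda>R. K * ((?v (R + norm t) - ?v (R - norm t)) / ?v R)) \<longlongrightarrow> K * 0) at_top"
    by (intro tendsto_intros shell_volume_tendsto)
  then have lim: "((\<lambda>R. K * ((?v (R + norm t) - ?v (R - norm t)) / ?v R)) \<longlongrightarrow> 0) at_top" by simp
  show ?thesis by (rule Lim_null_comparison[OF _ lim]) (use bnd in auto)
qed

text \<open>
  By asymptotic translation invariance the translates of \<open>A\<close> have equal mean, and their indicators add up to at most \<open>1\<close>.
\<close>

lemma ball_mean_disjoint_translates:
  fixes A :: "'a::euclidean_space set"
  assumes A: "A \<in> sets borel" and J: "finite J" "J \<noteq> {}" 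
    and disj: "\<And>y. (\<Sum>t\<in>J. indicator A (y + t)) \<le> (1::real)" and \<epsilon>: "\<epsilon> > 0"
  shows "\<forall>\<^sub>F R in at_top. ball_mean R (indicator A :: 'a \<Rightarrow> real) \<le> 1 / card J + \<epsilon>"
proof -
  let ?h = "indicator A :: 'a \<Rightarrow> real"
  have bm: "bounded_measurable ?h" using A by (intro bounded_measurableI[of _ 1]) (auto simp: indicator_def)
  have ev: "\<forall>\<^sub>F R in at_top. \<forall>t\<in>J. \<bar>ball_mean R (\<lambda>y. ?h (y + t)) - ball_mean R ?h\<bar> < \<epsilon>"
    using J(1) order_tendstoD(2)[OF tendsto_rabs_zero[OF ball_mean_shift[OF bm]] \<epsilon>]
    by (intro eventually_ball_finite) auto
  show ?thesis using ev eventually_gt_at_top[of 0]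
  proof eventually_elim
    case (elim R)
    have "(\<Sum>t\<in>J. ball_mean R (\<lambda>y. ?h (y + t))) = ball_mean R (\<lambda>y. \<Sum>t\<in>J. ?h (y + t))"
      using bounded_measurable_shift[OF bm] by (intro ball_mean_sum[symmetric]) auto
    also have "\<dots> \<le> ball_mean R (\<lambda>y::'a. 1::real)"
      using bounded_measurable_shift[OF bm] disj by (intro ball_mean_mono) auto
    also have "\<dots> = 1" using elim by (simp add: ball_mean_const)
    finally have "(\<Sum>t\<in>J. ball_mean R (\<lambda>y. ?h (y + t))) \<le> 1" .
    moreover have "(\<Sum>t\<in>J. ball_mean R ?h - \<epsilon>) \<le> (\<Sum>t\<in>J. ball_mean R (\<lambda>y. ?h (y + t)))"
      using elim by (intro sum_mono) (auto simp: abs_less_iff dest!: bspec)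
    ultimately have "card J * (ball_mean R ?h - \<epsilon>) \<le> 1" by simp
    moreover have "card J > 0" using J by (simp add: card_gt_0_iff)
    ultimately show ?case by (simp add: field_simps)
  qed
qed

definition has_mean :: "('a::euclidean_space \<Rightarrow> 'b::{banach,second_countable_topology}) \<Rightarrow> 'b \<Rightarrow> bool" where
  "has_mean h m \<longleftrightarrow> ((\<lambda>R. ball_mean R h) \<longlongrightarrow> m) at_top"

definition mean :: "('a::euclidean_space \<Rightarrow> 'b::{banach,second_countable_topology}) \<Rightarrow> 'b" where
  "mean h = Lim at_top (\<lambda>R. ball_mean R h)"

lemma has_mean_mean: "has_mean h m \<Longrightarrow> mean h = m"
  by (simp add: has_mean_def mean_def tendsto_Lim)

lemma has_mean_add: "has_mean f a \<Longrightarrow> has_mean g b \<Longrightarrow> bounded_measurable f \<Longrightarrow> bounded_measurable g \<Longrightarrow> has_mean (\<lambda>y. f y + g y) (a + b)"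
  unfolding has_mean_def by (simp add: ball_mean_add tendsto_add)

lemma has_mean_diff: "has_mean f a \<Longrightarrow> has_mean g b \<Longrightarrow> bounded_measurable f \<Longrightarrow> bounded_measurable g \<Longrightarrow> has_mean (\<lambda>y. f y - g y) (a - b)"
  unfolding has_mean_def by (simp add: ball_mean_diff tendsto_diff)

lemma has_mean_mult_left:
  fixes c :: "'b::{real_normed_field,banach,second_countable_topology}"
  shows "has_mean f a \<Longrightarrow> has_mean (\<lambda>y. c * f y) (c * a)"
  unfolding has_mean_def by (simp add: ball_mean_mult_left tendsto_mult_left)

lemma has_mean_sum:
  "(\<And>x. x \<in> A \<Longrightarrow> has_mean (f x) (a x)) \<Longrightarrow> (\<And>x. x \<in> A \<Longrightarrow> bounded_measurable (f x)) \<Longrightarrow> has_mean (\<lambda>y. \<Sum>x\<in>A. f x y) (\<Sum>x\<in>A. a x)"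
  unfolding has_mean_def by (simp add: ball_mean_sum tendsto_sum)

lemma has_mean_cnj: "has_mean f a \<Longrightarrow> has_mean (\<lambda>y. cnj (f y)) (cnj a)"
proof -
  assume "has_mean f a"
  moreover have "ball_mean R (\<lambda>y. cnj (f y)) = cnj (ball_mean R f)" for R
    by (simp add: ball_mean_def set_lebesgue_integral_def flip: integral_cnj complex_cnj_scaleR)
  ultimately show ?thesis unfolding has_mean_def by (simp add: tendsto_cnj)
qed

lemma has_mean_const: "has_mean (\<lambda>y. c) c"
  unfolding has_mean_def
  by (rule tendsto_eventually, use eventually_gt_at_top[of 0] in eventually_elim) (rule ball_mean_const)

text \<open>
  The averages form a Cauchy filter.
\<close>

lemma has_mean_approx:
  fixes h :: "'a::euclidean_space \<Rightarrow> 'b::{banach,second_countable_topology}"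
  assumes approx: "\<And>\<epsilon>. \<epsilon> > 0 \<Longrightarrow> \<exists>(h' :: 'a \<Rightarrow> 'b) m'. has_mean h' m' \<and> (\<forall>\<^sub>F R in at_top. norm (ball_mean R h - ball_mean R h') \<le> \<epsilon>)"
  shows "\<exists>m. has_mean h m"
proof -
  have "cauchy_filter (filtermap (\<lambda>R. ball_mean R h) at_top)"
    unfolding cauchy_filter_metric_filtermap
  proof (intro allI impI)
    fix \<epsilon> :: real assume "\<epsilon> > 0"
    then have \<epsilon>: "\<epsilon> / 4 > 0" by simp
    obtain h' :: "'a \<Rightarrow> 'b" and m' where h': "has_mean h' m'"
      "\<forall>\<^sub>F R in at_top. norm (ball_mean R h - ball_mean R h') \<le> \<epsilon> / 4" using approx[OF \<epsilon>] by blast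
    have "\<forall>\<^sub>F R in at_top. dist (ball_mean R h) m' < \<epsilon> / 2"
      using h'(2) tendstoD[OF h'(1)[unfolded has_mean_def] \<epsilon>]
    proof eventually_elim
      case (elim R)
      then show ?case using dist_triangle[of "ball_mean R h" m' "ball_mean R h'"] by (simp add: dist_norm)
    qed
    moreover have "dist a b < \<epsilon>" if "dist a m' < \<epsilon> / 2" "dist b m' < \<epsilon> / 2" for a b
      using dist_triangle_half_r[of m' a \<epsilon> b] that by (simp add: dist_commute)
    ultimately show "\<exists>Q. eventually Q at_top \<and> (\<forall>R R'. Q R \<and> Q R' \<longrightarrow> dist (ball_mean R h) (ball_mean R' h) < \<epsilon>)"
      by (intro exI[of _ "\<lambda>R. dist (ball_mean R h) m' < \<epsilon> / 2"]) auto
  qed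
  then have "\<exists>m. filtermap (\<lambda>R. ball_mean R h) at_top \<le> nhds m"
    by (rule cauchy_filter_complete_converges[OF _ complete_UNIV]) (simp_all add: filtermap_bot_iff)
  then show ?thesis by (simp add: has_mean_def filterlim_def)
qed

section \<open>Besicovitch almost periodic functions\<close>

lemma bounded_measurable_character [intro!]: "bounded_measurable (character \<xi>)"
  by (rule bounded_measurableI[of _ 1]) auto

lemma bounded_measurable_trig_poly: "trig_poly \<Gamma> T \<Longrightarrow> bounded_measurable T"
  by (induction rule: trig_poly.induct) auto

text \<open>
  A translation by a vector on which the character is \<open>-1\<close> changes the sign of the mean.
\<close>

lemma has_mean_character:
  assumes "\<xi> \<noteq> 0" shows "has_mean (character \<xi>) 0"
proof -
  define t where "t = (1 / (2 * (\<xi> \<bullet> \<xi>))) *\<^sub>R \<xi>"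
  have "character \<xi> t = -1" using assms by (simp add: character_def t_def)
  then have "ball_mean R (\<lambda>y. character \<xi> (y + t)) = - ball_mean R (character \<xi>)" for R
    using ball_mean_mult_left[of R "-1" "character \<xi>"] by (simp add: character_add_right)
  then have "((\<lambda>R. (-1/2) * (- ball_mean R (character \<xi>) - ball_mean R (character \<xi>))) \<longlongrightarrow> (-1/2) * 0) at_top"
    using ball_mean_shift[of "character \<xi>" t] by (intro tendsto_mult_left) auto
  then show ?thesis by (simp add: has_mean_def)
qed

text \<open>
  Approximability in the mean by trigonometric polynomials that satisfy a common bound. With such a bound, approximation
  in the \<open>L\<^sup>1\<close> mean gives it in the \<open>L\<^sup>2\<close> mean and is inherited by products.
\<close>

definition almost_periodic :: "(real^('d::finite)) set \<Rightarrow> (real^'d \<Rightarrow> complex) \<Rightarrow> bool" where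
  "almost_periodic \<Gamma> F \<longleftrightarrow> F \<in> borel_measurable borel \<and>
     (\<exists>K. (\<forall>y. cmod (F y) \<le> K) \<and>
       (\<forall>\<epsilon>>0. \<exists>T. trig_poly \<Gamma> T \<and> (\<forall>y. cmod (T y) \<le> K) \<and>
          (\<forall>\<^sub>F R in at_top. ball_mean R (\<lambda>y. cmod (F y - T y)) \<le> \<epsilon>)))"

lemma almost_periodic_bounded: "almost_periodic \<Gamma> F \<Longrightarrow> bounded_measurable F"
  by (auto simp: almost_periodic_def bounded_measurable_def)

lemma has_mean_trig_poly: "trig_poly \<Gamma> T \<Longrightarrow> \<exists>m. has_mean T m"
proof (induction rule: trig_poly.induct)
  case zero
  then show ?case using has_mean_const by blast
next
  case (add_term T \<xi> c)
  obtain m where m: "has_mean T m" using add_term.IH by blast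
  obtain b where "has_mean (character \<xi>) b"
  proof (cases "\<xi> = 0")
    case True
    then have "character \<xi> = (\<lambda>y. 1)" by auto
    then show ?thesis using that has_mean_const[of "1::complex", where 'a="real^'a"] by metis
  qed (use that has_mean_character in blast)
  then have "has_mean (\<lambda>y. c * character \<xi> y + T y) (c * b + m)"
    using m bounded_measurable_trig_poly[OF add_term.hyps(1)] by (intro has_mean_add has_mean_mult_left) auto
  then show ?case by blast
qed

lemma almost_periodic_has_mean:
  assumes "almost_periodic \<Gamma> F" shows "has_mean F (mean F)"
proof -
  have bF: "bounded_measurable F" using almost_periodic_bounded[OF assms] .
  have "\<exists>m. has_mean F m"
  proof (rule has_mean_approx)
    fix \<epsilon> :: real assume "\<epsilon> > 0"
    then obtain T where T: "trig_poly \<Gamma> T" "\<forall>\<^sub>F R in at_top. ball_mean R (\<lambda>y. cmod (F y - T y)) \<le> \<epsilon>"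
      using assms unfolding almost_periodic_def by blast
    obtain m where m: "has_mean T m" using has_mean_trig_poly[OF T(1)] by blast
    have "norm (ball_mean R F - ball_mean R T) \<le> ball_mean R (\<lambda>y. cmod (F y - T y))" for R
      using norm_ball_mean[of R "\<lambda>y. F y - T y"] bF bounded_measurable_trig_poly[OF T(1)] by (simp add: ball_mean_diff)
    then have "\<forall>\<^sub>F R in at_top. norm (ball_mean R F - ball_mean R T) \<le> \<epsilon>"
      using T(2) by (auto elim!: eventually_mono intro: order.trans)
    with m show "\<exists>(h' :: real^'a \<Rightarrow> complex) m'. has_mean h' m' \<and> (\<forall>\<^sub>F R in at_top. norm (ball_mean R F - ball_mean R h') \<le> \<epsilon>)" by blast
  qed
  then show ?thesis using has_mean_mean by metis
qed

lemma almost_periodic_cnj: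
  assumes "almost_periodic \<Gamma> F" "\<And>\<xi>. \<xi> \<in> \<Gamma> \<Longrightarrow> - \<xi> \<in> \<Gamma>"
  shows "almost_periodic \<Gamma> (\<lambda>y. cnj (F y))"
proof -
  obtain K where [measurable]: "F \<in> borel_measurable borel" and K: "\<And>y. cmod (F y) \<le> K"
    and ap: "\<And>\<epsilon>. \<epsilon> > 0 \<Longrightarrow> \<exists>T. trig_poly \<Gamma> T \<and> (\<forall>y. cmod (T y) \<le> K) \<and> (\<forall>\<^sub>F R in at_top. ball_mean R (\<lambda>y. cmod (F y - T y)) \<le> \<epsilon>)"
    using assms(1) unfolding almost_periodic_def by blast
  show ?thesis unfolding almost_periodic_def
  proof (intro conjI exI[of _ K] allI impI)
    fix \<epsilon> :: real assume "\<epsilon> > 0"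
    from ap[OF this] obtain T where T: "trig_poly \<Gamma> T" "\<And>y. cmod (T y) \<le> K"
      "\<forall>\<^sub>F R in at_top. ball_mean R (\<lambda>y. cmod (F y - T y)) \<le> \<epsilon>" by blast
    have "cmod (cnj (F y) - cnj (T y)) = cmod (F y - T y)" for y
      by (metis complex_cnj_diff complex_mod_cnj)
    then show "\<exists>T. trig_poly \<Gamma> T \<and> (\<forall>y. cmod (T y) \<le> K) \<and> (\<forall>\<^sub>F R in at_top. ball_mean R (\<lambda>y. cmod (cnj (F y) - T y)) \<le> \<epsilon>)"
      using trig_poly_cnj[OF T(1) assms(2)] T(2,3) by (intro exI[of _ "\<lambda>y. cnj (T y)"]) auto
  qed (use K in auto)
qed

lemma almost_periodic_mult:
  assumes "almost_periodic \<Gamma> F" "almost_periodic \<Gamma> G" "\<And>\<xi> \<eta>. \<xi> \<in> \<Gamma> \<Longrightarrow> \<eta> \<in> \<Gamma> \<Longrightarrow> \<xi> + \<eta> \<in> \<Gamma>"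
  shows "almost_periodic \<Gamma> (\<lambda>y. F y * G y)"
proof -
  obtain K where F [measurable]: "F \<in> borel_measurable borel" and K: "\<And>y. cmod (F y) \<le> K"
    and apF: "\<And>\<epsilon>. \<epsilon> > 0 \<Longrightarrow> \<exists>T. trig_poly \<Gamma> T \<and> (\<forall>y. cmod (T y) \<le> K) \<and> (\<forall>\<^sub>F R in at_top. ball_mean R (\<lambda>y. cmod (F y - T y)) \<le> \<epsilon>)"
    using assms(1) unfolding almost_periodic_def by blast
  obtain L where G [measurable]: "G \<in> borel_measurable borel" and L: "\<And>y. cmod (G y) \<le> L"
    and apG: "\<And>\<epsilon>. \<epsilon> > 0 \<Longrightarrow> \<exists>T. trig_poly \<Gamma> T \<and> (\<forall>y. cmod (T y) \<le> L) \<and> (\<forall>\<^sub>F R in at_top. ball_mean R (\<lambda>y. cmod (G y - T y)) \<le> \<epsilon>)"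
    using assms(2) unfolding almost_periodic_def by blast
  have K0: "K \<ge> 0" "L \<ge> 0" using K[of 0] L[of 0] norm_ge_zero order.trans by blast+
  show ?thesis unfolding almost_periodic_def
  proof (intro conjI exI[of _ "K * L"] allI impI)
    show "cmod (F y * G y) \<le> K * L" for y using K L K0 by (simp add: norm_mult mult_mono)
    fix \<epsilon> :: real assume \<epsilon>: "\<epsilon> > 0"
    define \<delta> where "\<delta> = \<epsilon> / (K + L + 1)"
    have \<delta>: "\<delta> > 0" using \<epsilon> K0 by (simp add: \<delta>_def)
    from apF[OF this] obtain S where S: "trig_poly \<Gamma> S" "\<And>y. cmod (S y) \<le> K"
      "\<forall>\<^sub>F R in at_top. ball_mean R (\<lambda>y. cmod (F y - S y)) \<le> \<delta>" by blast
    from apG[OF \<delta>] obtain T where T: "trig_poly \<Gamma> T" "\<And>y. cmod (T y) \<le> L"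
      "\<forall>\<^sub>F R in at_top. ball_mean R (\<lambda>y. cmod (G y - T y)) \<le> \<delta>" by blast
    note bm = bounded_measurable_trig_poly[OF S(1)] bounded_measurable_trig_poly[OF T(1)]
      almost_periodic_bounded[OF assms(1)] almost_periodic_bounded[OF assms(2)]
    have "\<forall>\<^sub>F R in at_top. ball_mean R (\<lambda>y. cmod (F y * G y - S y * T y)) \<le> \<epsilon>"
      using S(3) T(3)
    proof eventually_elim
      case (elim R)
      have "cmod (F y * G y - S y * T y) \<le> K * cmod (G y - T y) + L * cmod (F y - S y)" for y
      proof -
        have "F y * G y - S y * T y = F y * (G y - T y) + (F y - S y) * T y" by (simp add: algebra_simps)
        also have "cmod \<dots> \<le> cmod (F y) * cmod (G y - T y) + cmod (F y - S y) * cmod (T y)"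
          using norm_triangle_ineq norm_mult by metis
        also have "\<dots> \<le> K * cmod (G y - T y) + cmod (F y - S y) * L"
          using K T(2) by (intro add_mono mult_mono) (auto simp: K0)
        finally show ?thesis by (simp add: mult.commute)
      qed
      then have "ball_mean R (\<lambda>y. cmod (F y * G y - S y * T y)) \<le> ball_mean R (\<lambda>y. K * cmod (G y - T y) + L * cmod (F y - S y))"
        using bm by (intro ball_mean_mono) auto
      also have "\<dots> = K * ball_mean R (\<lambda>y. cmod (G y - T y)) + L * ball_mean R (\<lambda>y. cmod (F y - S y))"
        using bm by (subst ball_mean_add) (auto simp: ball_mean_mult_left)
      also have "\<dots> \<le> K * \<delta> + L * \<delta>" using elim K0 by (intro add_mono mult_left_mono) auto
      also have "\<dots> \<le> (K + L + 1) * \<delta>" using \<delta> by (simp add: algebra_simps)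
      also have "\<dots> = \<epsilon>" using K0 by (simp add: \<delta>_def)
      finally show ?case .
    qed
    moreover have "cmod (S y * T y) \<le> K * L" for y using S T K0 by (simp add: norm_mult mult_mono)
    ultimately show "\<exists>T. trig_poly \<Gamma> T \<and> (\<forall>y. cmod (T y) \<le> K * L) \<and> (\<forall>\<^sub>F R in at_top. ball_mean R (\<lambda>y. cmod (F y * G y - T y)) \<le> \<epsilon>)"
      using trig_poly_mult[OF S(1) T(1) assms(3)] by (intro exI[of _ "\<lambda>y. S y * T y"]) auto
  qed auto
qed

lemma almost_periodic_character:
  assumes "\<xi> \<in> \<Gamma>" shows "almost_periodic \<Gamma> (character \<xi>)"
  unfolding almost_periodic_def
proof (intro conjI exI[of _ 1] allI impI)
  fix \<epsilon> :: real assume "\<epsilon> > 0"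
  then show "\<exists>T. trig_poly \<Gamma> T \<and> (\<forall>y. cmod (T y) \<le> 1) \<and> (\<forall>\<^sub>F R in at_top. ball_mean R (\<lambda>y. cmod (character \<xi> y - T y)) \<le> \<epsilon>)"
    using trig_poly_char[OF assms, of 1] by (intro exI[of _ "character \<xi>"]) (auto simp: ball_mean_def)
qed auto

locale frequency_group =
  fixes \<Gamma> :: "(real^('d::finite)) set"
  assumes add_closed: "\<xi> \<in> \<Gamma> \<Longrightarrow> \<eta> \<in> \<Gamma> \<Longrightarrow> \<xi> + \<eta> \<in> \<Gamma>"
    and minus_closed: "\<xi> \<in> \<Gamma> \<Longrightarrow> - \<xi> \<in> \<Gamma>"
begin

lemma bessel_identity:
  assumes F: "almost_periodic \<Gamma> F" and X: "finite X" "X \<subseteq> \<Gamma>"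
  defines "a \<equiv> (\<lambda>\<xi>. mean (\<lambda>y. F y * character (- \<xi>) y))"
  shows "has_mean (\<lambda>y. complex_of_real ((cmod (F y - (\<Sum>\<xi>\<in>X. c \<xi> * character \<xi> y)))\<^sup>2))
    (mean (\<lambda>y. F y * cnj (F y)) - of_real (\<Sum>\<xi>\<in>X. (cmod (a \<xi>))\<^sup>2) + of_real (\<Sum>\<xi>\<in>X. (cmod (a \<xi> - c \<xi>))\<^sup>2))"
proof -
  note bF = almost_periodic_bounded[OF F]
  have a: "has_mean (\<lambda>y. F y * character (- \<xi>) y) (a \<xi>)" if "\<xi> \<in> X" for \<xi>
    unfolding a_def
    by (rule almost_periodic_has_mean[OF almost_periodic_mult[OF F almost_periodic_character[OF minus_closed] add_closed]])
      (use that X in auto)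
  have a': "has_mean (\<lambda>y. cnj (F y) * character \<xi> y) (cnj (a \<xi>))" if "\<xi> \<in> X" for \<xi>
    using has_mean_cnj[OF a[OF that]] by (simp add: cnj_character)
  have MF: "has_mean (\<lambda>y. F y * cnj (F y)) (mean (\<lambda>y. F y * cnj (F y)))"
    by (rule almost_periodic_has_mean[OF almost_periodic_mult[OF F almost_periodic_cnj[OF F minus_closed] add_closed]])
  have ch: "has_mean (\<lambda>y. character \<xi> y * character (- \<eta>) y) (if \<xi> = \<eta> then 1 else 0)" for \<xi> \<eta> :: "real^'d"
  proof -
    have "(\<lambda>y. character \<xi> y * character (- \<eta>) y) = character (\<xi> - \<eta>)"
      by (simp add: fun_eq_iff flip: character_add)
    moreover have "has_mean (character (\<xi> - \<eta>)) (if \<xi> = \<eta> then 1 else 0)"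
    proof (cases "\<xi> = \<eta>")
      case True
      then have "character (\<xi> - \<eta>) = (\<lambda>y. 1)" by auto
      then show ?thesis using True has_mean_const[of "1::complex", where 'a="real^'d"] by simp
    qed (use has_mean_character[of "\<xi> - \<eta>"] in simp)
    ultimately show ?thesis by simp
  qed
  have expand: "complex_of_real ((cmod (F y - (\<Sum>\<xi>\<in>X. c \<xi> * character \<xi> y)))\<^sup>2) =
     F y * cnj (F y) - (\<Sum>\<xi>\<in>X. cnj (c \<xi>) * (F y * character (- \<xi>) y)) - (\<Sum>\<xi>\<in>X. c \<xi> * (cnj (F y) * character \<xi> y))
     + (\<Sum>\<xi>\<in>X. \<Sum>\<eta>\<in>X. (c \<xi> * cnj (c \<eta>)) * (character \<xi> y * character (- \<eta>) y))" for y
  proof -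
    have "(\<Sum>\<xi>\<in>X. cnj (c \<xi>) * (F y * character (- \<xi>) y)) = F y * cnj (\<Sum>\<xi>\<in>X. c \<xi> * character \<xi> y)"
      by (simp add: sum_distrib_left cnj_character mult_ac)
    moreover have "(\<Sum>\<xi>\<in>X. c \<xi> * (cnj (F y) * character \<xi> y)) = cnj (F y) * (\<Sum>\<xi>\<in>X. c \<xi> * character \<xi> y)"
      by (simp add: sum_distrib_left mult_ac)
    moreover have "(\<Sum>\<xi>\<in>X. \<Sum>\<eta>\<in>X. (c \<xi> * cnj (c \<eta>)) * (character \<xi> y * character (- \<eta>) y))
      = (\<Sum>\<xi>\<in>X. c \<xi> * character \<xi> y) * cnj (\<Sum>\<xi>\<in>X. c \<xi> * character \<xi> y)"
      by (simp add: sum_product cnj_character mult_ac)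
    moreover have "complex_of_real ((cmod z)\<^sup>2) = z * cnj z" for z by (rule complex_norm_square)
    ultimately show ?thesis by (simp add: algebra_simps)
  qed
  have "has_mean (\<lambda>y. F y * cnj (F y) - (\<Sum>\<xi>\<in>X. cnj (c \<xi>) * (F y * character (- \<xi>) y)) - (\<Sum>\<xi>\<in>X. c \<xi> * (cnj (F y) * character \<xi> y))
     + (\<Sum>\<xi>\<in>X. \<Sum>\<eta>\<in>X. (c \<xi> * cnj (c \<eta>)) * (character \<xi> y * character (- \<eta>) y)))
     (mean (\<lambda>y. F y * cnj (F y)) - (\<Sum>\<xi>\<in>X. cnj (c \<xi>) * a \<xi>) - (\<Sum>\<xi>\<in>X. c \<xi> * cnj (a \<xi>))
     + (\<Sum>\<xi>\<in>X. \<Sum>\<eta>\<in>X. (c \<xi> * cnj (c \<eta>)) * (if \<xi> = \<eta> then 1 else 0)))"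
    by (intro has_mean_add has_mean_diff has_mean_sum has_mean_mult_left MF a a' ch
        bounded_measurable_add bounded_measurable_diff bounded_measurable_sum bounded_measurable_mult
        bounded_measurable_const bounded_measurable_cnj bF bounded_measurable_character)
  moreover have "(\<Sum>\<xi>\<in>X. \<Sum>\<eta>\<in>X. (c \<xi> * cnj (c \<eta>)) * (if \<xi> = \<eta> then 1 else 0)) = (\<Sum>\<xi>\<in>X. c \<xi> * cnj (c \<xi>))"
    using X(1) by (simp add: if_distrib[of "\<lambda>x. _ * x"] sum.delta cong: if_cong)
  moreover have "complex_of_real (\<Sum>\<xi>\<in>X. (cmod (a \<xi> - c \<xi>))\<^sup>2) = (\<Sum>\<xi>\<in>X. (a \<xi> - c \<xi>) * cnj (a \<xi> - c \<xi>))"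
    "complex_of_real (\<Sum>\<xi>\<in>X. (cmod (a \<xi>))\<^sup>2) = (\<Sum>\<xi>\<in>X. a \<xi> * cnj (a \<xi>))"
    by (simp_all only: of_real_sum complex_norm_square)
  moreover have "(\<Sum>\<xi>\<in>X. (a \<xi> - c \<xi>) * cnj (a \<xi> - c \<xi>)) =
    (\<Sum>\<xi>\<in>X. a \<xi> * cnj (a \<xi>)) - (\<Sum>\<xi>\<in>X. cnj (c \<xi>) * a \<xi>) - (\<Sum>\<xi>\<in>X. c \<xi> * cnj (a \<xi>)) + (\<Sum>\<xi>\<in>X. c \<xi> * cnj (c \<xi>))"
    by (simp add: algebra_simps sum.distrib sum_subtractf)
  ultimately show ?thesis
    unfolding expand by (simp only: diff_add_eq diff_diff_eq2 add_diff_eq diff_right_commute add_diff_cancel_left' diff_diff_eq) (simp add: algebra_simps)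
qed

lemma parseval:
  assumes F: "almost_periodic \<Gamma> F"
  shows "((\<lambda>\<xi>. (cmod (mean (\<lambda>y. F y * character (- \<xi>) y)))\<^sup>2) has_sum Re (mean (\<lambda>y. F y * cnj (F y)))) \<Gamma>"
    and "Im (mean (\<lambda>y. F y * cnj (F y))) = 0"
proof -
  define a where "a \<xi> = mean (\<lambda>y. F y * character (- \<xi>) y)" for \<xi>
  define M where "M = mean (\<lambda>y. F y * cnj (F y))"
  obtain K where K: "\<And>y. cmod (F y) \<le> K"
    and ap: "\<And>\<epsilon>. \<epsilon> > 0 \<Longrightarrow> \<exists>T. trig_poly \<Gamma> T \<and> (\<forall>y. cmod (T y) \<le> K) \<and> (\<forall>\<^sub>F R in at_top. ball_mean R (\<lambda>y. cmod (F y - T y)) \<le> \<epsilon>)"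
    using F unfolding almost_periodic_def by blast
  have K0: "K \<ge> 0" using K[of 0] norm_ge_zero order.trans by blast
  have id: "((\<lambda>R. ball_mean R (\<lambda>y. (cmod (F y - (\<Sum>\<xi>\<in>X. c \<xi> * character \<xi> y)))\<^sup>2)) \<longlongrightarrow>
     Re M - (\<Sum>\<xi>\<in>X. (cmod (a \<xi>))\<^sup>2) + (\<Sum>\<xi>\<in>X. (cmod (a \<xi> - c \<xi>))\<^sup>2)) at_top \<and> Im M = 0"
    if "finite X" "X \<subseteq> \<Gamma>" for X c
  proof -
    have l: "((\<lambda>R. complex_of_real (ball_mean R (\<lambda>y. (cmod (F y - (\<Sum>\<xi>\<in>X. c \<xi> * character \<xi> y)))\<^sup>2))) \<longlongrightarrow>
     M - of_real (\<Sum>\<xi>\<in>X. (cmod (a \<xi>))\<^sup>2) + of_real (\<Sum>\<xi>\<in>X. (cmod (a \<xi> - c \<xi>))\<^sup>2)) at_top"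
      using bessel_identity[OF F that, of c] unfolding has_mean_def ball_mean_of_real M_def a_def .
    from tendsto_Re[OF l] tendsto_Im[OF l] show ?thesis by (simp add: tendsto_const_iff)
  qed
  show "Im (mean (\<lambda>y. F y * cnj (F y))) = 0" using id[of "{}"] by (simp add: M_def)
  have upper: "(\<Sum>\<xi>\<in>X. (cmod (a \<xi>))\<^sup>2) \<le> Re M" if X: "finite X" "X \<subseteq> \<Gamma>" for X
  proof -
    have "0 \<le> Re M - (\<Sum>\<xi>\<in>X. (cmod (a \<xi>))\<^sup>2) + (\<Sum>\<xi>\<in>X. (cmod (a \<xi> - a \<xi>))\<^sup>2)"
      by (rule tendsto_lowerbound[OF conjunct1[OF id[OF X]]])
        (auto simp: ball_mean_def set_lebesgue_integral_def)
    then show ?thesis by simp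
  qed
  have lower: "\<exists>X. finite X \<and> X \<subseteq> \<Gamma> \<and> Re M - (\<Sum>\<xi>\<in>X. (cmod (a \<xi>))\<^sup>2) \<le> \<epsilon>" if \<epsilon>: "\<epsilon> > 0" for \<epsilon>
  proof -
    define \<delta> where "\<delta> = \<epsilon> / (2 * K + 1)"
    have \<delta>: "\<delta> > 0" using \<epsilon> K0 by (simp add: \<delta>_def)
    from ap[OF \<delta>] obtain T where T: "trig_poly \<Gamma> T" "\<And>y. cmod (T y) \<le> K"
      "\<forall>\<^sub>F R in at_top. ball_mean R (\<lambda>y. cmod (F y - T y)) \<le> \<delta>" by blast
    obtain X c where X: "finite X" "X \<subseteq> \<Gamma>" "T = (\<lambda>y. \<Sum>\<xi>\<in>X. c \<xi> * character \<xi> y)"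
      using trig_poly_sum_form[OF T(1)] by blast
    note bm = bounded_measurable_trig_poly[OF T(1)] almost_periodic_bounded[OF F]
    have sq: "(cmod (F y - T y))\<^sup>2 \<le> (2 * K) * cmod (F y - T y)" for y
    proof -
      have "cmod (F y - T y) \<le> 2 * K" using norm_triangle_ineq4[of "F y" "T y"] K[of y] T(2)[of y] by linarith
      then show ?thesis by (simp add: power2_eq_square mult_right_mono)
    qed
    have "\<forall>\<^sub>F R in at_top. ball_mean R (\<lambda>y. (cmod (F y - T y))\<^sup>2) \<le> \<epsilon>"
      using T(3)
    proof eventually_elim
      case (elim R)
      have "ball_mean R (\<lambda>y. (cmod (F y - T y))\<^sup>2) \<le> ball_mean R (\<lambda>y. (2 * K) * cmod (F y - T y))"
        using bm sq unfolding power2_eq_square by (intro ball_mean_mono) auto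
      also have "\<dots> \<le> 2 * K * \<delta>" unfolding ball_mean_mult_left using elim K0 by (intro mult_left_mono) auto
      also have "\<dots> \<le> (2 * K + 1) * \<delta>" using \<delta> by (simp add: algebra_simps)
      also have "\<dots> = \<epsilon>" using K0 by (simp add: \<delta>_def)
      finally show ?case .
    qed
    then have "Re M - (\<Sum>\<xi>\<in>X. (cmod (a \<xi>))\<^sup>2) + (\<Sum>\<xi>\<in>X. (cmod (a \<xi> - c \<xi>))\<^sup>2) \<le> \<epsilon>"
      unfolding X(3) by (intro tendsto_upperbound[OF conjunct1[OF id[OF X(1,2)]]]) auto
    moreover have "(\<Sum>\<xi>\<in>X. (cmod (a \<xi> - c \<xi>))\<^sup>2) \<ge> 0" by (rule sum_nonneg) simp
    ultimately show ?thesis using X by (intro exI[of _ X]) auto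
  qed
  have "((\<lambda>\<xi>. (cmod (a \<xi>))\<^sup>2) has_sum Re M) \<Gamma>"
    unfolding has_sum_def
  proof (rule tendstoI)
    fix \<epsilon> :: real assume \<epsilon>: "\<epsilon> > 0"
    obtain X where X: "finite X" "X \<subseteq> \<Gamma>" "Re M - (\<Sum>\<xi>\<in>X. (cmod (a \<xi>))\<^sup>2) \<le> \<epsilon> / 2" using lower[of "\<epsilon> / 2"] \<epsilon> by auto
    show "\<forall>\<^sub>F Y in finite_subsets_at_top \<Gamma>. dist (\<Sum>\<xi>\<in>Y. (cmod (a \<xi>))\<^sup>2) (Re M) < \<epsilon>"
      unfolding eventually_finite_subsets_at_top
    proof (intro exI[of _ X] conjI allI impI)
      fix Y assume Y: "finite Y \<and> X \<subseteq> Y \<and> Y \<subseteq> \<Gamma>"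
      then have "(\<Sum>\<xi>\<in>X. (cmod (a \<xi>))\<^sup>2) \<le> (\<Sum>\<xi>\<in>Y. (cmod (a \<xi>))\<^sup>2)" by (intro sum_mono2) auto
      then show "dist (\<Sum>\<xi>\<in>Y. (cmod (a \<xi>))\<^sup>2) (Re M) < \<epsilon>"
        using X(3) upper[of Y] Y \<epsilon> by (simp add: dist_real_def)
    qed (use X in auto)
  qed
  then show "((\<lambda>\<xi>. (cmod (mean (\<lambda>y. F y * character (- \<xi>) y)))\<^sup>2) has_sum Re (mean (\<lambda>y. F y * cnj (F y)))) \<Gamma>"
    by (simp add: a_def M_def)
qed

end


section \<open>Smeared combs are almost periodic\<close>

definition crease_centre :: "(real^('d::finite)) \<times> 'd \<times> crease \<Rightarrow> real^'d" where
  "crease_centre c = face_centre (fst c) (fst (snd c))"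

definition crease_weight :: "('d \<Rightarrow> crease \<Rightarrow> complex) \<Rightarrow> (real^('d::finite)) \<times> 'd \<times> crease \<Rightarrow> complex" where
  "crease_weight w c = w (fst (snd c)) (snd (snd c))"

text \<open>
  The comb of the creases in \<open>Q\<close>, smeared with \<open>f\<close>. Only creases with a nonzero term are summed, so that the sum is finite
  even for infinite \<open>Q\<close>.
\<close>

definition comb :: "('d \<Rightarrow> crease \<Rightarrow> complex) \<Rightarrow> ('d::finite) pattern \<Rightarrow> (real^'d \<Rightarrow> complex) \<Rightarrow> real^'d \<Rightarrow> complex" where
  "comb w Q f y = (\<Sum>c | c \<in> Q \<and> f (y + crease_centre c) \<noteq> 0. crease_weight w c * f (y + crease_centre c))"

lemma comb_eq_sum:
  assumes "finite A" "A \<subseteq> Q" "\<And>c. c \<in> Q \<Longrightarrow> f (y + crease_centre c) \<noteq> 0 \<Longrightarrow> c \<in> A"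
  shows "comb w Q f y = (\<Sum>c\<in>A. crease_weight w c * f (y + crease_centre c))"
  unfolding comb_def using assms by (intro sum.mono_neutral_left) auto

lemma face_centre_nth: "face_centre x k $ i = (if i = k then x $ i else x $ i + 1/2)"
  by (simp add: face_centre_def)

lemma face_centre_add: "face_centre (x + t) k = face_centre x k + t"
  by (simp add: vec_eq_iff face_centre_nth)

lemma finite_functions_into:
  assumes "finite B" shows "finite {m :: 'a::finite \<Rightarrow> 'b. \<forall>i. m i \<in> B}"
proof -
  have "{m :: 'a \<Rightarrow> 'b. \<forall>i. m i \<in> B} = PiE UNIV (\<lambda>_. B)" by (auto simp: PiE_def Pi_def extensional_def)
  then show ?thesis using assms by (simp add: finite_PiE)
qed

lemma weight_bound:
  fixes w :: "'d::finite \<Rightarrow> crease \<Rightarrow> complex" shows "\<exists>C. \<forall>k s. cmod (w k s) \<le> C"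
proof -
  have "cmod (w k s) \<le> (\<Sum>k\<in>UNIV. cmod (w k Valley) + cmod (w k Crest))" for k s
  proof -
    have "cmod (w k s) \<le> cmod (w k Valley) + cmod (w k Crest)" by (cases s) auto
    also have "\<dots> \<le> (\<Sum>k\<in>UNIV. cmod (w k Valley) + cmod (w k Crest))" by (rule member_le_sum) auto
    finally show ?thesis .
  qed
  then show ?thesis by blast
qed

lemma test_functionD:
  assumes "test_function f"
  shows "continuous_on UNIV f" "\<exists>\<rho>>0. \<forall>x. f x \<noteq> 0 \<longrightarrow> norm x \<le> \<rho>" "\<exists>K. \<forall>x. cmod (f x) \<le> K"
    and "f \<in> borel_measurable borel"
proof -
  show c: "continuous_on UNIV f" using assms by (simp add: test_function_def)
  then show "f \<in> borel_measurable borel" by (rule borel_measurable_continuous_onI)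
  let ?S = "closure {x. f x \<noteq> 0}"
  have cS: "compact ?S" using assms by (simp add: test_function_def)
  then have "bounded ?S" by (rule compact_imp_bounded)
  then obtain \<rho> where "\<forall>x\<in>?S. norm x \<le> \<rho>" unfolding bounded_iff ..
  then have "\<forall>x. f x \<noteq> 0 \<longrightarrow> norm x \<le> max \<rho> 1" using closure_subset[of "{x. f x \<noteq> 0}"] by force
  then show "\<exists>\<rho>>0. \<forall>x. f x \<noteq> 0 \<longrightarrow> norm x \<le> \<rho>" by (intro exI[of _ "max \<rho> 1"]) auto
  have "compact (f ` ?S)" by (rule compact_continuous_image[OF continuous_on_subset[OF c subset_UNIV] cS])
  then have "bounded (f ` ?S)" by (rule compact_imp_bounded)
  then obtain K where "\<forall>z\<in>f ` ?S. cmod z \<le> K" unfolding bounded_iff ..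
  then have K: "\<And>x. x \<in> ?S \<Longrightarrow> cmod (f x) \<le> K" by blast
  have "cmod (f x) \<le> max K 0" for x
    using K[of x] closure_subset[of "{x. f x \<noteq> 0}"] by (cases "f x = 0") (auto simp: le_max_iff_disj)
  then show "\<exists>K. \<forall>x. cmod (f x) \<le> K" by blast
qed

lemma test_functionI:
  assumes "continuous_on UNIV f" "\<And>x. f x \<noteq> 0 \<Longrightarrow> norm x \<le> \<rho>" shows "test_function f"
proof -
  have "closure {x. f x \<noteq> 0} \<subseteq> cball 0 \<rho>" using assms(2) by (intro closure_minimal) auto
  then have "compact (closure {x. f x \<noteq> 0})" by (meson bounded_cball bounded_subset closed_closure compact_eq_bounded_closed)
  then show ?thesis using assms(1) by (simp add: test_function_def)
qed

lemma integrable_bounded_support: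
  fixes h :: "'a::euclidean_space \<Rightarrow> 'b::{banach,second_countable_topology}"
  assumes "h \<in> borel_measurable borel" "\<And>y. norm (h y) \<le> K" "\<And>y. h y \<noteq> 0 \<Longrightarrow> norm y \<le> \<rho>"
  shows "integrable lborel h"
proof -
  have "integrable lborel (\<lambda>y. indicator (cball 0 \<rho>) y *\<^sub>R h y)"
    using assms(1,2) emeasure_lborel_cball_finite[of "0::'a" \<rho>]
    by (intro integrableI_bounded_set_indicator[of _ _ _ K]) auto
  moreover have "h = (\<lambda>y. indicator (cball 0 \<rho>) y *\<^sub>R h y)"
    using assms(3) by (auto simp: fun_eq_iff indicator_def)
  ultimately show ?thesis by metis
qed

lemma integrable_test_function: "test_function f \<Longrightarrow> integrable lborel f"
  using test_functionD(2-4)[of f] integrable_bounded_support by metis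

lemma integrable_test_mult:
  assumes "test_function f" "g \<in> borel_measurable borel" "\<And>y. cmod (g y) \<le> K"
  shows "integrable lborel (\<lambda>y. f (y + p) * g y)"
proof -
  obtain \<rho> L where f: "\<And>x. f x \<noteq> 0 \<Longrightarrow> norm x \<le> \<rho>" "\<And>x. cmod (f x) \<le> L" and [measurable]: "f \<in> borel_measurable borel"
    using test_functionD[OF assms(1)] by blast
  note [measurable] = assms(2)
  have K0: "K \<ge> 0" using assms(3)[of 0] norm_ge_zero order.trans by blast
  show ?thesis
  proof (rule integrable_bounded_support[of _ "L * K" "\<rho> + norm p"])
    show "cmod (f (y + p) * g y) \<le> L * K" for y
      unfolding norm_mult using f(2) assms(3) K0 by (intro mult_mono') auto
    show "norm y \<le> \<rho> + norm p" if "f (y + p) * g y \<noteq> 0" for y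
    proof -
      have "norm (y + p) \<le> \<rho>" using that f(1) by auto
      then show ?thesis using norm_triangle_ineq4[of "y + p" p] by simp
    qed
  qed measurable
qed

text \<open>
  Cutting \<open>v\<close> off at the sphere of radius \<open>R\<close> with an error in a shell of fixed width does not affect the mean. The
  autocorrelation is defined by combs cut off in this way.
\<close>

lemma has_mean_truncation:
  fixes v :: "'a::euclidean_space \<Rightarrow> complex"
  assumes v: "bounded_measurable v" "has_mean v m" and u: "\<And>R. u R \<in> borel_measurable borel" "\<And>R y. cmod (u R y) \<le> K"
    and \<rho>: "\<rho> \<ge> 0"
    and inn: "\<And>R y. norm y < R - \<rho> \<Longrightarrow> u R y = v y" and out: "\<And>R y. norm y \<ge> R + \<rho> \<Longrightarrow> u R y = 0"
  shows "((\<lambda>R. (\<integral>y. u R y \<partial>lborel) / complex_of_real (ball_volume TYPE('a) R)) \<longlongrightarrow> m) at_top"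
proof -
  obtain L where vm: "v \<in> borel_measurable borel" and L: "\<And>y. cmod (v y) \<le> L"
    using v(1) by (auto simp: bounded_measurable_def)
  have L0: "L \<ge> 0" "K \<ge> 0" using L[of 0] u(2)[of 0 0] norm_ge_zero order.trans by blast+
  let ?v = "ball_volume TYPE('a)"
  have bnd: "cmod ((\<integral>y. u R y \<partial>lborel) / complex_of_real (?v R) - ball_mean R v) \<le> (K + L) * ((?v (R + \<rho>) - ?v (R - \<rho>)) / ?v R)" for R
  proof -
    have iv: "integrable lborel (\<lambda>y. indicator (ball 0 R) y *\<^sub>R v y)"
      using bounded_measurable_set_integrable[OF v(1)] by (simp add: set_integrable_def)
    have iu: "integrable lborel (u R)"
      by (rule integrable_bounded_support[OF u(1) u(2), of _ "R + \<rho>"]) (use out in force)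
    have "cmod (\<integral>y. u R y - indicator (ball 0 R) y *\<^sub>R v y \<partial>lborel) \<le> (K + L) * (?v (R + \<rho>) - ?v (R - \<rho>))"
    proof (rule norm_integral_shell_le)
      show "(\<lambda>y. u R y - indicator (ball 0 R) y *\<^sub>R v y) \<in> borel_measurable borel"
        using borel_measurable_integrable[OF iu] borel_measurable_integrable[OF iv] by simp
      show "cmod (u R y - indicator (ball 0 R) y *\<^sub>R v y) \<le> K + L" for y
      proof -
        have "cmod (indicator (ball 0 R) y *\<^sub>R v y) \<le> L" using L[of y] L0 by (auto simp: indicator_def)
        then show ?thesis using u(2)[of R y] norm_triangle_ineq4[of "u R y"] by (meson add_mono order.trans)
      qed
      show "u R y - indicator (ball 0 R) y *\<^sub>R v y = 0" if "R + \<rho> \<le> norm y" for y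
        using out[OF that] that \<rho> by (simp add: indicator_def)
      show "u R y - indicator (ball 0 R) y *\<^sub>R v y = 0" if "norm y < R - \<rho>" for y
        using inn[OF that] that \<rho> by (simp add: indicator_def)
    qed (use \<rho> in auto)
    then have "cmod ((\<integral>y. u R y \<partial>lborel) - (\<integral>y. indicator (ball 0 R) y *\<^sub>R v y \<partial>lborel)) \<le> (K + L) * (?v (R + \<rho>) - ?v (R - \<rho>))"
      using iu iv by simp
    then have "cmod (((\<integral>y. u R y \<partial>lborel) - (\<integral>y. indicator (ball 0 R) y *\<^sub>R v y \<partial>lborel)) / complex_of_real (?v R))
      \<le> (K + L) * (?v (R + \<rho>) - ?v (R - \<rho>)) / ?v R"
      unfolding norm_divide by (simp add: divide_right_mono)
    then show ?thesis
      by (simp add: ball_mean_def set_lebesgue_integral_def diff_divide_distrib scaleR_conv_of_real field_simps)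
  qed
  have "((\<lambda>R. (K + L) * ((?v (R + \<rho>) - ?v (R - \<rho>)) / ?v R)) \<longlongrightarrow> (K + L) * 0) at_top"
    by (intro tendsto_intros shell_volume_tendsto)
  then have lim: "((\<lambda>R. (K + L) * ((?v (R + \<rho>) - ?v (R - \<rho>)) / ?v R)) \<longlongrightarrow> 0) at_top" by simp
  have "((\<lambda>R. (\<integral>y. u R y \<partial>lborel) / complex_of_real (?v R) - ball_mean R v) \<longlongrightarrow> 0) at_top"
    by (rule Lim_null_comparison[OF _ lim]) (use bnd in auto)
  from tendsto_add[OF this v(2)[unfolded has_mean_def]] show ?thesis by simp
qed

definition correlation :: "(real^('d::finite) \<Rightarrow> complex) \<Rightarrow> (real^'d \<Rightarrow> complex) \<Rightarrow> real^'d \<Rightarrow> complex" where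
  "correlation f g x = (\<integral>y. f y * cnj (g (y - x)) \<partial>lborel)"

lemma self_convolution_correlation: "self_convolution f = correlation f f"
  by (simp add: fun_eq_iff self_convolution_def correlation_def)

text \<open>
  The autocorrelation of \<open>f * g\<^sup>~\<close> is an integral of products of smeared combs: the correlation at the distance of two
  points is an inner product of the functions placed at these points.
\<close>

lemma correlation_diff:
  assumes [measurable]: "f \<in> borel_measurable borel" "g \<in> borel_measurable borel"
  shows "correlation f g (p - q) = (\<integral>y. f (y + p) * cnj (g (y + q)) \<partial>lborel)"
  using lborel_integral_shift[of "\<lambda>y. f y * cnj (g (y - (p - q)))" p]
  by (simp add: correlation_def algebra_simps)

definition autocorrelation_sum ::
  "('d \<Rightarrow> crease \<Rightarrow> complex) \<Rightarrow> ('d::finite) pattern \<Rightarrow> (real^'d \<Rightarrow> complex) \<Rightarrow> real \<Rightarrow> complex" where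
  "autocorrelation_sum w P g R =
     (\<Sum>c\<in>creases_in_ball P R. \<Sum>c'\<in>creases_in_ball P R.
        crease_weight w c * cnj (crease_weight w c') * g (crease_centre c - crease_centre c'))
     / complex_of_real (ball_volume TYPE(real^'d) R)"

lemma is_autocorrelation_iff:
  "is_autocorrelation P w \<gamma> \<longleftrightarrow> (\<forall>g. test_function g \<longrightarrow> (autocorrelation_sum w P g \<longlongrightarrow> \<gamma> g) at_top)"
  unfolding is_autocorrelation_def autocorrelation_sum_def ball_volume_def crease_centre_def crease_weight_def
  by (simp add: case_prod_unfold)

lemma creases_in_ball_eq: "creases_in_ball P R = {c \<in> P. norm (crease_centre c) < R}"
  by (auto simp: creases_in_ball_def crease_centre_def)

text \<open>
  Slabs of half width \<open>\<rho>\<close> around hyperplanes of spacing \<open>L\<close>, translated by the multiples \<open>0, \<dots>, m - 1\<close> of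
  \<open>2\<rho> + 1\<close>: two of these translations differ by at least \<open>2\<rho> + 1\<close>, more than the width, and by at most
  \<open>L - (2\<rho> + 1)\<close>, less than what reaches the next hyperplane.
\<close>

lemma slab_translates_disjoint:
  fixes j j' m :: nat and z z' :: int and a \<rho> L :: real
  assumes a: "\<bar>a + j * (2 * \<rho> + 1) + z * L\<bar> \<le> \<rho>" "\<bar>a + j' * (2 * \<rho> + 1) + z' * L\<bar> \<le> \<rho>"
    and j: "j < m" "j' < m" and L: "m * (2 * \<rho> + 1) \<le> L" and \<rho>: "\<rho> \<ge> 0"
  shows "j = j'"
proof (rule ccontr)
  assume ne: "j \<noteq> j'"
  define D where "D = real j - real j'"
  have D: "1 \<le> \<bar>D\<bar>" "\<bar>D\<bar> \<le> real m - 1" using ne j by (auto simp: D_def)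
  define s where "s = D * (2 * \<rho> + 1)"
  have s1: "2 * \<rho> + 1 \<le> \<bar>s\<bar>" using mult_right_mono[OF D(1), of "2 * \<rho> + 1"] \<rho> by (simp add: s_def abs_mult)
  have "\<bar>s\<bar> \<le> (real m - 1) * (2 * \<rho> + 1)" using mult_right_mono[OF D(2), of "2 * \<rho> + 1"] \<rho> by (simp add: s_def abs_mult)
  then have s2: "\<bar>s\<bar> \<le> L - (2 * \<rho> + 1)" using L by (simp add: algebra_simps)
  have q: "\<bar>s + (z - z') * L\<bar> \<le> 2 * \<rho>"
  proof -
    have "s + (z - z') * L = (a + j * (2 * \<rho> + 1) + z * L) - (a + j' * (2 * \<rho> + 1) + z' * L)"
      by (simp add: s_def D_def algebra_simps)
    then show ?thesis using a by linarith
  qed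
  show False
  proof (cases "z = z'")
    case True
    then show False using q s1 by simp
  next
    case False
    then have "1 \<le> \<bar>real_of_int (z - z')\<bar>" by linarith
    then have "L \<le> \<bar>(z - z') * L\<bar>" using mult_right_mono[of 1 "\<bar>real_of_int (z - z')\<bar>" L] s1 s2 \<rho>
      by (simp add: abs_mult)
    then show False using q s2 by linarith
  qed
qed

definition dyadic_frequencies :: "(real^('d::finite)) set" where
  "dyadic_frequencies = (\<Union>n. frequencies n)"

lemma frequency_group_dyadic: "frequency_group (dyadic_frequencies :: (real^('d::finite)) set)"
proof
  fix \<xi> \<eta> :: "real^'d" assume "\<xi> \<in> dyadic_frequencies" "\<eta> \<in> dyadic_frequencies"
  then obtain m n where "\<xi> \<in> frequencies m" "\<eta> \<in> frequencies n" by (auto simp: dyadic_frequencies_def)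
  then have "\<xi> \<in> frequencies (max m n)" "\<eta> \<in> frequencies (max m n)"
    using frequencies_mono[of m "max m n"] frequencies_mono[of n "max m n"] by auto
  then show "\<xi> + \<eta> \<in> dyadic_frequencies" unfolding dyadic_frequencies_def using frequencies_add by blast
next
  fix \<xi> :: "real^'d" assume "\<xi> \<in> dyadic_frequencies"
  then show "- \<xi> \<in> dyadic_frequencies" unfolding dyadic_frequencies_def using frequencies_minus by blast
qed

locale paperfolding_comb =
  fixes P :: "('d::{finite,linorder}) pattern" and w :: "'d \<Rightarrow> crease \<Rightarrow> complex"
  assumes loc: "locally_paperfolding P"
begin

lemma corner_diff: "(x, k, s) \<in> P \<Longrightarrow> (x', k', s') \<in> P \<Longrightarrow> x - x' \<in> dyadic_lattice 0"
  using address_exists[OF loc, of 0] address_corner dyadic_lattice_diff_trans dyadic_lattice_diff_sym by metis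

text \<open>
  The corners relative to \<open>y\<close> have distinct integer parts, and these are bounded independently of \<open>y\<close>.
\<close>

lemma local_finiteness:
  "\<exists>N. \<forall>y. finite {c \<in> P. norm (y + crease_centre c) \<le> \<rho>} \<and> card {c \<in> P. norm (y + crease_centre c) \<le> \<rho>} \<le> N"
proof -
  define M where "M = \<lceil>\<rho>\<rceil> + 2"
  define B :: "(('d \<Rightarrow> int) \<times> 'd \<times> crease) set" where "B = {m. \<forall>i. m i \<in> {-M..M}} \<times> UNIV \<times> {Valley, Crest}"
  have fB: "finite B" unfolding B_def by (intro finite_cartesian_product finite_functions_into) auto
  define g where "g y = (\<lambda>(x :: (real, 'd) vec, k :: 'd, s :: crease). ((\<lambda>i. \<lfloor>(x + y) $ i\<rfloor>), k, s))" for y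
  have inj: "inj_on (g y) {c \<in> P. norm (y + crease_centre c) \<le> \<rho>}" for y
  proof (rule inj_onI)
    fix c c' assume c: "c \<in> {c \<in> P. norm (y + crease_centre c) \<le> \<rho>}" "c' \<in> {c \<in> P. norm (y + crease_centre c) \<le> \<rho>}"
      and eq: "g y c = g y c'"
    obtain x k s x' k' s' where xs: "c = (x, k, s)" "c' = (x', k', s')" by (cases c, cases c') auto
    have "x - x' \<in> dyadic_lattice 0" using corner_diff c xs by auto
    then obtain z where z: "x - x' = lattice_point (\<lambda>i. 2 ^ 0 * z i)" by (elim dyadic_latticeE)
    have "x $ i = x' $ i" for i
    proof -
      have "\<lfloor>(x + y) $ i\<rfloor> = \<lfloor>(x' + y) $ i\<rfloor>" using eq xs by (auto simp: g_def fun_eq_iff)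
      moreover have "x $ i = x' $ i + of_int (z i)" using z by (simp add: vec_eq_iff algebra_simps)
      then have "(x + y) $ i = (x' + y) $ i + of_int (z i)" by simp
      ultimately have "z i = 0" by linarith
      then show ?thesis using \<open>x $ i = x' $ i + of_int (z i)\<close> by simp
    qed
    then show "c = c'" using eq xs by (simp add: g_def vec_eq_iff)
  qed
  have sub: "g y ` {c \<in> P. norm (y + crease_centre c) \<le> \<rho>} \<subseteq> B" for y
  proof
    fix b assume "b \<in> g y ` {c \<in> P. norm (y + crease_centre c) \<le> \<rho>}"
    then obtain x k s where b: "b = g y (x, k, s)" "norm (y + crease_centre (x, k, s)) \<le> \<rho>" by auto
    have "\<lfloor>(x + y) $ i\<rfloor> \<in> {-M..M}" for i
    proof -
      have "\<bar>(y + crease_centre (x, k, s)) $ i\<bar> \<le> \<rho>" using b(2) component_le_norm_cart order.trans by blast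
      then have "\<bar>y $ i + face_centre x k $ i\<bar> \<le> \<rho>" by (simp add: crease_centre_def)
      then have "\<bar>(x + y) $ i\<bar> \<le> \<rho> + 1" by (simp add: face_centre_nth split: if_splits)
      then show ?thesis unfolding M_def by (simp, linarith)
    qed
    moreover have "s \<in> {Valley, Crest}" by (cases s) auto
    ultimately show "b \<in> B" unfolding b B_def g_def by auto
  qed
  have "finite {c \<in> P. norm (y + crease_centre c) \<le> \<rho>} \<and> card {c \<in> P. norm (y + crease_centre c) \<le> \<rho>} \<le> card B" for y
    using inj_on_finite[OF inj sub fB] card_inj_on_le[OF inj sub fB] by blast
  then show ?thesis by blast
qed

lemma finite_local: "finite {c \<in> P. norm (y + crease_centre c) \<le> \<rho>}"
  using local_finiteness by blast

lemma finite_creases_in_ball: "finite (creases_in_ball P R)"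
  by (rule finite_subset[OF _ finite_local[of 0 R]]) (auto simp: creases_in_ball_eq)

lemma comb_local:
  assumes "Q \<subseteq> P" "\<And>x. f x \<noteq> 0 \<Longrightarrow> norm x \<le> \<rho>" "norm (y - y0) \<le> r"
  shows "comb w Q f y = (\<Sum>c | c \<in> Q \<and> norm (y0 + crease_centre c) \<le> \<rho> + r. crease_weight w c * f (y + crease_centre c))"
proof (rule comb_eq_sum)
  show "finite {c \<in> Q. norm (y0 + crease_centre c) \<le> \<rho> + r}"
    by (rule finite_subset[OF _ finite_local[of y0 "\<rho> + r"]]) (use assms(1) in auto)
  fix c assume c: "c \<in> Q" "f (y + crease_centre c) \<noteq> 0"
  then have "norm (y + crease_centre c) \<le> \<rho>" using assms(2) by blast
  moreover have "y0 + crease_centre c = (y + crease_centre c) - (y - y0)" by simp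
  then have "norm (y0 + crease_centre c) \<le> norm (y + crease_centre c) + norm (y - y0)"
    by (metis norm_triangle_ineq4)
  ultimately show "c \<in> {c \<in> Q. norm (y0 + crease_centre c) \<le> \<rho> + r}" using c(1) assms(3) by simp
qed auto

lemma comb_continuous:
  assumes "Q \<subseteq> P" "test_function f" shows "continuous_on UNIV (comb w Q f)"
proof -
  obtain \<rho> where \<rho>: "\<And>x. f x \<noteq> 0 \<Longrightarrow> norm x \<le> \<rho>" using test_functionD(2)[OF assms(2)] by blast
  have cf: "continuous_on A (\<lambda>y. f (y + p))" for A p
    by (rule continuous_on_compose2[OF test_functionD(1)[OF assms(2)]]) (auto intro!: continuous_intros)
  have "isCont (comb w Q f) y0" for y0
  proof -
    have "continuous_on (ball y0 1) (comb w Q f)"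
    proof (subst continuous_on_cong[OF refl])
      fix y assume "y \<in> ball y0 1"
      then have "norm (y - y0) \<le> 1" by (simp add: dist_norm norm_minus_commute)
      then show "comb w Q f y = (\<Sum>c | c \<in> Q \<and> norm (y0 + crease_centre c) \<le> \<rho> + 1. crease_weight w c * f (y + crease_centre c))"
        using comb_local[OF assms(1) \<rho>] by blast
    qed (intro continuous_intros cf)
    then show ?thesis by (simp add: continuous_on_eq_continuous_at)
  qed
  then show ?thesis by (simp add: continuous_on_eq_continuous_at)
qed

lemma comb_bounded:
  assumes "test_function f" shows "\<exists>K. \<forall>Q y. Q \<subseteq> P \<longrightarrow> cmod (comb w Q f y) \<le> K"
proof -
  obtain \<rho> where \<rho>: "\<And>x. f x \<noteq> 0 \<Longrightarrow> norm x \<le> \<rho>" using test_functionD(2)[OF assms] by blast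
  obtain K where K: "\<And>x. cmod (f x) \<le> K" using test_functionD(3)[OF assms] by blast
  obtain C where C: "\<And>k s. cmod (w k s) \<le> C" using weight_bound by blast
  obtain N where N: "\<And>y. card {c \<in> P. norm (y + crease_centre c) \<le> \<rho>} \<le> N" using local_finiteness by blast
  have K0: "K \<ge> 0" "C \<ge> 0" using K[of 0] C norm_ge_zero order.trans by blast+
  have "cmod (comb w Q f y) \<le> N * (C * K)" if Q: "Q \<subseteq> P" for Q y
  proof -
    have "comb w Q f y = (\<Sum>c | c \<in> Q \<and> norm (y + crease_centre c) \<le> \<rho> + 0. crease_weight w c * f (y + crease_centre c))"
      by (rule comb_local[OF Q \<rho>]) auto
    also have "cmod \<dots> \<le> (\<Sum>c | c \<in> Q \<and> norm (y + crease_centre c) \<le> \<rho> + 0. C * K)"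
    proof (rule sum_norm_le)
      show "cmod (crease_weight w c * f (y + crease_centre c)) \<le> C * K" for c
        unfolding norm_mult crease_weight_def using C K K0 by (intro mult_mono) auto
    qed
    also have "\<dots> = card {c \<in> Q. norm (y + crease_centre c) \<le> \<rho> + 0} * (C * K)" by simp
    also have "\<dots> \<le> N * (C * K)"
    proof (rule mult_right_mono)
      have "card {c \<in> Q. norm (y + crease_centre c) \<le> \<rho> + 0} \<le> card {c \<in> P. norm (y + crease_centre c) \<le> \<rho>}"
        by (rule card_mono[OF finite_local]) (use Q in auto)
      then show "real (card {c \<in> Q. norm (y + crease_centre c) \<le> \<rho> + 0}) \<le> real N" using N[of y] by linarith
    qed (use K0 in simp)
    finally show ?thesis .
  qed
  then show ?thesis by blast
qed

lemma comb_bounded_measurable: "Q \<subseteq> P \<Longrightarrow> test_function f \<Longrightarrow> bounded_measurable (comb w Q f)"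
  unfolding bounded_measurable_def using comb_bounded comb_continuous borel_measurable_continuous_onI by metis

lemma comb_measurable: "Q \<subseteq> P \<Longrightarrow> test_function f \<Longrightarrow> comb w Q f \<in> borel_measurable borel"
  using comb_bounded_measurable by (auto simp: bounded_measurable_def)

text \<open>
  The part of \<open>P\<close> that is periodic with respect to \<open>2\<^sup>n\<^sup>+\<^sup>1\<int>\<^sup>d\<close>.
\<close>

definition off_slabs :: "nat \<Rightarrow> (real, 'd) vec \<Rightarrow> 'd pattern" where
  "off_slabs n \<tau> = {(x, k, s) \<in> P. (x - \<tau>) $ k / 2 ^ n \<notin> \<int>}"

lemma off_slabs_translate:
  assumes "address (Suc n) \<tau> P" "t \<in> dyadic_lattice (Suc n)" "(x, k, s) \<in> off_slabs n \<tau>"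
  shows "(x + t, k, s) \<in> off_slabs n \<tau>"
proof -
  have t: "t $ k / 2 ^ n \<in> \<int>" using assms(2) dyadic_lattice_mono[of n "Suc n"] by (auto simp: dyadic_lattice_def)
  have x: "(x, k, s) \<in> P" "(x - \<tau>) $ k / 2 ^ n \<notin> \<int>" using assms(3) by (auto simp: off_slabs_def)
  have "(x + t - \<tau>) $ k / 2 ^ n = (x - \<tau>) $ k / 2 ^ n + t $ k / 2 ^ n"
    by (simp add: add_divide_distrib diff_divide_distrib)
  then have xt: "(x + t - \<tau>) $ k / 2 ^ n \<notin> \<int>" using t x(2) by (metis Ints_diff add_diff_cancel_right')
  have "(x + t, k, s) \<in> P"
    using paperfolding_structure_translate_periodic[OF assms(2) x(2), of s] address_off_slab[OF assms(1) x(2), of s]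
      address_off_slab[OF assms(1) xt, of s] x(1) by (simp add: algebra_simps)
  then show ?thesis using xt by (simp add: off_slabs_def)
qed

lemma comb_off_slabs_periodic:
  assumes a: "address (Suc n) \<tau> P" and t: "t \<in> dyadic_lattice (Suc n)"
  shows "comb w (off_slabs n \<tau>) f (y + t) = comb w (off_slabs n \<tau>) f y"
proof -
  have mt: "- t \<in> dyadic_lattice (Suc n)" using t by (rule dyadic_lattice_minus)
  show ?thesis
    unfolding comb_def
    by (rule sum.reindex_bij_witness[of _ "\<lambda>(x, k, s). (x + - t, k, s)" "\<lambda>(x, k, s). (x + t, k, s)"])
      (auto dest: off_slabs_translate[OF a t] off_slabs_translate[OF a mt]
        simp: crease_centre_def crease_weight_def face_centre_add face_centre_add[of _ "- t", simplified] add_ac)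
qed

text \<open>
  A crease outside the periodic part acts only near the hyperplane that contains it.
\<close>

lemma comb_slab_difference:
  assumes f: "\<And>x. f x \<noteq> 0 \<Longrightarrow> norm x \<le> \<rho>" and ne: "comb w P f y \<noteq> comb w (off_slabs n \<tau>) f y"
  shows "\<exists>k z. \<bar>(y + \<tau>) $ k + of_int z * 2 ^ n\<bar> \<le> \<rho>"
proof -
  have "\<exists>c\<in>P - off_slabs n \<tau>. f (y + crease_centre c) \<noteq> 0"
  proof (rule ccontr)
    assume "\<not> ?thesis"
    then have "{c. c \<in> P \<and> f (y + crease_centre c) \<noteq> 0} = {c. c \<in> off_slabs n \<tau> \<and> f (y + crease_centre c) \<noteq> 0}"
      by (auto simp: off_slabs_def)
    then show False using ne by (simp add: comb_def)
  qed
  then obtain x k s where c: "(x, k, s) \<in> P - off_slabs n \<tau>" "f (y + face_centre x k) \<noteq> 0"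
    by (auto simp: crease_centre_def)
  then have "(x - \<tau>) $ k / 2 ^ n \<in> \<int>" by (auto simp: off_slabs_def)
  then obtain z where "(x - \<tau>) $ k / 2 ^ n = of_int z" by (elim Ints_cases)
  then have z: "x $ k = \<tau> $ k + of_int z * 2 ^ n" by (simp add: field_simps)
  have "\<bar>(y + face_centre x k) $ k\<bar> \<le> \<rho>" using f[OF c(2)] component_le_norm_cart order.trans by blast
  then show ?thesis using z by (intro exI[of _ k] exI[of _ z]) (simp add: face_centre_nth algebra_simps)
qed

definition slab :: "(real, 'd) vec \<Rightarrow> nat \<Rightarrow> real \<Rightarrow> 'd \<Rightarrow> (real, 'd) vec set" where
  "slab \<tau> n \<rho> k = {y. \<exists>z::int. \<bar>(y + \<tau>) $ k + of_int z * 2 ^ n\<bar> \<le> \<rho>}"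

lemma slab_borel: "slab \<tau> n \<rho> k \<in> sets borel"
proof -
  have "slab \<tau> n \<rho> k = (\<Union>z::int. {y. \<bar>(y + \<tau>) $ k + of_int z * 2 ^ n\<bar> \<le> \<rho>})" by (auto simp: slab_def)
  moreover have "closed {y :: (real, 'd) vec. \<bar>(y + \<tau>) $ k + of_int z * 2 ^ n\<bar> \<le> \<rho>}" for z :: int
    by (intro closed_Collect_le continuous_intros)
  ultimately show ?thesis by auto
qed

lemma slab_mean:
  assumes \<rho>: "\<rho> \<ge> 0" and m: "m > 0" "real m * (2 * \<rho> + 1) \<le> 2 ^ n" and \<epsilon>: "\<epsilon> > 0"
  shows "\<forall>\<^sub>F R in at_top. ball_mean R (indicator (slab \<tau> n \<rho> k) :: _ \<Rightarrow> real) \<le> 1 / real m + \<epsilon>"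
proof -
  let ?A = "slab \<tau> n \<rho> k"
  define t :: "nat \<Rightarrow> (real, 'd) vec" where "t j = (real j * (2 * \<rho> + 1)) *\<^sub>R axis k 1" for j
  have tk: "t j $ k = real j * (2 * \<rho> + 1)" for j by (simp add: t_def)
  have inj: "inj t"
  proof (rule injI)
    fix i j assume "t i = t j"
    then have "real i * (2 * \<rho> + 1) = real j * (2 * \<rho> + 1)" using tk by metis
    then show "i = j" using \<rho> by simp
  qed
  have "(\<Sum>s\<in>t ` {..<m}. indicator ?A (y + s)) \<le> (1::real)" for y
  proof -
    have "(\<Sum>s\<in>t ` {..<m}. indicator ?A (y + s)) = (\<Sum>j<m. indicator ?A (y + t j) :: real)"
      using inj by (subst sum.reindex) (auto simp: inj_on_def)
    also have "\<dots> = real (card {j. j < m \<and> y + t j \<in> ?A})"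
      by (simp add: indicator_def sum.If_cases Int_def)
    also have "card {j. j < m \<and> y + t j \<in> ?A} \<le> 1"
    proof -
      have "i = j" if ij: "i < m" "j < m" and A: "y + t i \<in> ?A" "y + t j \<in> ?A" for i j
      proof -
        obtain z z' where "\<bar>(y + t i + \<tau>) $ k + of_int z * 2 ^ n\<bar> \<le> \<rho>" "\<bar>(y + t j + \<tau>) $ k + of_int z' * 2 ^ n\<bar> \<le> \<rho>"
          using A by (auto simp: slab_def)
        then have "\<bar>(y + \<tau>) $ k + real i * (2 * \<rho> + 1) + of_int z * 2 ^ n\<bar> \<le> \<rho>"
          "\<bar>(y + \<tau>) $ k + real j * (2 * \<rho> + 1) + of_int z' * 2 ^ n\<bar> \<le> \<rho>" by (simp_all add: tk algebra_simps)
        then show "i = j" by (rule slab_translates_disjoint[OF _ _ ij m(2) \<rho>])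
      qed
      then show ?thesis unfolding One_nat_def by (subst card_le_Suc0_iff_eq) auto
    qed
    finally show ?thesis by simp
  qed
  moreover have "finite (t ` {..<m})" "t ` {..<m} \<noteq> {}" "card (t ` {..<m}) = m"
    using m inj by (auto simp: card_image inj_on_def)
  ultimately show ?thesis using ball_mean_disjoint_translates[of ?A "t ` {..<m}" \<epsilon>] slab_borel \<epsilon> by metis
qed

text \<open>
  Replace \<open>P\<close> by its periodic part, at the expense of an error supported by slabs of mean at most \<open>2/m\<close>, and approximate the
  resulting periodic function uniformly.
\<close>

lemma almost_periodic_comb:
  assumes f: "test_function f" shows "almost_periodic dyadic_frequencies (comb w P f)"
proof -
  obtain \<rho> where \<rho>: "\<rho> > 0" "\<And>x. f x \<noteq> 0 \<Longrightarrow> norm x \<le> \<rho>" using test_functionD(2)[OF f] by blast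
  obtain K where K: "\<And>Q y. Q \<subseteq> P \<Longrightarrow> cmod (comb w Q f y) \<le> K" using comb_bounded[OF f] by blast
  have K0: "K \<ge> 0" using K[of P 0] norm_ge_zero order.trans by blast
  show ?thesis
    unfolding almost_periodic_def
  proof (intro conjI exI[of _ "K + 1"] allI impI)
    show "comb w P f \<in> borel_measurable borel" using f by (intro comb_measurable) auto
    show "cmod (comb w P f y) \<le> K + 1" for y using K[of P y] by simp
    fix \<epsilon> :: real assume \<epsilon>: "\<epsilon> > 0"
    define C where "C = 2 * K * real CARD('d)"
    have C0: "C \<ge> 0" using K0 by (simp add: C_def)
    (* m disjoint translates make the contribution of the slabs at most epsilon / 2 *)
    obtain m :: nat where m: "4 * C / \<epsilon> + 1 < m" using reals_Archimedean2 by blast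
    then have m0: "m > 0" "C * (2 / real m) \<le> \<epsilon> / 2"
    proof -
      have "0 \<le> 4 * C / \<epsilon>" using C0 \<epsilon> by simp
      then show "m > 0" using m by linarith
      have "4 * C / \<epsilon> \<le> real m" using m by simp
      then have "4 * C \<le> \<epsilon> * real m" using \<epsilon> by (simp add: field_simps)
      then show "C * (2 / real m) \<le> \<epsilon> / 2" using \<open>m > 0\<close> by (simp add: field_simps)
    qed
    obtain n where n: "real m * (2 * \<rho> + 1) \<le> 2 ^ n"
      using real_arch_pow[of 2 "real m * (2 * \<rho> + 1)"] by (auto intro: less_imp_le)
    obtain \<tau> where \<tau>: "address (Suc n) \<tau> P" using address_exists[OF loc] by blast
    define Q where "Q = off_slabs n \<tau>"
    have Q: "Q \<subseteq> P" by (auto simp: Q_def off_slabs_def)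
    have "min (\<epsilon> / 2) 1 > 0" using \<epsilon> by simp
    from periodic_function_approx[OF comb_continuous[OF Q f] comb_off_slabs_periodic[OF \<tau>, of _ f, folded Q_def] this]
    obtain T where T: "trig_poly (frequencies (Suc n)) T" "\<And>y. cmod (comb w Q f y - T y) < min (\<epsilon> / 2) 1" by blast
    have T1: "trig_poly dyadic_frequencies T" using T(1) by (rule trig_poly_mono) (auto simp: dyadic_frequencies_def)
    define A where "A = slab \<tau> n \<rho>"
    have TK: "cmod (T y) \<le> K + 1" for y
    proof -
      have "cmod (T y) \<le> cmod (comb w Q f y) + cmod (comb w Q f y - T y)"
        using norm_triangle_ineq4[of "comb w Q f y" "comb w Q f y - T y"] by simp
      then show ?thesis using K[OF Q, of y] T(2)[of y] by simp
    qed
    have pt: "cmod (comb w P f y - T y) \<le> (2 * K) * (\<Sum>k\<in>UNIV. indicator (A k) y) + \<epsilon> / 2" for y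
    proof -
      have s0: "(\<Sum>k\<in>UNIV. indicator (A k) y) \<ge> (0::real)" by (intro sum_nonneg) auto
      have "cmod (comb w P f y - comb w Q f y) \<le> (2 * K) * (\<Sum>k\<in>UNIV. indicator (A k) y)"
      proof (cases "comb w P f y = comb w Q f y")
        case True
        then show ?thesis using K0 s0 by simp
      next
        case False
        then obtain k where "y \<in> A k" using comb_slab_difference[OF \<rho>(2)] unfolding Q_def A_def slab_def by blast
        then have "1 \<le> (\<Sum>k\<in>UNIV. indicator (A k) y :: real)"
          using member_le_sum[of k UNIV "\<lambda>k. indicator (A k) y :: real"] by simp
        then have "2 * K * 1 \<le> (2 * K) * (\<Sum>k\<in>UNIV. indicator (A k) y)" using K0 by (intro mult_left_mono) auto
        moreover have "cmod (comb w P f y - comb w Q f y) \<le> 2 * K"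
          using norm_triangle_ineq4[of "comb w P f y" "comb w Q f y"] K[of P y] K[OF Q, of y] by simp
        ultimately show ?thesis by simp
      qed
      moreover have "cmod (comb w P f y - T y) \<le> cmod (comb w P f y - comb w Q f y) + cmod (comb w Q f y - T y)"
        using norm_triangle_ineq[of "comb w P f y - comb w Q f y" "comb w Q f y - T y"] by simp
      ultimately show ?thesis using T(2)[of y] by simp
    qed
    have bA: "bounded_measurable (indicator (A k) :: _ \<Rightarrow> real)" for k
      by (rule bounded_measurableI[of _ 1]) (use slab_borel in \<open>auto simp: A_def indicator_def\<close>)
    have "\<forall>\<^sub>F R in at_top. \<forall>k. ball_mean R (indicator (A k) :: _ \<Rightarrow> real) \<le> 1 / real m + 1 / real m"
      unfolding A_def using slab_mean[OF less_imp_le[OF \<rho>(1)] m0(1) n, of "1 / real m"] m0(1)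
      by (intro eventually_all_finite) auto
    then have ev: "\<forall>\<^sub>F R in at_top. ball_mean R (\<lambda>y. cmod (comb w P f y - T y)) \<le> \<epsilon>"
      using eventually_gt_at_top[of 0]
    proof eventually_elim
      case (elim R)
      have "ball_mean R (\<lambda>y. cmod (comb w P f y - T y)) \<le> ball_mean R (\<lambda>y. (2 * K) * (\<Sum>k\<in>UNIV. indicator (A k) y) + \<epsilon> / 2)"
        using bA comb_bounded_measurable[OF _ f, of P] bounded_measurable_trig_poly[OF T(1)]
        by (intro ball_mean_mono pt) auto
      also have "\<dots> = (2 * K) * (\<Sum>k\<in>UNIV. ball_mean R (indicator (A k))) + \<epsilon> / 2"
        using bA elim by (simp add: ball_mean_add ball_mean_mult_left ball_mean_sum ball_mean_const
            bounded_measurable_mult bounded_measurable_sum)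
      also have "\<dots> \<le> (2 * K) * (\<Sum>k\<in>(UNIV::'d set). 1 / real m + 1 / real m) + \<epsilon> / 2"
        using K0 elim by (intro add_mono mult_left_mono sum_mono) auto
      also have "\<dots> = C * (2 / real m) + \<epsilon> / 2" by (simp add: C_def)
      also have "\<dots> \<le> \<epsilon>" using m0(2) by simp
      finally show ?case .
    qed
    show "\<exists>T. trig_poly dyadic_frequencies T \<and> (\<forall>y. cmod (T y) \<le> K + 1) \<and> (\<forall>\<^sub>F R in at_top. ball_mean R (\<lambda>y. cmod (comb w P f y - T y)) \<le> \<epsilon>)"
      using T1 TK ev by blast
  qed
qed

end


section \<open>Diffraction\<close>

text \<open>
  A nonnegative continuous function with arbitrarily small support: its transform is nonzero on a given bounded set, and its
  translates separate the points of a lattice.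
\<close>

definition bump :: "real \<Rightarrow> real^('d::finite) \<Rightarrow> real" where
  "bump r y = max 0 (r - norm y)"

lemma continuous_on_bump [continuous_intros]: "continuous_on A (bump r)"
  unfolding bump_def by (intro continuous_intros)

lemma test_function_bump: "test_function (\<lambda>y. complex_of_real (bump r y))"
proof (rule test_functionI[of _ r])
  show "continuous_on UNIV (\<lambda>y. complex_of_real (bump r y))" by (intro continuous_intros)
qed (auto simp: bump_def max_def split: if_splits)

lemma test_function_mult:
  assumes "test_function f" "continuous_on UNIV g" shows "test_function (\<lambda>y. f y * g y)"
proof -
  obtain \<rho> where "\<And>x. f x \<noteq> 0 \<Longrightarrow> norm x \<le> \<rho>" using test_functionD(2)[OF assms(1)] by blast
  then show ?thesis using test_functionD(1)[OF assms(1)] assms(2)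
    by (intro test_functionI[of _ \<rho>] continuous_intros) auto
qed

lemma test_function_shift:
  assumes "test_function f" shows "test_function (\<lambda>y. f (y + t))"
proof -
  obtain \<rho> where \<rho>: "\<And>x. f x \<noteq> 0 \<Longrightarrow> norm x \<le> \<rho>" using test_functionD(2)[OF assms(1)] by blast
  show ?thesis
  proof (rule test_functionI[of _ "\<rho> + norm t"])
    show "continuous_on UNIV (\<lambda>y. f (y + t))"
      by (rule continuous_on_compose2[OF test_functionD(1)[OF assms]]) (auto intro!: continuous_intros)
    show "norm x \<le> \<rho> + norm t" if "f (x + t) \<noteq> 0" for x
      using \<rho>[OF that] norm_triangle_ineq4[of "x + t" t] by simp
  qed
qed

lemma integral_bump_pos:
  fixes g :: "real^('d::finite) \<Rightarrow> real"
  assumes r: "r > 0" and g: "continuous_on UNIV g" "\<And>y. g y \<ge> 0" "g 0 > 0"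
    and bnd: "integrable lborel (\<lambda>y. bump r y * g y)"
  shows "(\<integral>y. bump r y * g y \<partial>lborel) > 0"
proof -
  let ?h = "\<lambda>y. bump r y * g y"
  have c: "continuous_on UNIV ?h" by (intro continuous_intros g)
  have h0: "?h 0 > 0" using r g by (simp add: bump_def)
  obtain \<delta> where \<delta>: "\<delta> > 0" "\<And>y. dist y 0 < \<delta> \<Longrightarrow> dist (?h y) (?h 0) < ?h 0 / 2"
    using c[unfolded continuous_on_iff, rule_format, of 0 "?h 0 / 2"] h0 by auto
  have nn: "?h y \<ge> 0" for y using g by (simp add: bump_def)
  have "0 < ?h 0 / 2 * ball_volume TYPE((real, 'd) vec) \<delta>"
    using h0 ball_volume_pos[OF \<delta>(1), where 'a="(real,'d) vec"] by simp
  also have "\<dots> = (\<integral>y. ?h 0 / 2 * indicator (ball 0 \<delta>) y \<partial>(lborel :: (real^'d) measure))" by (simp add: ball_volume_def)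
  also have "\<dots> \<le> (\<integral>y. ?h y \<partial>lborel)"
  proof (rule integral_mono[OF _ bnd])
    show "integrable lborel (\<lambda>y :: real^'d. ?h 0 / 2 * indicator (ball 0 \<delta>) y)"
      using emeasure_ball_less_top[of "0::(real,'d) vec" \<delta>] by (intro integrable_mult_right integrable_real_indicator) auto
    show "?h 0 / 2 * indicator (ball 0 \<delta>) y \<le> ?h y" for y
    proof (cases "y \<in> ball 0 \<delta>")
      case True
      then have "\<bar>?h y - ?h 0\<bar> < ?h 0 / 2" using \<delta>(2)[of y] by (simp add: dist_real_def)
      then have "?h 0 / 2 \<le> ?h y" by (simp only: abs_less_iff) linarith
      then show ?thesis using True by simp
    qed (use nn[of y] in simp)
  qed
  finally show ?thesis .
qed

lemma integrable_bump_mult: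
  assumes "continuous_on UNIV g" shows "integrable lborel (\<lambda>y. bump r y * g y)"
proof -
  have "test_function (\<lambda>y. complex_of_real (bump r y) * complex_of_real (g y))"
    using test_function_bump assms by (intro test_function_mult continuous_intros)
  from integrable_test_function[OF this] show ?thesis
    by (simp add: complex_of_real_integrable_eq flip: of_real_mult)
qed

lemma inverse_fourier_character: "inverse_fourier f \<xi> = (\<integral>x. f x * character \<xi> x \<partial>lborel)"
  by (simp add: inverse_fourier_def character_def)

lemma inverse_fourier_measurable:
  assumes "test_function f" shows "inverse_fourier f \<in> borel_measurable borel"
proof -
  note [measurable] = test_functionD(4)[OF assms]
  have "(\<lambda>(\<xi>, x). f x * cis (2 * pi * (\<xi> \<bullet> x))) \<in> borel_measurable (borel \<Otimes>\<^sub>M lborel)"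
    unfolding cis_conv_exp by measurable
  then show ?thesis unfolding inverse_fourier_def[abs_def]
    by (intro lborel.borel_measurable_lebesgue_integral) (simp add: case_prod_unfold)
qed

text \<open>
  On the support of a sufficiently narrow bump, the phase \<open>2\<pi> \<xi> \<bullet> y\<close> is at most \<open>\<pi>/3\<close> for all \<open>\<xi> \<in> K\<close>, hence its cosine is at least \<open>1/2\<close>.
\<close>

lemma inverse_fourier_bump_nonzero:
  fixes K :: "(real^('d::finite)) set"
  assumes "bounded K"
  shows "\<exists>f c. test_function f \<and> c > 0 \<and> (\<forall>\<xi>\<in>K. c \<le> cmod (inverse_fourier f \<xi>))"
proof -
  obtain B where B: "B > 0" "\<And>\<xi>. \<xi> \<in> K \<Longrightarrow> norm \<xi> \<le> B" using assms bounded_pos by metis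
  (* 2 * pi * B * r = pi / 3 *)
  define r where "r = 1 / (6 * B)"
  have r: "r > 0" using B by (simp add: r_def)
  define c where "c = (\<integral>y. bump r y * (1/2) \<partial>(lborel :: (real^'d) measure))"
  have i2: "integrable lborel (\<lambda>y. bump r y * (1/2))" by (intro integrable_bump_mult continuous_intros)
  have c: "c > 0" unfolding c_def using r by (intro integral_bump_pos i2) (auto intro!: continuous_intros)
  have "c \<le> cmod (inverse_fourier (\<lambda>y. complex_of_real (bump r y)) \<xi>)" if "\<xi> \<in> K" for \<xi>
  proof -
    have i: "integrable lborel (\<lambda>x. complex_of_real (bump r x) * character \<xi> x)"
      by (intro integrable_test_function test_function_mult test_function_bump continuous_intros)
    have "c \<le> (\<integral>x. Re (complex_of_real (bump r x) * character \<xi> x) \<partial>lborel)"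
      unfolding c_def
    proof (rule integral_mono[OF i2 integrable_Re[OF i]])
      fix y :: "real^'d"
      show "bump r y * (1/2) \<le> Re (complex_of_real (bump r y) * character \<xi> y)"
      proof (cases "norm y < r")
        case True
        have "\<bar>\<xi> \<bullet> y\<bar> \<le> norm \<xi> * norm y" by (rule Cauchy_Schwarz_ineq2)
        also have "\<dots> \<le> B * r" using B(1) B(2)[OF that] True by (intro mult_mono) auto
        also have "\<dots> = 1 / 6" using B(1) by (simp add: r_def)
        finally have "2 * pi * \<bar>\<xi> \<bullet> y\<bar> \<le> 2 * pi * (1 / 6)" by (intro mult_left_mono) auto
        then have "\<bar>2 * pi * (\<xi> \<bullet> y)\<bar> \<le> pi / 3" by (simp add: abs_mult)
        then have "cos (pi / 3) \<le> cos \<bar>2 * pi * (\<xi> \<bullet> y)\<bar>" by (intro cos_monotone_0_pi_le) auto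
        then have "1 / 2 \<le> cos (2 * pi * (\<xi> \<bullet> y))" by (simp add: cos_60)
        moreover have "bump r y \<ge> 0" by (simp add: bump_def)
        ultimately have "bump r y * (1/2) \<le> bump r y * cos (2 * pi * (\<xi> \<bullet> y))" by (rule mult_left_mono)
        then show ?thesis by (simp add: character_def)
      next
        case False
        then have "bump r y = 0" by (simp add: bump_def)
        then show ?thesis by simp
      qed
    qed
    also have "\<dots> = Re (inverse_fourier (\<lambda>y. complex_of_real (bump r y)) \<xi>)"
      unfolding inverse_fourier_character by (rule integral_Re[OF i])
    also have "\<dots> \<le> cmod (inverse_fourier (\<lambda>y. complex_of_real (bump r y)) \<xi>)" by (rule complex_Re_le_cmod)
    finally show ?thesis .
  qed
  then show ?thesis using c test_function_bump by blast
qed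

text \<open>
  Up to a factor, the correlation of a translated bump with a bump is \<open>1\<close> at the point \<open>z\<close> and \<open>0\<close> at all points at
  distance at least \<open>1/4\<close>. Correlations can thus take arbitrary values on a separated set.
\<close>

lemma bump_correlation_interpolates:
  fixes z x :: "real^('d::finite)"
  defines "\<phi> \<equiv> (\<lambda>y :: real^'d. complex_of_real (bump (1/8) y))"
  shows "correlation (\<lambda>y. \<phi> (y + - z)) \<phi> z \<noteq> 0"
    and "correlation (\<lambda>y. \<phi> (y + - z)) \<phi> z = correlation \<phi> \<phi> 0"
    and "norm (x - z) \<ge> 1/4 \<Longrightarrow> correlation (\<lambda>y. \<phi> (y + - z)) \<phi> x = 0"
proof -
  have [measurable]: "\<phi> \<in> borel_measurable borel"
    unfolding \<phi>_def using test_functionD(4)[OF test_function_bump] .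
  show eq: "correlation (\<lambda>y. \<phi> (y + - z)) \<phi> z = correlation \<phi> \<phi> 0"
    using lborel_integral_shift[of "\<lambda>y. \<phi> y * cnj (\<phi> y)" "- z"] by (simp add: correlation_def)
  have "correlation \<phi> \<phi> 0 = complex_of_real (\<integral>y. bump (1/8) y * bump (1/8) y \<partial>(lborel :: (real^'d) measure))"
    unfolding correlation_def \<phi>_def by (simp flip: of_real_mult integral_complex_of_real)
  moreover have "(\<integral>y. bump (1/8) y * bump (1/8) y \<partial>(lborel :: (real^'d) measure)) > 0"
    by (intro integral_bump_pos integrable_bump_mult continuous_intros) (auto simp: bump_def)
  ultimately have "correlation \<phi> \<phi> 0 \<noteq> 0" by (metis of_real_eq_0_iff less_irrefl)
  then show "correlation (\<lambda>y. \<phi> (y + - z)) \<phi> z \<noteq> 0" unfolding eq .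
  assume x: "norm (x - z) \<ge> 1/4"
  have zero: "\<phi> (y + - z) * cnj (\<phi> (y - x)) = 0" for y
  proof (rule ccontr)
    assume "\<not> ?thesis"
    then have "norm (y - z) < 1/8" "norm (y - x) < 1/8" by (auto simp: \<phi>_def bump_def max_def split: if_splits)
    moreover have "x - z = (y - z) - (y - x)" by simp
    then have "norm (x - z) \<le> norm (y - z) + norm (y - x)" by (metis norm_triangle_ineq4)
    ultimately show False using x by simp
  qed
  show "correlation (\<lambda>y. \<phi> (y + - z)) \<phi> x = 0" unfolding correlation_def zero by simp
qed

text \<open>
  The differences of crease centres lie here.
\<close>

definition half_lattice :: "(real^('d::finite)) set" where
  "half_lattice = {z. \<forall>i. 2 * z $ i \<in> \<int>}"

lemma half_lattice_separated:
  assumes "x \<in> half_lattice" "z \<in> half_lattice" "x \<noteq> z" shows "norm (x - z) \<ge> 1/4"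
proof -
  obtain i where i: "x $ i \<noteq> z $ i" using assms(3) by (auto simp: vec_eq_iff)
  have "2 * x $ i - 2 * z $ i \<in> \<int>" using assms(1,2) by (auto simp: half_lattice_def)
  then have "1 \<le> \<bar>2 * x $ i - 2 * z $ i\<bar>" using i by (intro Ints_nonzero_abs_ge1) auto
  then have "1/4 \<le> \<bar>(x - z) $ i\<bar>" unfolding vector_minus_component by linarith
  also have "\<dots> \<le> norm (x - z)" by (rule component_le_norm_cart)
  finally show ?thesis .
qed

lemma finite_half_lattice_bounded: "finite {z \<in> half_lattice. norm (z :: real^('d::finite)) \<le> \<rho>}"
proof -
  define g :: "('d \<Rightarrow> int) \<Rightarrow> real^'d" where "g m = (\<chi> i. of_int (m i) / 2)" for m
  have "{z \<in> half_lattice. norm z \<le> \<rho>} \<subseteq> g ` {m. \<forall>i. m i \<in> {- \<lceil>2 * \<rho>\<rceil>..\<lceil>2 * \<rho>\<rceil>}}"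
  proof
    fix z :: "real^'d" assume z: "z \<in> {z \<in> half_lattice. norm z \<le> \<rho>}"
    have eq: "of_int \<lfloor>2 * z $ i\<rfloor> = 2 * z $ i" for i using z by (auto simp: half_lattice_def of_int_floor)
    have "\<lfloor>2 * z $ i\<rfloor> \<in> {- \<lceil>2 * \<rho>\<rceil>..\<lceil>2 * \<rho>\<rceil>}" for i
    proof -
      have "\<bar>z $ i\<bar> \<le> \<rho>" using z component_le_norm_cart order.trans by blast
      then have "\<bar>real_of_int \<lfloor>2 * z $ i\<rfloor>\<bar> \<le> 2 * \<rho>" unfolding eq by simp
      then show ?thesis by (simp, linarith)
    qed
    moreover have "z = g (\<lambda>i. \<lfloor>2 * z $ i\<rfloor>)" by (simp add: g_def vec_eq_iff eq)
    ultimately show "z \<in> g ` {m. \<forall>i. m i \<in> {- \<lceil>2 * \<rho>\<rceil>..\<lceil>2 * \<rho>\<rceil>}}" by blast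
  qed
  then show ?thesis by (rule finite_subset) (intro finite_imageI finite_functions_into, simp)
qed

context paperfolding_comb
begin

lemma comb_finite:
  assumes "finite A" shows "comb w A f y = (\<Sum>c\<in>A. crease_weight w c * f (y + crease_centre c))"
  by (rule comb_eq_sum) (use assms in auto)

lemma centre_diff_half_lattice:
  assumes "c \<in> P" "c' \<in> P" shows "crease_centre c - crease_centre c' \<in> half_lattice"
proof -
  obtain x k s x' k' s' where c: "c = (x, k, s)" "c' = (x', k', s')" by (cases c, cases c') auto
  then have d: "x - x' \<in> dyadic_lattice 0" using corner_diff assms by auto
  have "2 * (crease_centre c - crease_centre c') $ i \<in> \<int>" for i
  proof -
    have "x $ i - x' $ i \<in> \<int>" using d by (auto simp: dyadic_lattice_def)
    then obtain z where "x $ i - x' $ i = of_int z" by (elim Ints_cases)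
    then have "2 * (crease_centre c - crease_centre c') $ i =
       of_int (2 * z + (if i = k then 0 else 1) - (if i = k' then 0 else 1))"
      by (auto simp: c crease_centre_def face_centre_nth algebra_simps)
    then show ?thesis by (metis Ints_of_int)
  qed
  then show ?thesis by (simp add: half_lattice_def)
qed

lemma comb_creases_in_ball_inside:
  assumes "\<And>x. f x \<noteq> 0 \<Longrightarrow> norm x \<le> \<rho>" "norm y < R - \<rho>"
  shows "comb w (creases_in_ball P R) f y = comb w P f y"
proof -
  have "{c. c \<in> creases_in_ball P R \<and> f (y + crease_centre c) \<noteq> 0} = {c. c \<in> P \<and> f (y + crease_centre c) \<noteq> 0}"
  proof -
    have "norm (crease_centre c) < R" if "f (y + crease_centre c) \<noteq> 0" for c
      using assms(1)[OF that] assms(2) norm_triangle_ineq4[of "y + crease_centre c" y] by simp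
    then show ?thesis by (auto simp: creases_in_ball_eq)
  qed
  then show ?thesis by (simp add: comb_def)
qed

lemma comb_creases_in_ball_outside:
  assumes "\<And>x. f x \<noteq> 0 \<Longrightarrow> norm x \<le> \<rho>" "norm y \<ge> R + \<rho>"
  shows "comb w (creases_in_ball P R) f y = 0"
proof -
  have "f (y + crease_centre c) = 0" if "c \<in> creases_in_ball P R" for c
  proof (rule ccontr)
    assume "f (y + crease_centre c) \<noteq> 0"
    then have "norm (y + crease_centre c) \<le> \<rho>" using assms(1) by blast
    then have "norm y \<le> \<rho> + norm (crease_centre c)"
      using norm_triangle_ineq4[of "y + crease_centre c" "crease_centre c"] by simp
    then show False using that assms(2) by (simp add: creases_in_ball_eq)
  qed
  then show ?thesis by (simp add: comb_def)
qed

lemma creases_in_ball_subset: "creases_in_ball P R \<subseteq> P"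
  by (auto simp: creases_in_ball_eq)

lemma truncated_comb_mean:
  assumes f: "test_function f" and g: "\<And>R. g R \<in> borel_measurable borel" "\<And>R y. cmod (g R y) \<le> L" "bounded_measurable h"
    and gh: "\<sigma> \<ge> 0" "\<And>R y. norm y < R - \<sigma> \<Longrightarrow> g R y = h y"
    and m: "has_mean (\<lambda>y. comb w P f y * h y) m"
  shows "((\<lambda>R. (\<integral>y. comb w (creases_in_ball P R) f y * g R y \<partial>lborel) / complex_of_real (ball_volume TYPE((real, 'd) vec) R)) \<longlongrightarrow> m) at_top"
proof -
  obtain \<rho> where \<rho>: "\<rho> > 0" "\<And>x. f x \<noteq> 0 \<Longrightarrow> norm x \<le> \<rho>" using test_functionD(2)[OF f] by blast
  obtain K where K: "\<And>Q y. Q \<subseteq> P \<Longrightarrow> cmod (comb w Q f y) \<le> K" using comb_bounded[OF f] by blast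
  have K0: "K \<ge> 0" "L \<ge> 0" using K[of P 0] g(2)[of 0 0] norm_ge_zero order.trans by blast+
  show ?thesis
  proof (rule has_mean_truncation[OF _ m, of _ "K * L" "max \<rho> \<sigma>"])
    show "bounded_measurable (\<lambda>y. comb w P f y * h y)"
      using comb_bounded_measurable[OF subset_refl f] g(3) by auto
    show "(\<lambda>y. comb w (creases_in_ball P R) f y * g R y) \<in> borel_measurable borel" for R
      using comb_measurable[OF creases_in_ball_subset f] g(1) by auto
    show "cmod (comb w (creases_in_ball P R) f y * g R y) \<le> K * L" for R y
      unfolding norm_mult using K[OF creases_in_ball_subset] g(2) K0 by (intro mult_mono) auto
    show "comb w (creases_in_ball P R) f y * g R y = comb w P f y * h y" if "norm y < R - max \<rho> \<sigma>" for R y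
      using comb_creases_in_ball_inside[where f=f and \<rho>=\<rho> and y=y and R=R, OF \<rho>(2)] gh(2)[of y R] that by simp
    show "comb w (creases_in_ball P R) f y * g R y = 0" if "norm y \<ge> R + max \<rho> \<sigma>" for R y
      using comb_creases_in_ball_outside[where f=f and \<rho>=\<rho> and y=y and R=R, OF \<rho>(2)] that by simp
  qed (use \<rho> in auto)
qed

text \<open>
  Expanding the product of two smeared truncated combs and integrating term by term gives the autocorrelation sum.
\<close>

lemma autocorrelation_sum_correlation:
  assumes f: "test_function f" and g: "test_function g"
  shows "(autocorrelation_sum w P (correlation f g) \<longlongrightarrow> mean (\<lambda>y. comb w P f y * cnj (comb w P g y))) at_top"
proof -
  interpret frequency_group "dyadic_frequencies :: (real, 'd) vec set" by (rule frequency_group_dyadic)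
  note [measurable] = test_functionD(4)[OF f] test_functionD(4)[OF g]
  obtain L where L: "\<And>x. cmod (g x) \<le> L" using test_functionD(3)[OF g] by blast
  obtain K where K: "\<And>Q y. Q \<subseteq> P \<Longrightarrow> cmod (comb w Q g y) \<le> K" using comb_bounded[OF g] by blast
  obtain \<rho> where \<rho>: "\<rho> > 0" "\<And>x. g x \<noteq> 0 \<Longrightarrow> norm x \<le> \<rho>" using test_functionD(2)[OF g] by blast
  have "(\<Sum>c\<in>creases_in_ball P R. \<Sum>c'\<in>creases_in_ball P R.
        crease_weight w c * cnj (crease_weight w c') * correlation f g (crease_centre c - crease_centre c'))
      = (\<integral>y. comb w (creases_in_ball P R) f y * cnj (comb w (creases_in_ball P R) g y) \<partial>lborel)" for R
  proof -
    let ?A = "creases_in_ball P R"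
    have i: "integrable lborel (\<lambda>y. f (y + p) * cnj (g (y + q)))" for p q
      using L by (intro integrable_test_mult[OF f, of _ L]) auto
    have "(\<integral>y. comb w ?A f y * cnj (comb w ?A g y) \<partial>lborel) =
      (\<integral>y. (\<Sum>c\<in>?A. \<Sum>c'\<in>?A. crease_weight w c * cnj (crease_weight w c') * (f (y + crease_centre c) * cnj (g (y + crease_centre c')))) \<partial>lborel)"
      unfolding comb_finite[OF finite_creases_in_ball] by (simp add: sum_product mult_ac)
    also have "\<dots> = (\<Sum>c\<in>?A. \<Sum>c'\<in>?A. crease_weight w c * cnj (crease_weight w c') * (\<integral>y. f (y + crease_centre c) * cnj (g (y + crease_centre c')) \<partial>lborel))"
      using i by (simp add: Bochner_Integration.integral_sum Bochner_Integration.integrable_sum)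
    also have "\<dots> = (\<Sum>c\<in>?A. \<Sum>c'\<in>?A. crease_weight w c * cnj (crease_weight w c') * correlation f g (crease_centre c - crease_centre c'))"
      by (simp add: correlation_diff)
    finally show ?thesis by simp
  qed
  then have "autocorrelation_sum w P (correlation f g) = (\<lambda>R.
     (\<integral>y. comb w (creases_in_ball P R) f y * cnj (comb w (creases_in_ball P R) g y) \<partial>lborel) / complex_of_real (ball_volume TYPE((real, 'd) vec) R))"
    by (simp add: autocorrelation_sum_def fun_eq_iff)
  moreover have "has_mean (\<lambda>y. comb w P f y * cnj (comb w P g y)) (mean (\<lambda>y. comb w P f y * cnj (comb w P g y)))"
    by (rule almost_periodic_has_mean[OF almost_periodic_mult[OF almost_periodic_comb[OF f]
          almost_periodic_cnj[OF almost_periodic_comb[OF g] minus_closed] add_closed]])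
  then have "((\<lambda>R. (\<integral>y. comb w (creases_in_ball P R) f y * cnj (comb w (creases_in_ball P R) g y) \<partial>lborel) / complex_of_real (ball_volume TYPE((real, 'd) vec) R))
     \<longlongrightarrow> mean (\<lambda>y. comb w P f y * cnj (comb w P g y))) at_top"
  proof (rule truncated_comb_mean[OF f, rotated -1])
    show "(\<lambda>y. cnj (comb w (creases_in_ball P R) g y)) \<in> borel_measurable borel" for R
      using comb_measurable[OF creases_in_ball_subset g] by auto
    show "cmod (cnj (comb w (creases_in_ball P R) g y)) \<le> K" for R y
      using K[OF creases_in_ball_subset] by simp
    show "bounded_measurable (\<lambda>y. cnj (comb w P g y))" using comb_bounded_measurable[OF subset_refl g] by auto
    show "cnj (comb w (creases_in_ball P R) g y) = cnj (comb w P g y)" if "norm y < R - \<rho>" for R y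
      using comb_creases_in_ball_inside[OF \<rho>(2) that] by simp
  qed (use \<rho> in auto)
  ultimately show ?thesis by simp
qed

text \<open>
  The sums see a test function only at the finitely many points of the half lattice in its support, where it coincides
  with a combination of correlations of bumps.
\<close>

lemma autocorrelation_sum_converges:
  assumes g: "test_function g" shows "\<exists>l. (autocorrelation_sum w P g \<longlongrightarrow> l) at_top"
proof -
  obtain \<rho> where \<rho>: "\<And>x. g x \<noteq> 0 \<Longrightarrow> norm x \<le> \<rho>" using test_functionD(2)[OF g] by blast
  define Z where "Z = {z \<in> half_lattice. norm (z :: (real, 'd) vec) \<le> \<rho>}"
  have Z: "finite Z" unfolding Z_def by (rule finite_half_lattice_bounded)
  define \<phi> :: "(real, 'd) vec \<Rightarrow> complex" where "\<phi> = (\<lambda>y. complex_of_real (bump (1/8) y))"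
  define B where "B z = correlation (\<lambda>y. \<phi> (y + - z)) \<phi>" for z
  define b where "b = correlation \<phi> \<phi> 0"
  have B: "B z z = b" "b \<noteq> 0" "norm (x - z) \<ge> 1/4 \<Longrightarrow> B z x = 0" for z x
    using bump_correlation_interpolates(1,2)[of z] bump_correlation_interpolates(3)[of x z]
    unfolding B_def b_def \<phi>_def by auto
  have t: "test_function \<phi>" "test_function (\<lambda>y. \<phi> (y + - z))" for z
    using test_function_bump test_function_shift unfolding \<phi>_def by blast+
  have interp: "g x = (\<Sum>z\<in>Z. g z / b * B z x)" if x: "x \<in> half_lattice" for x
  proof -
    have "(\<Sum>z\<in>Z. g z / b * B z x) = (\<Sum>z\<in>Z. if z = x then g x else 0)"
      using B half_lattice_separated[OF x] by (intro sum.cong) (auto simp: Z_def)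
    also have "\<dots> = g x" using Z \<rho>[of x] x by (auto simp: Z_def)
    finally show ?thesis by simp
  qed
  have "autocorrelation_sum w P g = (\<lambda>R. \<Sum>z\<in>Z. g z / b * autocorrelation_sum w P (B z) R)"
  proof
    fix R
    let ?A = "creases_in_ball P R"
    have "(\<Sum>c\<in>?A. \<Sum>c'\<in>?A. crease_weight w c * cnj (crease_weight w c') * g (crease_centre c - crease_centre c'))
      = (\<Sum>c\<in>?A. \<Sum>c'\<in>?A. \<Sum>z\<in>Z. g z / b * (crease_weight w c * cnj (crease_weight w c') * B z (crease_centre c - crease_centre c')))"
    proof (intro sum.cong refl)
      fix c c' assume "c \<in> ?A" "c' \<in> ?A"
      then have "crease_centre c - crease_centre c' \<in> half_lattice"
        using centre_diff_half_lattice creases_in_ball_subset by blast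
      from interp[OF this] show "crease_weight w c * cnj (crease_weight w c') * g (crease_centre c - crease_centre c')
        = (\<Sum>z\<in>Z. g z / b * (crease_weight w c * cnj (crease_weight w c') * B z (crease_centre c - crease_centre c')))"
        by (simp add: sum_distrib_left mult_ac)
    qed
    also have "\<dots> = (\<Sum>c\<in>?A. \<Sum>z\<in>Z. \<Sum>c'\<in>?A. g z / b * (crease_weight w c * cnj (crease_weight w c') * B z (crease_centre c - crease_centre c')))"
      by (intro sum.cong refl sum.swap)
    also have "\<dots> = (\<Sum>z\<in>Z. \<Sum>c\<in>?A. \<Sum>c'\<in>?A. g z / b * (crease_weight w c * cnj (crease_weight w c') * B z (crease_centre c - crease_centre c')))"
      by (rule sum.swap)
    finally show "autocorrelation_sum w P g R = (\<Sum>z\<in>Z. g z / b * autocorrelation_sum w P (B z) R)"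
      by (simp add: autocorrelation_sum_def sum_distrib_left sum_divide_distrib)
  qed
  moreover have "((\<lambda>R. \<Sum>z\<in>Z. g z / b * autocorrelation_sum w P (B z) R) \<longlongrightarrow>
     (\<Sum>z\<in>Z. g z / b * mean (\<lambda>y. comb w P (\<lambda>y. \<phi> (y + - z)) y * cnj (comb w P \<phi> y)))) at_top"
    unfolding B_def by (intro tendsto_intros autocorrelation_sum_correlation t)
  ultimately show ?thesis by metis
qed

text \<open>
  The integral of a smeared truncated comb against a character is the exponential sum of the comb times the transform of
  \<open>f\<close>. Comparison with a fixed bump whose transform is nonzero at \<open>\<xi>\<close> shows that the averaged exponential sums converge.
\<close>

lemma fourier_bohr_coefficient:
  assumes \<xi>: "\<xi> \<in> dyadic_frequencies"
  shows "\<exists>a. \<forall>f. test_function f \<longrightarrow> mean (\<lambda>y. comb w P f y * character \<xi> y) = a * inverse_fourier f \<xi>"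
proof -
  interpret frequency_group "dyadic_frequencies :: (real, 'd) vec set" by (rule frequency_group_dyadic)
  define S where "S R = (\<Sum>c\<in>creases_in_ball P R. crease_weight w c * character (- \<xi>) (crease_centre c))
      / complex_of_real (ball_volume TYPE((real, 'd) vec) R)" for R
  have lim: "((\<lambda>R. S R * inverse_fourier f \<xi>) \<longlongrightarrow> mean (\<lambda>y. comb w P f y * character \<xi> y)) at_top"
    if f: "test_function f" for f
  proof -
    have "has_mean (\<lambda>y. comb w P f y * character \<xi> y) (mean (\<lambda>y. comb w P f y * character \<xi> y))"
      by (rule almost_periodic_has_mean[OF almost_periodic_mult[OF almost_periodic_comb[OF f] almost_periodic_character[OF \<xi>] add_closed]])
    then have "((\<lambda>R. (\<integral>y. comb w (creases_in_ball P R) f y * character \<xi> y \<partial>lborel) / complex_of_real (ball_volume TYPE((real, 'd) vec) R))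
       \<longlongrightarrow> mean (\<lambda>y. comb w P f y * character \<xi> y)) at_top"
      by (intro truncated_comb_mean[OF f, of "\<lambda>_. character \<xi>" 1 _ 0]) auto
    moreover have "(\<integral>y. comb w (creases_in_ball P R) f y * character \<xi> y \<partial>lborel) =
       (\<Sum>c\<in>creases_in_ball P R. crease_weight w c * character (- \<xi>) (crease_centre c)) * inverse_fourier f \<xi>" for R
    proof -
      have [measurable]: "f \<in> borel_measurable borel" using test_functionD(4)[OF f] .
      have i: "integrable lborel (\<lambda>y. f (y + p) * character \<xi> y)" for p
        by (rule integrable_test_mult[OF f, of _ 1]) auto
      have sh: "(\<integral>y. f (y + p) * character \<xi> y \<partial>lborel) = character (- \<xi>) p * inverse_fourier f \<xi>" for p
      proof -
        have "(\<lambda>y. f (y + p) * character \<xi> y) = (\<lambda>y. character (- \<xi>) p * (f (y + p) * character \<xi> (y + p)))"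
          by (simp add: fun_eq_iff character_add_right mult_ac)
        then have "(\<integral>y. f (y + p) * character \<xi> y \<partial>lborel) = character (- \<xi>) p * (\<integral>y. f (y + p) * character \<xi> (y + p) \<partial>lborel)"
          by simp
        also have "(\<integral>y. f (y + p) * character \<xi> (y + p) \<partial>lborel) = inverse_fourier f \<xi>"
          unfolding inverse_fourier_character by (rule lborel_integral_shift[of "\<lambda>y. f y * character \<xi> y"]) measurable
        finally show ?thesis .
      qed
      have "(\<integral>y. comb w (creases_in_ball P R) f y * character \<xi> y \<partial>lborel)
        = (\<integral>y. (\<Sum>c\<in>creases_in_ball P R. crease_weight w c * (f (y + crease_centre c) * character \<xi> y)) \<partial>lborel)"
        unfolding comb_finite[OF finite_creases_in_ball] by (simp add: sum_distrib_right mult.assoc)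
      also have "\<dots> = (\<Sum>c\<in>creases_in_ball P R. crease_weight w c * (character (- \<xi>) (crease_centre c) * inverse_fourier f \<xi>))"
        using i by (simp add: Bochner_Integration.integral_sum sh)
      finally show ?thesis by (simp add: sum_distrib_left sum_distrib_right mult_ac)
    qed
    ultimately show ?thesis by (simp add: S_def)
  qed
  obtain f0 c where f0: "test_function f0" "c > 0" "c \<le> cmod (inverse_fourier f0 \<xi>)"
    using inverse_fourier_bump_nonzero[of "{\<xi>}"] by auto
  have nz: "inverse_fourier f0 \<xi> \<noteq> 0" using f0 by auto
  have "((\<lambda>R. S R * inverse_fourier f0 \<xi> / inverse_fourier f0 \<xi>) \<longlongrightarrow> mean (\<lambda>y. comb w P f0 y * character \<xi> y) / inverse_fourier f0 \<xi>) at_top"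
    by (intro tendsto_divide lim f0 tendsto_const nz)
  then have S: "(S \<longlongrightarrow> mean (\<lambda>y. comb w P f0 y * character \<xi> y) / inverse_fourier f0 \<xi>) at_top" (is "(S \<longlongrightarrow> ?a) _")
    using nz by simp
  have "mean (\<lambda>y. comb w P f y * character \<xi> y) = ?a * inverse_fourier f \<xi>" if f: "test_function f" for f
    using tendsto_unique[OF _ lim[OF f] tendsto_mult_right[OF S]] by simp
  then show ?thesis by blast
qed

text \<open>
  The Fourier--Bohr coefficient of the weighted Dirac comb itself.
\<close>

definition amplitude :: "(real, 'd) vec \<Rightarrow> complex" where
  "amplitude \<xi> = (if \<xi> \<in> dyadic_frequencies
     then SOME a. \<forall>f. test_function f \<longrightarrow> mean (\<lambda>y. comb w P f y * character \<xi> y) = a * inverse_fourier f \<xi>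
     else 0)"

lemma amplitude_eq:
  assumes "\<xi> \<in> dyadic_frequencies" "test_function f"
  shows "mean (\<lambda>y. comb w P f y * character \<xi> y) = amplitude \<xi> * inverse_fourier f \<xi>"
  using someI_ex[OF fourier_bohr_coefficient[OF assms(1)]] assms by (simp add: amplitude_def)

text \<open>
  Parseval's identity for the smeared comb, with \<open>\<xi>\<close> replaced by \<open>-\<xi>\<close> because the transform in question is the inverse one.
\<close>

lemma amplitude_parseval:
  assumes f: "test_function f"
  shows "((\<lambda>\<xi>. (cmod (amplitude \<xi>))\<^sup>2 * (cmod (inverse_fourier f \<xi>))\<^sup>2) has_sum
     Re (mean (\<lambda>y. comb w P f y * cnj (comb w P f y)))) UNIV"
    and "Im (mean (\<lambda>y. comb w P f y * cnj (comb w P f y))) = 0"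
proof -
  interpret frequency_group "dyadic_frequencies :: (real, 'd) vec set" by (rule frequency_group_dyadic)
  let ?M = "Re (mean (\<lambda>y. comb w P f y * cnj (comb w P f y)))"
  show "Im (mean (\<lambda>y. comb w P f y * cnj (comb w P f y))) = 0"
    by (rule parseval(2)[OF almost_periodic_comb[OF f]])
  have bij: "bij_betw uminus (dyadic_frequencies :: (real, 'd) vec set) dyadic_frequencies"
    by (rule bij_betwI[of _ _ _ uminus]) (auto intro: minus_closed)
  have "((\<lambda>\<xi>. (cmod (mean (\<lambda>y. comb w P f y * character (- \<xi>) y)))\<^sup>2) has_sum ?M) dyadic_frequencies"
    by (rule parseval(1)[OF almost_periodic_comb[OF f]])
  then have "((\<lambda>\<xi>. (cmod (mean (\<lambda>y. comb w P f y * character \<xi> y)))\<^sup>2) has_sum ?M) dyadic_frequencies"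
    using has_sum_reindex_bij_betw[OF bij, of "\<lambda>\<xi>. (cmod (mean (\<lambda>y. comb w P f y * character \<xi> y)))\<^sup>2" ?M] by simp
  also have "?this \<longleftrightarrow> ((\<lambda>\<xi>. (cmod (amplitude \<xi>))\<^sup>2 * (cmod (inverse_fourier f \<xi>))\<^sup>2) has_sum ?M) UNIV"
    by (rule has_sum_cong_neutral) (auto simp: amplitude_eq[OF _ f] norm_mult power_mult_distrib amplitude_def)
  finally show "((\<lambda>\<xi>. (cmod (amplitude \<xi>))\<^sup>2 * (cmod (inverse_fourier f \<xi>))\<^sup>2) has_sum ?M) UNIV" .
qed

definition diffraction :: "(real, 'd) vec measure" where
  "diffraction = distr (density (count_space UNIV) (\<lambda>\<xi>. ennreal ((cmod (amplitude \<xi>))\<^sup>2))) borel (\<lambda>\<xi>. \<xi>)"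

lemma emeasure_diffraction:
  assumes "A \<in> sets borel"
  shows "emeasure diffraction A = (\<integral>\<^sup>+\<xi>. ennreal ((cmod (amplitude \<xi>))\<^sup>2) * indicator A \<xi> \<partial>count_space UNIV)"
  using assms by (simp add: diffraction_def emeasure_distr emeasure_density)

lemma pure_point_diffraction: "pure_point_measure diffraction"
  unfolding pure_point_measure_def
proof
  fix A assume "A \<in> sets diffraction"
  then have A: "A \<in> sets borel" by (simp add: diffraction_def)
  have "emeasure diffraction {\<xi>} = ennreal ((cmod (amplitude \<xi>))\<^sup>2)" for \<xi>
  proof -
    have "emeasure diffraction {\<xi>} = (\<integral>\<^sup>+\<eta>. ennreal ((cmod (amplitude \<eta>))\<^sup>2) * indicator {\<xi>} \<eta> \<partial>count_space UNIV)"
      by (rule emeasure_diffraction) simp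
    also have "\<dots> = ennreal ((cmod (amplitude \<xi>))\<^sup>2)" by (simp add: nn_integral_indicator_singleton)
    finally show ?thesis .
  qed
  then show "emeasure diffraction A = (\<integral>\<^sup>+x\<in>A. emeasure diffraction {x} \<partial>count_space UNIV)"
    by (simp add: emeasure_diffraction[OF A])
qed

lemma diffraction_integral:
  assumes f: "test_function f"
  shows "integrable diffraction (\<lambda>\<xi>. (cmod (inverse_fourier f \<xi>))\<^sup>2)"
    and "complex_of_real (\<integral>\<xi>. (cmod (inverse_fourier f \<xi>))\<^sup>2 \<partial>diffraction) = mean (\<lambda>y. comb w P f y * cnj (comb w P f y))"
proof -
  note [measurable] = inverse_fourier_measurable[OF f]
  let ?h = "\<lambda>\<xi>. (cmod (inverse_fourier f \<xi>))\<^sup>2"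
  let ?g = "\<lambda>\<xi>. (cmod (amplitude \<xi>))\<^sup>2 * ?h \<xi>"
  note hs = amplitude_parseval(1)[OF f]
  have "?g summable_on UNIV" using hs by (rule has_sum_imp_summable)
  then have "(\<lambda>\<xi>. norm (?g \<xi>)) summable_on UNIV" by simp
  note abs = iffD1[OF abs_summable_equivalent this]
  then have int: "integrable (count_space UNIV) ?g" using abs by (simp only: abs_summable_on_def)
  have hm: "?h \<in> borel_measurable borel" by measurable
  show "integrable diffraction ?h"
    unfolding diffraction_def using int hm
    by (subst integrable_distr_eq) (auto simp: integrable_density)
  have "(\<integral>\<xi>. ?h \<xi> \<partial>diffraction) = (\<integral>\<xi>. ?g \<xi> \<partial>count_space UNIV)"
    unfolding diffraction_def using hm
    by (subst integral_distr) (auto simp: integral_density)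
  also have "\<dots> = infsum ?g UNIV" using infsetsum_infsum[OF abs] by (simp add: infsetsum_def)
  also have "\<dots> = Re (mean (\<lambda>y. comb w P f y * cnj (comb w P f y)))" using hs by (rule infsumI)
  finally show "complex_of_real (\<integral>\<xi>. ?h \<xi> \<partial>diffraction) = mean (\<lambda>y. comb w P f y * cnj (comb w P f y))"
    using amplitude_parseval(2)[OF f] by (simp add: complex_eq_iff)
qed

text \<open>
  A test function whose transform is bounded below on \<open>K\<close> bounds the indicator of \<open>K\<close> by an integrable function.
\<close>

lemma diffraction_locally_finite:
  assumes K: "compact K" shows "emeasure diffraction K < \<infinity>"
proof -
  have KB: "K \<in> sets borel" using K by (simp add: compact_imp_closed)
  obtain f c where f: "test_function f" "c > 0" "\<And>\<xi>. \<xi> \<in> K \<Longrightarrow> c \<le> cmod (inverse_fourier f \<xi>)"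
    using inverse_fourier_bump_nonzero[OF compact_imp_bounded[OF K]] by blast
  note i = integrable_mult_right[OF diffraction_integral(1)[OF f(1)], of "1 / c\<^sup>2"]
  have "integrable diffraction (indicator K :: _ \<Rightarrow> real)"
  proof (rule Bochner_Integration.integrable_bound[OF i])
    show "(indicator K :: _ \<Rightarrow> real) \<in> borel_measurable diffraction" using KB by (simp add: diffraction_def)
    have "norm (indicator K \<xi> :: real) \<le> norm (1 / c\<^sup>2 * (cmod (inverse_fourier f \<xi>))\<^sup>2)" for \<xi>
    proof (cases "\<xi> \<in> K")
      case True
      then have "c\<^sup>2 \<le> (cmod (inverse_fourier f \<xi>))\<^sup>2" using f by (intro power_mono) auto
      then show ?thesis using True f(2) by (simp add: field_simps)
    qed simp
    then show "AE \<xi> in diffraction. norm (indicator K \<xi> :: real) \<le> norm (1 / c\<^sup>2 * (cmod (inverse_fourier f \<xi>))\<^sup>2)" by simp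
  qed
  then show ?thesis using KB by (simp add: integrable_indicator_iff diffraction_def)
qed

theorem diffraction_measure: "is_diffraction_measure P w diffraction"
proof -
  define \<gamma> where "\<gamma> g = Lim at_top (autocorrelation_sum w P g)" for g
  have "is_autocorrelation P w \<gamma>"
    unfolding is_autocorrelation_iff \<gamma>_def
    using autocorrelation_sum_converges tendsto_Lim trivial_limit_at_top_linorder by metis
  moreover have "is_fourier_transform \<gamma> diffraction"
    unfolding is_fourier_transform_def
  proof (intro conjI allI impI)
    show "sets diffraction = sets borel" by (simp add: diffraction_def)
    show "emeasure diffraction K < \<infinity>" if "compact K" for K using diffraction_locally_finite[OF that] .
    fix f :: "(real, 'd) vec \<Rightarrow> complex" assume f: "test_function f"
    show "integrable diffraction (\<lambda>\<xi>. (cmod (inverse_fourier f \<xi>))\<^sup>2)" by (rule diffraction_integral(1)[OF f])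
    have "\<gamma> (self_convolution f) = mean (\<lambda>y. comb w P f y * cnj (comb w P f y))"
      unfolding \<gamma>_def self_convolution_correlation
      by (intro tendsto_Lim autocorrelation_sum_correlation f) simp
    then show "complex_of_real (\<integral>\<xi>. (cmod (inverse_fourier f \<xi>))\<^sup>2 \<partial>diffraction) = \<gamma> (self_convolution f)"
      using diffraction_integral(2)[OF f] by simp
  qed
  ultimately show ?thesis unfolding is_diffraction_measure_def by blast
qed

end

theorem hull_pure_point_diffraction:
  assumes "P \<in> paperfolding_hull" shows "pure_point_diffraction_spectrum P"
  unfolding pure_point_diffraction_spectrum_def
proof
  fix w
  interpret paperfolding_comb P w by unfold_locales (rule hull_locally_paperfolding[OF assms])
  show "\<exists>D. is_diffraction_measure P w D \<and> pure_point_measure D"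
    using diffraction_measure pure_point_diffraction by blast
qed


section \<open>Square integrable functions\<close>

lemma cmod_add_squared: "(cmod (a + b))\<^sup>2 \<le> 2 * (cmod a)\<^sup>2 + 2 * (cmod b)\<^sup>2"
proof -
  have "(cmod (a + b))\<^sup>2 \<le> (cmod a + cmod b)\<^sup>2" by (intro power_mono norm_triangle_ineq) auto
  also have "\<dots> \<le> 2 * (cmod a)\<^sup>2 + 2 * (cmod b)\<^sup>2"
    using sum_squares_bound[of "cmod a" "cmod b"] by (simp add: power2_sum)
  finally show ?thesis .
qed

lemma square_integrable_add:
  assumes "square_integrable M f" "square_integrable M g"
  shows "square_integrable M (\<lambda>x. f x + g x)"
proof -
  have [measurable]: "f \<in> borel_measurable M" "g \<in> borel_measurable M"
    using assms by (auto simp: square_integrable_def)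
  have "integrable M (\<lambda>x. 2 * (cmod (f x))\<^sup>2 + 2 * (cmod (g x))\<^sup>2)"
    using assms by (auto simp: square_integrable_def)
  then have "integrable M (\<lambda>x. (cmod (f x + g x))\<^sup>2)"
  proof (rule Bochner_Integration.integrable_bound)
    show "AE x in M. norm ((cmod (f x + g x))\<^sup>2) \<le> norm (2 * (cmod (f x))\<^sup>2 + 2 * (cmod (g x))\<^sup>2)"
      using cmod_add_squared by (intro AE_I2) (simp add: abs_of_nonneg)
  qed measurable
  then show ?thesis by (simp add: square_integrable_def)
qed

lemma square_integrable_cmult:
  assumes "square_integrable M f" shows "square_integrable M (\<lambda>x. c * f x)"
  using assms by (auto simp: square_integrable_def norm_mult power_mult_distrib)

lemma square_integrable_diff:
  "square_integrable M f \<Longrightarrow> square_integrable M g \<Longrightarrow> square_integrable M (\<lambda>x. f x - g x)"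
  using square_integrable_add[OF _ square_integrable_cmult[of M g "-1"]] by simp

lemma square_integrable_sum:
  "(\<And>a. a \<in> A \<Longrightarrow> square_integrable M (f a)) \<Longrightarrow> square_integrable M (\<lambda>x. \<Sum>a\<in>A. f a x)"
proof (induction A rule: infinite_finite_induct)
  case (insert a A)
  then show ?case by (simp add: square_integrable_add)
qed (simp_all add: square_integrable_def)

definition sq_dist :: "'a measure \<Rightarrow> ('a \<Rightarrow> complex) \<Rightarrow> ('a \<Rightarrow> complex) \<Rightarrow> real" where
  "sq_dist M f g = (\<integral>x. (cmod (f x - g x))\<^sup>2 \<partial>M)"

lemma sq_dist_triangle:
  assumes "square_integrable M f" "square_integrable M g" "square_integrable M h"
  shows "sq_dist M f h \<le> 2 * sq_dist M f g + 2 * sq_dist M g h"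
proof -
  have i: "integrable M (\<lambda>x. (cmod (f x - h x))\<^sup>2)" "integrable M (\<lambda>x. (cmod (f x - g x))\<^sup>2)" "integrable M (\<lambda>x. (cmod (g x - h x))\<^sup>2)"
    using square_integrable_diff assms by (auto simp: square_integrable_def)
  have "sq_dist M f h \<le> (\<integral>x. 2 * (cmod (f x - g x))\<^sup>2 + 2 * (cmod (g x - h x))\<^sup>2 \<partial>M)"
    unfolding sq_dist_def
  proof (rule integral_mono)
    show "(cmod (f x - h x))\<^sup>2 \<le> 2 * (cmod (f x - g x))\<^sup>2 + 2 * (cmod (g x - h x))\<^sup>2" for x
      using cmod_add_squared[of "f x - g x" "g x - h x"] by simp
  qed (use i in auto)
  also have "\<dots> = 2 * sq_dist M f g + 2 * sq_dist M g h" using i by (simp add: sq_dist_def)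
  finally show ?thesis .
qed

lemma sq_dist_nonneg: "sq_dist M f g \<ge> 0"
  by (simp add: sq_dist_def)

section \<open>Eigenfunctions on the hull\<close>

definition some_address :: "nat \<Rightarrow> ('d::{finite,linorder}) pattern \<Rightarrow> (real, 'd) vec" where
  "some_address n P = (SOME \<tau>. address n \<tau> P)"

lemma some_address: "locally_paperfolding P \<Longrightarrow> address n (some_address n P) P"
  unfolding some_address_def using address_exists by (rule someI_ex)

text \<open>
  The least \<open>n\<close> makes this a function of \<open>\<xi>\<close> and \<open>P\<close> alone; any other admissible level gives the same value.
\<close>

definition eigenchar :: "(real, 'd) vec \<Rightarrow> ('d::{finite,linorder}) pattern \<Rightarrow> complex" where
  "eigenchar \<xi> P = character \<xi> (some_address (LEAST n. \<xi> \<in> frequencies n) P)"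

lemma eigenchar_eq:
  assumes "\<xi> \<in> frequencies n" "address n \<tau> P" shows "eigenchar \<xi> P = character \<xi> \<tau>"
proof -
  let ?m = "LEAST n. \<xi> \<in> frequencies n"
  have m: "\<xi> \<in> frequencies ?m" "?m \<le> n" using assms(1) by (auto intro: LeastI Least_le)
  have a: "address ?m \<tau> P" using address_mono[OF assms(2) m(2)] .
  then have "address ?m (some_address ?m P) P" unfolding some_address_def by (rule someI)
  from address_unique[OF this a] show ?thesis unfolding eigenchar_def by (rule character_cong[OF m(1)])
qed

definition coordinate :: "nat \<Rightarrow> ('d::{finite,linorder}) pattern \<Rightarrow> (complex, 'd) vec" where
  "coordinate n P = torus_map n (some_address n P)"

lemma coordinate_eq:
  assumes "address n \<tau> P" shows "coordinate n P = torus_map n \<tau>"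
  using address_unique[OF someI[of "\<lambda>\<tau>. address n \<tau> P", OF assms] assms]
  by (simp add: coordinate_def some_address_def torus_map_eq_iff)

lemma address_pattern_close:
  fixes P Q :: "('d::{finite,linorder}) pattern"
  assumes close: "pattern_close \<epsilon> P Q" and \<epsilon>: "\<epsilon> > 0" "recognition_radius TYPE('d) n \<le> 1 / \<epsilon>"
    and P: "address n \<tau> P" and Q: "locally_paperfolding Q"
  shows "\<exists>t. norm t \<le> \<epsilon> \<and> address n (\<tau> - t) Q"
proof -
  obtain t where t: "norm t \<le> \<epsilon>" "agree_on (ball 0 (1 / \<epsilon>)) P (translate t Q)"
    using close by (auto simp: pattern_close_def)
  obtain \<sigma> where \<sigma>: "address n \<sigma> Q" using address_exists[OF Q] by blast
  have "\<tau> - (t + \<sigma>) \<in> dyadic_lattice n"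
    by (rule address_agree[OF P address_translate[OF \<sigma>] t(2) \<epsilon>(2)])
  then have "\<sigma> - (\<tau> - t) \<in> dyadic_lattice n" using dyadic_lattice_minus[of "\<tau> - (t + \<sigma>)" n] by (simp add: algebra_simps)
  from address_cong[OF \<sigma> this] t(1) show ?thesis by blast
qed

lemma hull_complement_open:
  "openin pattern_topology (- (paperfolding_hull :: ('d::{finite,linorder}) pattern set))"
proof -
  have "closedin pattern_topology (paperfolding_hull :: 'd pattern set)"
    unfolding paperfolding_hull_def by (rule closedin_closure_of)
  then show ?thesis by (simp add: closedin_def Compl_eq_Diff_UNIV)
qed

text \<open>
  The hull is closed, so a relatively open set becomes open when the complement of the hull is added to it.
\<close>

lemma openin_hullI:
  fixes V :: "('d::{finite,linorder}) pattern set"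
  assumes "V \<subseteq> paperfolding_hull"
    and "\<And>P. P \<in> V \<Longrightarrow> \<exists>\<epsilon>>0. \<forall>Q\<in>paperfolding_hull. pattern_close \<epsilon> P Q \<longrightarrow> Q \<in> V"
  shows "openin (subtopology pattern_topology paperfolding_hull) V"
  unfolding openin_subtopology
proof (intro exI conjI)
  show "openin pattern_topology (V \<union> - paperfolding_hull)"
    unfolding openin_pattern_topology
  proof
    fix P assume "P \<in> V \<union> - paperfolding_hull"
    then show "\<exists>\<epsilon>>0. \<forall>Q. pattern_close \<epsilon> P Q \<longrightarrow> Q \<in> V \<union> - paperfolding_hull"
    proof
      assume "P \<in> V" then show ?thesis using assms(2) by blast
    next
      assume "P \<in> - paperfolding_hull"
      then show ?thesis using hull_complement_open[where 'd='d] unfolding openin_pattern_topology by blast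
    qed
  qed
  show "V = (V \<union> - paperfolding_hull) \<inter> paperfolding_hull" using assms(1) by auto
qed

text \<open>
  Nearby patterns have nearby addresses, so continuous functions of the address are continuous on the hull.
\<close>

lemma openin_address_function:
  fixes h :: "(real, 'd::{finite,linorder}) vec \<Rightarrow> 'b::topological_space"
  assumes h: "continuous_on UNIV h" and \<Phi>: "\<And>P \<tau>. P \<in> paperfolding_hull \<Longrightarrow> address n \<tau> P \<Longrightarrow> \<Phi> P = h \<tau>" and W: "open W"
  shows "openin (subtopology pattern_topology paperfolding_hull) {P \<in> paperfolding_hull. \<Phi> P \<in> W}"
proof (rule openin_hullI)
  fix P assume P: "P \<in> {P \<in> paperfolding_hull. \<Phi> P \<in> W}"
  then have PH: "P \<in> paperfolding_hull" by simp
  obtain \<tau> where \<tau>: "address n \<tau> P" using address_exists[OF hull_locally_paperfolding[OF PH]] by blast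
  have "open (h -` W)" using h W by (simp add: continuous_on_open_vimage)
  moreover have "\<tau> \<in> h -` W" using P \<Phi>[OF PH \<tau>] by simp
  ultimately obtain e where e: "e > 0" "cball \<tau> e \<subseteq> h -` W" using open_contains_cball by blast
  let ?r = "recognition_radius TYPE('d) n"
  have r: "?r > 0" by (simp add: recognition_radius_def add_nonneg_pos)
  define \<epsilon> where "\<epsilon> = min e (1 / ?r)"
  have "?r \<le> 1 / \<epsilon>"
  proof -
    have "\<epsilon> > 0" "\<epsilon> \<le> 1 / ?r" using e r by (auto simp: \<epsilon>_def)
    then show ?thesis using r by (simp add: field_simps)
  qed
  have \<epsilon>: "\<epsilon> > 0" "\<epsilon> \<le> e" using e r by (auto simp: \<epsilon>_def)
  have "Q \<in> {P \<in> paperfolding_hull. \<Phi> P \<in> W}" if Q: "Q \<in> paperfolding_hull" "pattern_close \<epsilon> P Q" for Q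
  proof -
    obtain t where t: "norm t \<le> \<epsilon>" "address n (\<tau> - t) Q"
      using address_pattern_close[OF Q(2) \<epsilon>(1) \<open>?r \<le> 1 / \<epsilon>\<close> \<tau> hull_locally_paperfolding[OF Q(1)]] by blast
    have "\<tau> - t \<in> cball \<tau> e" using t(1) \<epsilon>(2) by (simp add: dist_norm)
    then have "\<tau> - t \<in> h -` W" using e(2) by blast
    then show ?thesis using \<Phi>[OF Q(1) t(2)] Q(1) by simp
  qed
  with \<epsilon>(1) show "\<exists>\<epsilon>>0. \<forall>Q\<in>paperfolding_hull. pattern_close \<epsilon> P Q \<longrightarrow> Q \<in> {P \<in> paperfolding_hull. \<Phi> P \<in> W}" by blast
qed auto

section \<open>Invariant measures and the dynamical spectrum\<close>

locale invariant_measure =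
  fixes M :: "('d::{finite,linorder}) pattern measure"
  assumes invariant: "invariant_hull_measure M"
begin

sublocale prob_space M
  using invariant by (simp add: invariant_hull_measure_def)

lemma open_subsets: "{U. openin (subtopology pattern_topology paperfolding_hull) U} \<subseteq> Pow paperfolding_hull"
  using openin_subset by fastforce

lemma sets_M: "sets M = sigma_sets paperfolding_hull {U. openin (subtopology pattern_topology paperfolding_hull) U}"
proof -
  have "sets M = sets (sigma paperfolding_hull {U. openin (subtopology pattern_topology paperfolding_hull) U})"
    using invariant by (simp add: invariant_hull_measure_def)
  also have "\<dots> = sigma_sets paperfolding_hull {U. openin (subtopology pattern_topology paperfolding_hull) U}"
    by (rule sets_measure_of[OF open_subsets])
  finally show ?thesis .
qed

lemma space_M: "space M = paperfolding_hull"
proof -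
  have "sets M = sets (sigma paperfolding_hull {U. openin (subtopology pattern_topology paperfolding_hull) U})"
    using invariant by (simp add: invariant_hull_measure_def)
  from sets_eq_imp_space_eq[OF this] show ?thesis using open_subsets by (simp add: space_measure_of_conv)
qed

lemma open_in_sets: "openin (subtopology pattern_topology paperfolding_hull) U \<Longrightarrow> U \<in> sets M"
  unfolding sets_M by (rule sigma_sets.Basic) simp

lemma translate_measurable: "translate t \<in> measurable M M"
  and translate_distr: "distr M M (translate t) = M"
  using invariant by (auto simp: invariant_hull_measure_def)

lemma translate_in_space: "P \<in> space M \<Longrightarrow> translate t P \<in> space M"
  using measurable_space[OF translate_measurable] .

lemma space_locally_paperfolding: "P \<in> space M \<Longrightarrow> locally_paperfolding P"
  unfolding space_M by (rule hull_locally_paperfolding)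

lemma address_function_measurable:
  fixes h :: "(real, 'd) vec \<Rightarrow> 'b::topological_space"
  assumes "continuous_on UNIV h" "\<And>P \<tau>. P \<in> space M \<Longrightarrow> address n \<tau> P \<Longrightarrow> \<Phi> P = h \<tau>"
  shows "\<Phi> \<in> borel_measurable M"
proof (rule borel_measurableI)
  fix W :: "'b set" assume "open W"
  from openin_address_function[OF assms(1) assms(2)[unfolded space_M] this]
  have "{P \<in> paperfolding_hull. \<Phi> P \<in> W} \<in> sets M" by (intro open_in_sets) auto
  moreover have "\<Phi> -` W \<inter> space M = {P \<in> paperfolding_hull. \<Phi> P \<in> W}" by (auto simp: space_M)
  ultimately show "\<Phi> -` W \<inter> space M \<in> sets M" by simp
qed

lemma coordinate_measurable [measurable]: "coordinate n \<in> borel_measurable M"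
  by (rule address_function_measurable[OF continuous_on_torus_map coordinate_eq])

lemma eigenchar_measurable:
  assumes "\<xi> \<in> dyadic_frequencies" shows "eigenchar \<xi> \<in> borel_measurable M"
proof -
  obtain n where "\<xi> \<in> frequencies n" using assms by (auto simp: dyadic_frequencies_def)
  then show ?thesis by (intro address_function_measurable[OF continuous_on_character eigenchar_eq]) auto
qed

lemma eigenchar_address:
  assumes "\<xi> \<in> dyadic_frequencies" "P \<in> space M"
  obtains n \<tau> where "\<xi> \<in> frequencies n" "address n \<tau> P" "eigenchar \<xi> P = character \<xi> \<tau>"
proof -
  obtain n where n: "\<xi> \<in> frequencies n" using assms by (auto simp: dyadic_frequencies_def)
  obtain \<tau> where \<tau>: "address n \<tau> P" using address_exists[OF space_locally_paperfolding[OF assms(2)]] by blast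
  show ?thesis using that[OF n \<tau> eigenchar_eq[OF n \<tau>]] .
qed

lemma norm_eigenchar: "\<xi> \<in> dyadic_frequencies \<Longrightarrow> P \<in> space M \<Longrightarrow> cmod (eigenchar \<xi> P) = 1"
  by (metis eigenchar_address norm_character)

lemma square_integrable_bounded:
  assumes "f \<in> borel_measurable M" "\<And>P. P \<in> space M \<Longrightarrow> cmod (f P) \<le> K"
  shows "square_integrable M f"
  unfolding square_integrable_def
proof (intro conjI integrable_const_bound[of _ "K\<^sup>2"])
  show "AE P in M. norm ((cmod (f P))\<^sup>2) \<le> K\<^sup>2"
    using assms(2) by (intro AE_I2) (simp add: power_mono)
qed (use assms(1) in measurable)

lemma square_integrable_eigenchar: "\<xi> \<in> dyadic_frequencies \<Longrightarrow> square_integrable M (eigenchar \<xi>)"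
  by (rule square_integrable_bounded[of _ 1]) (auto simp: eigenchar_measurable norm_eigenchar)

lemma eigenfunction_eigenchar:
  assumes \<xi>: "\<xi> \<in> dyadic_frequencies" shows "eigenfunction M (eigenchar \<xi>)"
  unfolding eigenfunction_def
proof (intro conjI exI[of _ \<xi>] allI)
  show "square_integrable M (eigenchar \<xi>)" using square_integrable_eigenchar[OF \<xi>] .
  show "\<not> (AE P in M. eigenchar \<xi> P = 0)"
  proof
    assume "AE P in M. eigenchar \<xi> P = 0"
    then have "AE P in M. False"
      by (rule AE_mp[OF _ AE_I2]) (use norm_eigenchar[OF \<xi>] in force)
    then show False using AE_False by blast
  qed
  fix t
  show "AE P in M. eigenchar \<xi> (translate t P) = cis (2 * pi * (\<xi> \<bullet> t)) * eigenchar \<xi> P"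
  proof (rule AE_I2)
    fix P assume "P \<in> space M"
    then obtain n \<tau> where n: "\<xi> \<in> frequencies n" "address n \<tau> P" "eigenchar \<xi> P = character \<xi> \<tau>"
      using eigenchar_address[OF \<xi>] by metis
    have "eigenchar \<xi> (translate t P) = character \<xi> (t + \<tau>)"
      by (rule eigenchar_eq[OF n(1) address_translate[OF n(2)]])
    then show "eigenchar \<xi> (translate t P) = cis (2 * pi * (\<xi> \<bullet> t)) * eigenchar \<xi> P"
      using n(3) by (simp add: character_add_right) (simp add: character_def)
  qed
qed

text \<open>
  The patterns for which the origin is within \<open>\<rho>\<close> of a hyperplane of spacing \<open>2\<^sup>n\<close>; expressed by the coordinate, which makes it measurable.
\<close>

definition slab_event :: "nat \<Rightarrow> 'd \<Rightarrow> real \<Rightarrow> 'd pattern set" where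
  "slab_event n k \<rho> = {P \<in> space M. coordinate n P $ k \<in> (\<lambda>a. cis (2 * pi * (a / 2 ^ n))) ` {-\<rho>..\<rho>}}"

lemma slab_event_iff:
  assumes "P \<in> space M" "address n \<tau> P"
  shows "P \<in> slab_event n k \<rho> \<longleftrightarrow> (\<exists>z::int. \<bar>\<tau> $ k + of_int z * 2 ^ n\<bar> \<le> \<rho>)"
proof -
  have "P \<in> slab_event n k \<rho> \<longleftrightarrow> (\<exists>a. \<bar>a\<bar> \<le> \<rho> \<and> cis (2 * pi * (\<tau> $ k / 2 ^ n)) = cis (2 * pi * (a / 2 ^ n)))"
    using assms by (auto simp: slab_event_def coordinate_eq torus_map_def abs_le_iff)
  also have "\<dots> \<longleftrightarrow> (\<exists>a. \<bar>a\<bar> \<le> \<rho> \<and> (\<exists>z::int. a = \<tau> $ k + of_int z * 2 ^ n))"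
    unfolding cis_turn_eq_iff[symmetric] by (metis (no_types))
  finally show ?thesis by auto
qed

lemma slab_event_sets: "slab_event n k \<rho> \<in> sets M"
proof -
  have "compact ((\<lambda>a. cis (2 * pi * (a / 2 ^ n))) ` {-\<rho>..\<rho>})"
    by (intro compact_continuous_image continuous_intros) auto
  then have c: "closed ((\<lambda>a. cis (2 * pi * (a / 2 ^ n))) ` {-\<rho>..\<rho>})" by (rule compact_imp_closed)
  have m: "(\<lambda>P. coordinate n P $ k) \<in> borel_measurable M"
    by (rule borel_measurable_continuous_on[OF _ coordinate_measurable]) (intro continuous_intros)
  have "slab_event n k \<rho> = (\<lambda>P. coordinate n P $ k) -` ((\<lambda>a. cis (2 * pi * (a / 2 ^ n))) ` {-\<rho>..\<rho>}) \<inter> space M"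
    by (auto simp: slab_event_def)
  then show ?thesis using measurable_sets[OF m] c by auto
qed

text \<open>
  The translates of the event by multiples of \<open>2\<rho> + 1\<close> are disjoint and, by invariance, have equal probability.
\<close>

lemma slab_event_prob:
  assumes \<rho>: "\<rho> \<ge> 0" and m: "real m * (2 * \<rho> + 1) \<le> 2 ^ n"
  shows "real m * prob (slab_event n k \<rho>) \<le> 1"
proof -
  define t :: "nat \<Rightarrow> (real, 'd) vec" where "t j = (real j * (2 * \<rho> + 1)) *\<^sub>R axis k 1" for j
  have tk: "t j $ k = real j * (2 * \<rho> + 1)" for j by (simp add: t_def)
  define B where "B j = translate (t j) -` slab_event n k \<rho> \<inter> space M" for j
  have Bs: "B j \<in> sets M" for j unfolding B_def by (rule measurable_sets[OF translate_measurable slab_event_sets])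
  have pB: "prob (B j) = prob (slab_event n k \<rho>)" for j
    using measure_distr[OF translate_measurable slab_event_sets, of "t j" n k \<rho>] by (simp add: translate_distr B_def)
  have "disjoint_family_on B {..<m}"
    unfolding disjoint_family_on_def
  proof (intro ballI impI)
    fix i j assume ij: "i \<in> {..<m}" "j \<in> {..<m}" "i \<noteq> j"
    show "B i \<inter> B j = {}"
    proof (rule ccontr)
      assume "B i \<inter> B j \<noteq> {}"
      then obtain P where P: "P \<in> space M" "translate (t i) P \<in> slab_event n k \<rho>" "translate (t j) P \<in> slab_event n k \<rho>"
        by (auto simp: B_def)
      obtain \<tau> where \<tau>: "address n \<tau> P" using address_exists[OF space_locally_paperfolding[OF P(1)]] by blast
      obtain z z' where "\<bar>(t i + \<tau>) $ k + of_int z * 2 ^ n\<bar> \<le> \<rho>" "\<bar>(t j + \<tau>) $ k + of_int z' * 2 ^ n\<bar> \<le> \<rho>"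
        using P(2,3) slab_event_iff[OF translate_in_space[OF P(1)] address_translate[OF \<tau>]] by metis
      then have "\<bar>\<tau> $ k + real i * (2 * \<rho> + 1) + of_int z * 2 ^ n\<bar> \<le> \<rho>"
        "\<bar>\<tau> $ k + real j * (2 * \<rho> + 1) + of_int z' * 2 ^ n\<bar> \<le> \<rho>" by (simp_all add: tk algebra_simps)
      from slab_translates_disjoint[OF this _ _ m \<rho>] ij show False by auto
    qed
  qed
  then have "prob (\<Union>j\<in>{..<m}. B j) = (\<Sum>j<m. prob (B j))"
    using Bs by (intro finite_measure_finite_Union) auto
  then have "real m * prob (slab_event n k \<rho>) = prob (\<Union>j\<in>{..<m}. B j)" by (simp add: pB)
  then show ?thesis by simp
qed

text \<open>
  In almost every pattern, every ball around the origin is missed by the hyperplanes of spacing \<open>2\<^sup>n\<close>, for some \<open>n\<close>. In the exceptional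
  patterns a hyperplane remains whose creases are not determined by the addresses, as in the paperfolding structure itself.
\<close>

lemma slab_events_null:
  "AE P in M. \<forall>\<rho>::nat. \<exists>n. \<forall>k. P \<notin> slab_event n k (real \<rho>)"
proof (subst AE_all_countable, rule allI)
  fix \<rho> :: nat
  define A where "A = (\<Inter>n. \<Union>k. slab_event n k (real \<rho>))"
  have As: "A \<in> sets M" unfolding A_def using slab_event_sets by (intro sets.countable_INT' sets.finite_UN) auto
  have small: "prob A \<le> real CARD('d) / real m" if "m > 0" for m :: nat
  proof -
    obtain n where n: "real m * (2 * real \<rho> + 1) \<le> 2 ^ n"
      using real_arch_pow[of 2 "real m * (2 * real \<rho> + 1)"] by (auto intro: less_imp_le)
    have "prob A \<le> prob (\<Union>k. slab_event n k (real \<rho>))"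
      using slab_event_sets by (intro finite_measure_mono sets.finite_UN) (auto simp: A_def)
    also have "\<dots> \<le> (\<Sum>k\<in>UNIV. prob (slab_event n k (real \<rho>)))"
      using slab_event_sets by (intro finite_measure_subadditive_finite) auto
    also have "\<dots> \<le> (\<Sum>k\<in>(UNIV::'d set). 1 / real m)"
      using slab_event_prob[OF _ n] that by (intro sum_mono) (simp add: field_simps)
    finally show ?thesis by simp
  qed
  have "prob A \<le> 0"
  proof (rule field_le_epsilon)
    fix e :: real assume e: "e > 0"
    obtain m :: nat where m: "real CARD('d) / e < real m" using reals_Archimedean2 by blast
    moreover have "real CARD('d) / e > 0" using e by simp
    ultimately have "m > 0" using of_nat_0_less_iff less_trans by blast
    have "real CARD('d) / real m \<le> e" using m e \<open>m > 0\<close> by (simp add: field_simps)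
    then show "prob A \<le> 0 + e" using small[OF \<open>m > 0\<close>] by simp
  qed
  then have "A \<in> null_sets M" using As by (simp add: null_sets_def emeasure_eq_measure measure_le_0_iff)
  from AE_not_in[OF this] show "AE P in M. \<exists>n. \<forall>k. P \<notin> slab_event n k (real \<rho>)"
    by (auto simp: A_def elim: AE_mp)
qed

text \<open>
  The span of the characters of the address.
\<close>

definition eigen_sum :: "('d pattern \<Rightarrow> complex) \<Rightarrow> bool" where
  "eigen_sum g \<longleftrightarrow> (\<exists>X c. finite X \<and> X \<subseteq> dyadic_frequencies \<and> g = (\<lambda>P. \<Sum>\<xi>\<in>X. c \<xi> * eigenchar \<xi> P))"

definition approximable :: "('d pattern \<Rightarrow> complex) \<Rightarrow> bool" where
  "approximable f \<longleftrightarrow> square_integrable M f \<and> (\<forall>\<epsilon>>0. \<exists>g. eigen_sum g \<and> sq_dist M f g < \<epsilon>)"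

lemma square_integrable_eigen_sum: "eigen_sum g \<Longrightarrow> square_integrable M g"
  unfolding eigen_sum_def by (auto intro!: square_integrable_sum square_integrable_cmult square_integrable_eigenchar)

lemma eigen_sum_add:
  assumes "eigen_sum f" "eigen_sum g" shows "eigen_sum (\<lambda>P. f P + g P)"
proof -
  obtain X c Y d where f: "finite X" "X \<subseteq> dyadic_frequencies" "f = (\<lambda>P. \<Sum>\<xi>\<in>X. c \<xi> * eigenchar \<xi> P)"
    and g: "finite Y" "Y \<subseteq> dyadic_frequencies" "g = (\<lambda>P. \<Sum>\<xi>\<in>Y. d \<xi> * eigenchar \<xi> P)"
    using assms unfolding eigen_sum_def by blast
  define a where "a \<xi> = (if \<xi> \<in> X then c \<xi> else 0) + (if \<xi> \<in> Y then d \<xi> else 0)" for \<xi>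
  have "f P + g P = (\<Sum>\<xi>\<in>X \<union> Y. a \<xi> * eigenchar \<xi> P)" for P
  proof -
    have "f P = (\<Sum>\<xi>\<in>X \<union> Y. (if \<xi> \<in> X then c \<xi> else 0) * eigenchar \<xi> P)"
      unfolding f(3) using f(1) g(1) by (intro sum.mono_neutral_cong_left) auto
    moreover have "g P = (\<Sum>\<xi>\<in>X \<union> Y. (if \<xi> \<in> Y then d \<xi> else 0) * eigenchar \<xi> P)"
      unfolding g(3) using f(1) g(1) by (intro sum.mono_neutral_cong_left) auto
    ultimately show ?thesis by (simp add: a_def distrib_right sum.distrib)
  qed
  then show ?thesis unfolding eigen_sum_def using f(1,2) g(1,2) by (intro exI[of _ "X \<union> Y"] exI[of _ a]) auto
qed

lemma eigen_sum_cmult: assumes "eigen_sum f" shows "eigen_sum (\<lambda>P. a * f P)"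
proof -
  obtain X c where "finite X" "X \<subseteq> dyadic_frequencies" "f = (\<lambda>P. \<Sum>\<xi>\<in>X. c \<xi> * eigenchar \<xi> P)"
    using assms unfolding eigen_sum_def by blast
  then show ?thesis unfolding eigen_sum_def
    by (intro exI[of _ X] exI[of _ "\<lambda>\<xi>. a * c \<xi>"]) (auto simp: sum_distrib_left mult.assoc)
qed

lemma approximable_add:
  assumes "approximable f" "approximable g" shows "approximable (\<lambda>P. f P + g P)"
  unfolding approximable_def
proof (intro conjI allI impI)
  have sq: "square_integrable M f" "square_integrable M g" using assms by (auto simp: approximable_def)
  then show "square_integrable M (\<lambda>P. f P + g P)" by (rule square_integrable_add)
  fix \<epsilon> :: real assume "\<epsilon> > 0"
  then have "\<epsilon> / 4 > 0" by simp
  then obtain f' g' where f': "eigen_sum f'" "sq_dist M f f' < \<epsilon> / 4" and g': "eigen_sum g'" "sq_dist M g g' < \<epsilon> / 4"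
    using assms unfolding approximable_def by metis
  note sq' = square_integrable_eigen_sum[OF f'(1)] square_integrable_eigen_sum[OF g'(1)]
  have i: "integrable M (\<lambda>P. (cmod (f P - f' P))\<^sup>2)" "integrable M (\<lambda>P. (cmod (g P - g' P))\<^sup>2)"
    using square_integrable_diff[OF sq(1) sq'(1)] square_integrable_diff[OF sq(2) sq'(2)] by (auto simp: square_integrable_def)
  have j: "integrable M (\<lambda>P. (cmod (f P + g P - (f' P + g' P)))\<^sup>2)"
    using square_integrable_diff[OF square_integrable_add[OF sq] square_integrable_add[OF sq']] by (auto simp: square_integrable_def)
  have "sq_dist M (\<lambda>P. f P + g P) (\<lambda>P. f' P + g' P) \<le> (\<integral>P. 2 * (cmod (f P - f' P))\<^sup>2 + 2 * (cmod (g P - g' P))\<^sup>2 \<partial>M)"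
    unfolding sq_dist_def
  proof (rule integral_mono[OF j])
    show "(cmod (f P + g P - (f' P + g' P)))\<^sup>2 \<le> 2 * (cmod (f P - f' P))\<^sup>2 + 2 * (cmod (g P - g' P))\<^sup>2" for P
      using cmod_add_squared[of "f P - f' P" "g P - g' P"] by (simp add: algebra_simps)
  qed (use i in auto)
  also have "\<dots> = 2 * sq_dist M f f' + 2 * sq_dist M g g'" using i by (simp add: sq_dist_def)
  also have "\<dots> < \<epsilon>" using f'(2) g'(2) by simp
  finally show "\<exists>h. eigen_sum h \<and> sq_dist M (\<lambda>P. f P + g P) h < \<epsilon>" using eigen_sum_add[OF f'(1) g'(1)] by blast
qed

lemma approximable_cmult:
  assumes "approximable f" shows "approximable (\<lambda>P. a * f P)"
  unfolding approximable_def
proof (intro conjI allI impI)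
  show "square_integrable M (\<lambda>P. a * f P)" using assms by (auto simp: approximable_def intro: square_integrable_cmult)
  fix \<epsilon> :: real assume \<epsilon>: "\<epsilon> > 0"
  define \<delta> where "\<delta> = \<epsilon> / ((cmod a)\<^sup>2 + 1)"
  have pos: "(cmod a)\<^sup>2 + 1 > 0" by (simp add: add_nonneg_pos)
  then have "\<delta> > 0" using \<epsilon> by (simp add: \<delta>_def)
  then obtain g where g: "eigen_sum g" "sq_dist M f g < \<delta>" using assms unfolding approximable_def by blast
  have "sq_dist M (\<lambda>P. a * f P) (\<lambda>P. a * g P) = (cmod a)\<^sup>2 * sq_dist M f g"
    unfolding sq_dist_def by (simp add: norm_mult power_mult_distrib flip: right_diff_distrib)
  also have "\<dots> \<le> ((cmod a)\<^sup>2 + 1) * sq_dist M f g" using sq_dist_nonneg[of M f g] by (intro mult_right_mono) auto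
  also have "\<dots> < ((cmod a)\<^sup>2 + 1) * \<delta>" using g(2) pos by (intro mult_strict_left_mono)
  also have "\<dots> = \<epsilon>" using pos by (simp add: \<delta>_def)
  finally show "\<exists>h. eigen_sum h \<and> sq_dist M (\<lambda>P. a * f P) h < \<epsilon>" using eigen_sum_cmult[OF g(1)] by blast
qed

lemma approximable_0: "approximable (\<lambda>P. 0)"
  unfolding approximable_def
proof (intro conjI allI impI exI[of _ "\<lambda>P. 0"])
  show "eigen_sum (\<lambda>P. 0)" unfolding eigen_sum_def by (rule exI[of _ "{}"]) auto
qed (auto simp: square_integrable_def sq_dist_def)

lemma approximable_sum: "(\<And>a. a \<in> A \<Longrightarrow> approximable (f a)) \<Longrightarrow> approximable (\<lambda>P. \<Sum>a\<in>A. f a P)"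
  by (induction A rule: infinite_finite_induct) (auto intro: approximable_add approximable_0)

lemma approximable_limit:
  assumes f: "square_integrable M f" and fn: "\<And>n. approximable (F n)" and lim: "(\<lambda>n. sq_dist M f (F n)) \<longlonglongrightarrow> 0"
  shows "approximable f"
  unfolding approximable_def
proof (intro conjI allI impI f)
  fix \<epsilon> :: real assume "\<epsilon> > 0"
  then have e4: "\<epsilon> / 4 > 0" by simp
  obtain n where n: "sq_dist M f (F n) < \<epsilon> / 4"
    using order_tendstoD(2)[OF lim e4] by (auto simp: eventually_sequentially)
  obtain g where g: "eigen_sum g" "sq_dist M (F n) g < \<epsilon> / 4" using fn[of n] e4 unfolding approximable_def by blast
  have "sq_dist M f g \<le> 2 * sq_dist M f (F n) + 2 * sq_dist M (F n) g"
    using f fn[of n] square_integrable_eigen_sum[OF g(1)] by (intro sq_dist_triangle) (auto simp: approximable_def)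
  also have "\<dots> < \<epsilon>" using n g(2) by simp
  finally show "\<exists>g. eigen_sum g \<and> sq_dist M f g < \<epsilon>" using g(1) by blast
qed

lemma approximable_dominated:
  assumes f: "f \<in> borel_measurable M" and F: "\<And>n. approximable (F n)"
    and lim: "AE P in M. (\<lambda>n. F n P) \<longlonglongrightarrow> f P"
    and dom: "\<And>n P. P \<in> space M \<Longrightarrow> cmod (F n P) \<le> h P" "\<And>P. P \<in> space M \<Longrightarrow> cmod (f P) \<le> h P"
    and h: "h \<in> borel_measurable M" "integrable M (\<lambda>P. (h P)\<^sup>2)"
  shows "approximable f"
proof (rule approximable_limit[OF _ F])
  note [measurable] = f h(1)
  have Fm [measurable]: "F n \<in> borel_measurable M" for n using F by (auto simp: approximable_def square_integrable_def)
  have "integrable M (\<lambda>P. (cmod (f P))\<^sup>2)"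
    by (rule Bochner_Integration.integrable_bound[OF h(2)]) (use dom(2) in \<open>auto intro!: AE_I2 power_mono\<close>)
  then show "square_integrable M f" using f by (simp add: square_integrable_def)
  have "(\<lambda>n. \<integral>P. (cmod (f P - F n P))\<^sup>2 \<partial>M) \<longlonglongrightarrow> (\<integral>P. 0 \<partial>M)"
  proof (rule integral_dominated_convergence[of _ _ _ "\<lambda>P. 4 * (h P)\<^sup>2"])
    show "AE P in M. (\<lambda>n. (cmod (f P - F n P))\<^sup>2) \<longlonglongrightarrow> 0"
      using lim
    proof eventually_elim
      case (elim P)
      have "(\<lambda>n. (cmod (f P - F n P))\<^sup>2) \<longlonglongrightarrow> (cmod (f P - f P))\<^sup>2" by (intro tendsto_intros elim)
      then show ?case by simp
    qed
    show "AE P in M. norm ((cmod (f P - F n P))\<^sup>2) \<le> 4 * (h P)\<^sup>2" for n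
    proof (rule AE_I2)
      fix P assume P: "P \<in> space M"
      have "cmod (f P - F n P) \<le> 2 * h P" using norm_triangle_ineq4[of "f P" "F n P"] dom(1)[OF P, of n] dom(2)[OF P] by linarith
      then have "(cmod (f P - F n P))\<^sup>2 \<le> (2 * h P)\<^sup>2" by (intro power_mono) auto
      then show "norm ((cmod (f P - F n P))\<^sup>2) \<le> 4 * (h P)\<^sup>2" by (simp add: power_mult_distrib)
    qed
  qed (use h in auto)
  then show "(\<lambda>n. sq_dist M f (F n)) \<longlonglongrightarrow> 0" by (simp add: sq_dist_def)
qed

lemma approximable_dominated_1:
  assumes "f \<in> borel_measurable M" "\<And>n. approximable (F n)" "AE P in M. (\<lambda>n. F n P) \<longlonglongrightarrow> f P"
    "\<And>n P. P \<in> space M \<Longrightarrow> cmod (F n P) \<le> 1" "\<And>P. P \<in> space M \<Longrightarrow> cmod (f P) \<le> 1"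
  shows "approximable f"
  by (rule approximable_dominated[OF assms(1-3), of "\<lambda>_. 1"]) (use assms(4,5) in auto)

text \<open>
  A continuous function of the address modulo \<open>2\<^sup>n\<close> is uniformly approximated by trigonometric polynomials in the address.
\<close>

lemma approximable_torus_function:
  fixes g :: "(complex, 'd) vec \<Rightarrow> complex"
  assumes g: "continuous_on UNIV g" and bnd: "\<And>z. cmod (g z) \<le> 1"
  shows "approximable (\<lambda>P. g (coordinate n P))"
  unfolding approximable_def
proof (intro conjI allI impI)
  have m: "(\<lambda>P. g (coordinate n P)) \<in> borel_measurable M"
    by (rule borel_measurable_continuous_on[OF g coordinate_measurable])
  then show "square_integrable M (\<lambda>P. g (coordinate n P))" using bnd by (intro square_integrable_bounded[of _ 1]) auto
  fix \<epsilon> :: real assume \<epsilon>: "\<epsilon> > 0"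
  then have e: "sqrt (\<epsilon> / 2) > 0" by simp
  obtain T where T: "trig_poly (frequencies n) T" "\<And>y. cmod (g (torus_map n y) - T y) < sqrt (\<epsilon> / 2)"
    using torus_function_approx[OF continuous_on_subset[OF g subset_UNIV] e] by blast
  obtain X c where X: "finite X" "X \<subseteq> frequencies n" "T = (\<lambda>y. \<Sum>\<xi>\<in>X. c \<xi> * character \<xi> y)"
    using trig_poly_sum_form[OF T(1)] by blast
  define G where "G P = (\<Sum>\<xi>\<in>X. c \<xi> * eigenchar \<xi> P)" for P
  have G: "eigen_sum G" unfolding eigen_sum_def G_def using X by (auto simp: dyadic_frequencies_def)
  have pt: "(cmod (g (coordinate n P) - G P))\<^sup>2 \<le> \<epsilon> / 2" if P: "P \<in> space M" for P
  proof -
    obtain \<tau> where \<tau>: "address n \<tau> P" using address_exists[OF space_locally_paperfolding[OF P]] by blast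
    have "G P = T \<tau>" unfolding G_def X(3) using X(2) eigenchar_eq[OF _ \<tau>] by (intro sum.cong) auto
    then have "cmod (g (coordinate n P) - G P) \<le> sqrt (\<epsilon> / 2)" using T(2)[of \<tau>] by (simp add: coordinate_eq[OF \<tau>])
    then have "(cmod (g (coordinate n P) - G P))\<^sup>2 \<le> (sqrt (\<epsilon> / 2))\<^sup>2" by (intro power_mono) auto
    then show ?thesis using \<epsilon> by simp
  qed
  have "sq_dist M (\<lambda>P. g (coordinate n P)) G \<le> (\<integral>P. \<epsilon> / 2 \<partial>M)"
    unfolding sq_dist_def
  proof (rule integral_mono_AE)
    show "integrable M (\<lambda>P. (cmod (g (coordinate n P) - G P))\<^sup>2)"
      using square_integrable_diff[OF square_integrable_bounded[OF m bnd] square_integrable_eigen_sum[OF G]]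
      by (simp add: square_integrable_def)
    show "AE P in M. (cmod (g (coordinate n P) - G P))\<^sup>2 \<le> \<epsilon> / 2" using pt by (rule AE_I2)
  qed simp
  also have "\<dots> < \<epsilon>" using \<epsilon> by (simp add: prob_space)
  finally show "\<exists>h. eigen_sum h \<and> sq_dist M (\<lambda>P. g (coordinate n P)) h < \<epsilon>" using G by blast
qed

definition cylinder :: "nat \<Rightarrow> (complex, 'd) vec set \<Rightarrow> 'd pattern set" where
  "cylinder n W = {P \<in> space M. coordinate n P \<in> W}"

lemma cylinder_sets: "open W \<Longrightarrow> cylinder n W \<in> sets M"
  using measurable_sets[OF coordinate_measurable, of W n] by (simp add: cylinder_def vimage_def Int_def conj_commute)

text \<open>
  The indicator of an open set is the increasing limit of the continuous functions \<open>z \<mapsto> min 1 (m dist (z, - W))\<close>.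
\<close>

lemma approximable_cylinder:
  assumes W: "open W" shows "approximable (indicator (cylinder n W))"
proof (cases "W = UNIV")
  (* infdist z {} = 0 by convention, so the construction below fails for W = UNIV *)
  case True
  then have "approximable (\<lambda>P. (\<lambda>z. 1) (coordinate n P))" by (intro approximable_torus_function) auto
  then show ?thesis
    by (rule approximable_dominated_1[rotated, of "\<lambda>_ P. 1"]) (auto simp: True cylinder_def indicator_def cong: measurable_cong)
next
  case False
  define g where "g m z = complex_of_real (min 1 (real m * infdist z (- W)))" for m z
  have cg: "continuous_on UNIV (g m)" for m unfolding g_def by (intro continuous_intros)
  have bg: "cmod (g m z) \<le> 1" for m z
    using infdist_nonneg[of z "- W"] by (simp add: g_def min_def)
  have lim: "(\<lambda>m. g m z) \<longlonglongrightarrow> indicator W z" for z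
  proof (cases "z \<in> W")
    case True
    have cW: "closed (- W)" "- W \<noteq> {}" using W False by auto
    then have d: "infdist z (- W) > 0"
      using in_closed_iff_infdist_zero[OF cW, of z] infdist_nonneg[of z "- W"] True by (simp add: order_less_le)
    obtain m0 :: nat where m0: "1 / infdist z (- W) < real m0" using reals_Archimedean2 by blast
    have "g m z = 1" if "m \<ge> m0" for m
    proof -
      have "1 / infdist z (- W) \<le> real m" using m0 that by linarith
      then have "1 \<le> real m * infdist z (- W)" using d by (simp add: field_simps)
      then show ?thesis by (simp add: g_def)
    qed
    then have "\<forall>\<^sub>F m in sequentially. g m z = 1" by (auto simp: eventually_sequentially)
    then show ?thesis using True by (simp add: tendsto_eventually)
  next
    case False
    then have "infdist z (- W) = 0" by (simp add: infdist_zero)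
    then show ?thesis using False by (simp add: g_def)
  qed
  show ?thesis
  proof (rule approximable_dominated_1[OF _ approximable_torus_function[OF cg bg, of _ n]])
    show "indicator (cylinder n W) \<in> borel_measurable M" using cylinder_sets[OF W] by simp
    have "indicator (cylinder n W) P = (indicator W (coordinate n P) :: complex)" if "P \<in> space M" for P
      using that by (simp add: cylinder_def indicator_def)
    then show "AE P in M. (\<lambda>m. g m (coordinate n P)) \<longlonglongrightarrow> indicator (cylinder n W) P"
      using lim by (intro AE_I2) simp
  qed (use bg in \<open>auto simp: indicator_def\<close>)
qed

text \<open>
  The coordinate of level \<open>n\<close> is the square of that of level \<open>n + 1\<close>, so finer levels have more cylinder sets.
\<close>

lemma cylinder_Suc:
  assumes "open W" shows "\<exists>W'. open W' \<and> cylinder n W = cylinder (Suc n) W'"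
proof (intro exI conjI)
  let ?s = "\<lambda>z :: (complex, 'd) vec. (\<chi> i. (z $ i)\<^sup>2) :: (complex, 'd) vec"
  have "continuous_on UNIV ?s" by (intro continuous_intros)
  then show "open (?s -` W)" using assms by (simp add: continuous_on_open_vimage)
  have "coordinate n P = ?s (coordinate (Suc n) P)" if P: "P \<in> space M" for P
  proof -
    obtain \<tau> where \<tau>: "address (Suc n) \<tau> P" using address_exists[OF space_locally_paperfolding[OF P]] by blast
    then have "address n \<tau> P" by (rule address_mono) simp
    then have "coordinate n P = torus_map n \<tau>" "coordinate (Suc n) P = torus_map (Suc n) \<tau>" using \<tau> by (auto intro: coordinate_eq)
    moreover have "torus_map n \<tau> = ?s (torus_map (Suc n) \<tau>)"
      by (simp add: torus_map_def vec_eq_iff power2_eq_square cis_mult mult.assoc)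
    ultimately show ?thesis by simp
  qed
  then show "cylinder n W = cylinder (Suc n) (?s -` W)" by (auto simp: cylinder_def)
qed

text \<open>
  Points of the torus near the coordinate of \<open>P\<close> have representatives near \<open>\<tau>\<close>: the other points form the image of a compact set.
\<close>

lemma cylinder_neighbourhood:
  assumes P: "P \<in> space M" and \<tau>: "address n \<tau> P" and \<epsilon>: "\<epsilon> > 0"
  obtains W where "open W" "P \<in> cylinder n W"
    "\<And>Q. Q \<in> cylinder n W \<Longrightarrow> \<exists>t. norm t < \<epsilon> \<and> address n \<tau> (translate t Q)"
proof -
  let ?K = "cbox 0 (\<chi> i. 2 ^ n) :: (real, 'd) vec set"
  define F where "F = ?K \<inter> (\<Inter>l\<in>dyadic_lattice n. {y. \<epsilon> \<le> norm (y - \<tau> - l)})"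
  have "closed (\<Inter>l\<in>dyadic_lattice n. {y. \<epsilon> \<le> norm (y - \<tau> - l)})"
    by (intro closed_INT ballI closed_Collect_le continuous_intros)
  then have "compact F" unfolding F_def by (intro compact_Int_closed compact_cbox)
  then have "closed (torus_map n ` F)" by (intro compact_imp_closed compact_continuous_image continuous_on_torus_map)
  then have W: "open (- torus_map n ` F)" by (simp add: open_Compl)
  moreover have "P \<in> cylinder n (- torus_map n ` F)"
  proof -
    have False if "y \<in> F" "torus_map n \<tau> = torus_map n y" for y
    proof -
      have "y - \<tau> \<in> dyadic_lattice n" using that(2) by (metis torus_map_eq_iff)
      then have "\<epsilon> \<le> norm (y - \<tau> - (y - \<tau>))" using that(1) unfolding F_def by blast
      then show False using \<epsilon> by simp
    qed
    then show ?thesis using P by (auto simp: cylinder_def coordinate_eq[OF \<tau>])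
  qed
  moreover have "\<exists>t. norm t < \<epsilon> \<and> address n \<tau> (translate t Q)" if Q: "Q \<in> cylinder n (- torus_map n ` F)" for Q
  proof -
    have QM: "Q \<in> space M" using Q by (simp add: cylinder_def)
    obtain \<sigma> where \<sigma>: "address n \<sigma> Q" using address_exists[OF space_locally_paperfolding[OF QM]] by blast
    have "torus_map n \<sigma> \<in> torus_map n ` ?K" unfolding torus_map_surj[symmetric] by simp
    then obtain y where y: "y \<in> ?K" "torus_map n \<sigma> = torus_map n y" by auto
    have "y \<notin> F" using Q y(2) by (auto simp: cylinder_def coordinate_eq[OF \<sigma>])
    then obtain l where l: "l \<in> dyadic_lattice n" "norm (y - \<tau> - l) < \<epsilon>" using y(1) by (auto simp: F_def not_le)
    define t where "t = - (y - \<tau> - l)"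
    have "address n y Q" using address_cong[OF \<sigma>] y(2) by (simp add: torus_map_eq_iff)
    then have a: "address n (t + y) (translate t Q)" by (rule address_translate)
    have "t + y - \<tau> = l" by (simp add: t_def)
    then have "address n \<tau> (translate t Q)" using address_cong[OF a, of \<tau>] l(1) by simp
    moreover have "norm t < \<epsilon>" unfolding t_def norm_minus_cancel by (rule l(2))
    ultimately show ?thesis by blast
  qed
  ultimately show ?thesis using that by blast
qed

text \<open>
  Let \<open>n\<close> be such that the hyperplanes of spacing \<open>2\<^sup>n\<close> miss the ball of radius \<open>1/\<epsilon>\<close>. A pattern whose address is
  close to that of \<open>P\<close> has, after a small translation, the same address, and then agrees with \<open>P\<close> on this ball.
\<close>

lemma regular_point_cylinder:
  assumes U: "openin (subtopology pattern_topology paperfolding_hull) U" and P: "P \<in> U"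
    and reg: "\<forall>\<rho>::nat. \<exists>n. \<forall>k. P \<notin> slab_event n k (real \<rho>)"
  shows "\<exists>n W. open W \<and> P \<in> cylinder n W \<and> cylinder n W \<subseteq> U"
proof -
  obtain U' where U': "openin pattern_topology U'" "U = U' \<inter> paperfolding_hull"
    using U by (auto simp: openin_subtopology)
  obtain \<epsilon> where \<epsilon>: "\<epsilon> > 0" "\<And>Q. pattern_close \<epsilon> P Q \<Longrightarrow> Q \<in> U'"
    using U'(1) P U'(2) unfolding openin_pattern_topology by blast
  have PM: "P \<in> space M" using P U'(2) by (simp add: space_M)
  obtain \<rho> :: nat where \<rho>: "1 / \<epsilon> < real \<rho>" using reals_Archimedean2 by blast
  obtain n where n: "\<And>k. P \<notin> slab_event n k (real \<rho>)" using reg by blast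
  obtain \<tau> where \<tau>: "address (Suc n) \<tau> P" using address_exists[OF space_locally_paperfolding[OF PM]] by blast
  have \<tau>n: "address n \<tau> P" using address_mono[OF \<tau>] by simp
  have far: "\<bar>\<tau> $ k + of_int z * 2 ^ n\<bar> > real \<rho>" for k and z :: int
    using n[of k] slab_event_iff[OF PM \<tau>n, of k "real \<rho>"] not_le by blast
  obtain W where W: "open W" "P \<in> cylinder (Suc n) W"
    "\<And>Q. Q \<in> cylinder (Suc n) W \<Longrightarrow> \<exists>t. norm t < \<epsilon> \<and> address (Suc n) \<tau> (translate t Q)"
    using cylinder_neighbourhood[OF PM \<tau> \<epsilon>(1)] by metis
  have "Q \<in> U" if Q: "Q \<in> cylinder (Suc n) W" for Q
  proof -
    obtain t where t: "norm t < \<epsilon>" "address (Suc n) \<tau> (translate t Q)" using W(3)[OF Q] by blast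
    have "agree_on (ball 0 (1 / \<epsilon>)) P (translate t Q)"
      unfolding agree_on_def
    proof (intro allI impI)
      fix x :: "(real, 'd) vec" and k s assume "face x k \<inter> ball 0 (1 / \<epsilon>) \<noteq> {}"
      then obtain y where y: "y \<in> face x k" "norm y < 1 / \<epsilon>" by auto
      then have "\<bar>x $ k\<bar> < real \<rho>" using component_le_norm_cart[of y k] \<rho> by (simp add: face_def)
      have "(x - \<tau>) $ k / 2 ^ n \<notin> \<int>"
      proof
        assume "(x - \<tau>) $ k / 2 ^ n \<in> \<int>"
        then obtain z where "(x - \<tau>) $ k / 2 ^ n = of_int z" by (elim Ints_cases)
        then have "x $ k = \<tau> $ k + of_int z * 2 ^ n" by (simp add: field_simps)
        then show False using far[of k z] \<open>\<bar>x $ k\<bar> < real \<rho>\<close> by simp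
      qed
      then show "((x, k, s) \<in> P) = ((x, k, s) \<in> translate t Q)"
        using address_off_slab[OF \<tau>] address_off_slab[OF t(2)] by blast
    qed
    then have "pattern_close \<epsilon> P Q" using t(1) unfolding pattern_close_def by (auto intro: less_imp_le)
    then have "Q \<in> U'" by (rule \<epsilon>(2))
    moreover have "Q \<in> paperfolding_hull" using Q by (simp add: cylinder_def space_M)
    ultimately show ?thesis using U'(2) by simp
  qed
  with W show ?thesis by blast
qed

text \<open>
  Up to a null set, \<open>U\<close> is the increasing union over \<open>n\<close> of the largest cylinder sets of level \<open>n\<close> that it contains.
\<close>

lemma approximable_open:
  assumes U: "openin (subtopology pattern_topology paperfolding_hull) U"
  shows "approximable (indicator U)"
proof -
  define W where "W n = \<Union>{W. open W \<and> cylinder n W \<subseteq> U}" for n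
  have oW: "open (W n)" for n unfolding W_def by (intro open_Union) auto
  have sub: "cylinder n (W n) \<subseteq> U" for n by (auto simp: cylinder_def W_def)
  have mono1: "cylinder n (W n) \<subseteq> cylinder (Suc n) (W (Suc n))" for n
  proof
    fix P assume "P \<in> cylinder n (W n)"
    then obtain V where V: "open V" "cylinder n V \<subseteq> U" "P \<in> cylinder n V" by (auto simp: cylinder_def W_def)
    obtain V' where "open V'" "cylinder n V = cylinder (Suc n) V'" using cylinder_Suc[OF V(1)] by blast
    then show "P \<in> cylinder (Suc n) (W (Suc n))" using V by (auto simp: cylinder_def W_def)
  qed
  have mono: "n \<le> m \<Longrightarrow> cylinder n (W n) \<subseteq> cylinder m (W m)" for n m
    using lift_Suc_mono_le[of "\<lambda>n. cylinder n (W n)", OF mono1] by blast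
  show ?thesis
  proof (rule approximable_dominated_1[OF _ approximable_cylinder[OF oW]])
    show "indicator U \<in> borel_measurable M" using open_in_sets[OF U] by simp
    show "AE P in M. (\<lambda>n. indicator (cylinder n (W n)) P) \<longlonglongrightarrow> (indicator U P :: complex)"
      using slab_events_null
    proof eventually_elim
      case (elim P)
      show ?case
      proof (cases "P \<in> U")
        case True
        from regular_point_cylinder[OF U True elim] obtain n V where "open V" "P \<in> cylinder n V" "cylinder n V \<subseteq> U" by blast
        then have "P \<in> cylinder n (W n)" by (auto simp: cylinder_def W_def)
        then have "\<forall>m\<ge>n. indicator (cylinder m (W m)) P = (1 :: complex)" using mono by (auto intro!: indicator_simps(1))
        then have "\<forall>\<^sub>F m in sequentially. indicator (cylinder m (W m)) P = (1 :: complex)"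
          by (auto simp: eventually_sequentially)
        then show ?thesis using True by (simp add: tendsto_eventually)
      next
        case False
        then have "indicator (cylinder n (W n)) P = (0 :: complex)" for n using sub by (auto simp: indicator_def)
        then show ?thesis using False by simp
      qed
    qed
  qed (auto simp: indicator_def)
qed

text \<open>
  The sets with approximable indicator form a Dynkin system that contains the open sets.
\<close>

lemma approximable_indicator:
  assumes "A \<in> sets M" shows "approximable (indicator A)"
proof -
  have "Int_stable {U. openin (subtopology pattern_topology (paperfolding_hull :: 'd pattern set)) U}"
    by (auto simp: Int_stable_def)
  from this open_subsets assms[unfolded sets_M] show ?thesis
  proof (induction rule: sigma_sets_induct_disjoint)
    case (basic A)
    then show ?case using approximable_open by simp
  next
    case empty
    then show ?case using approximable_0 by simp
  next
    case (compl A)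
    have sp: "approximable (indicator (space M))"
      using approximable_cylinder[of UNIV 0] by (simp add: cylinder_def)
    have "A \<subseteq> space M" using compl(1) sets_M sets.sets_into_space by blast
    then have "(\<lambda>P. indicator (space M) P + (-1) * indicator A P) = (indicator (paperfolding_hull - A) :: _ \<Rightarrow> complex)"
      by (auto simp: fun_eq_iff indicator_def space_M)
    then show ?case using approximable_add[OF sp approximable_cmult[OF compl(2), of "-1"]] by metis
  next
    case (union A)
    have As: "A i \<in> sets M" for i using union(2) sets_M by blast
    have ind: "(indicator (\<Union>i<n. A i) :: _ \<Rightarrow> complex) = (\<lambda>P. \<Sum>i<n. indicator (A i) P)" for n
    proof
      fix P
      have "disjoint_family_on A {..<n}" using union(1) by (auto simp: disjoint_family_on_def)
      then show "(indicator (\<Union>i<n. A i) P :: complex) = (\<Sum>i<n. indicator (A i) P)"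
        by (intro indicator_UN_disjoint) auto
    qed
    show ?case
    proof (rule approximable_dominated_1[of _ "\<lambda>n. indicator (\<Union>i<n. A i)"])
      show "indicator (\<Union>i. A i) \<in> borel_measurable M" using As by auto
      show "approximable (indicator (\<Union>i<n. A i))" for n unfolding ind using union(3) by (rule approximable_sum)
      show "AE P in M. (\<lambda>n. indicator (\<Union>i<n. A i) P) \<longlonglongrightarrow> (indicator (\<Union>i. A i) P :: complex)"
      proof (rule AE_I2)
        fix P
        show "(\<lambda>n. indicator (\<Union>i<n. A i) P) \<longlonglongrightarrow> (indicator (\<Union>i. A i) P :: complex)"
        proof (cases "P \<in> (\<Union>i. A i)")
          case True
          then obtain i where "P \<in> A i" by blast
          then have "\<forall>n\<ge>Suc i. indicator (\<Union>i<n. A i) P = (1 :: complex)" by (auto simp: indicator_def)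
          then have "\<forall>\<^sub>F n in sequentially. indicator (\<Union>i<n. A i) P = (1 :: complex)" unfolding eventually_sequentially by blast
          then show ?thesis using True by (simp add: tendsto_eventually)
        next
          case False
          then have "indicator (\<Union>i<n. A i) P = (0 :: complex)" for n by (auto simp: indicator_def)
          then show ?thesis using False by simp
        qed
      qed
    qed (auto simp: indicator_def)
  qed
qed

text \<open>
  Simple functions approximate every square integrable function, dominated by twice its modulus.
\<close>

lemma approximable_square_integrable:
  assumes f: "square_integrable M f" shows "approximable f"
proof -
  have fm: "f \<in> borel_measurable M" using f by (simp add: square_integrable_def)
  obtain F where F: "\<And>i. simple_function M (F i)" "\<And>P. P \<in> space M \<Longrightarrow> (\<lambda>i. F i P) \<longlonglongrightarrow> f P"
    "\<And>i P. P \<in> space M \<Longrightarrow> dist (F i P) 0 \<le> 2 * dist (f P) 0"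
    using borel_measurable_implies_sequence_metric[OF fm, of 0] by metis
  have aF: "approximable (F i)" for i
  proof -
    define G where "G P = (\<Sum>y\<in>F i ` space M. y * indicator (F i -` {y} \<inter> space M) P)" for P
    have aG: "approximable G"
      unfolding G_def using simple_functionD(2)[OF F(1)]
      by (intro approximable_sum approximable_cmult approximable_indicator)
    have eq: "F i P = G P" if "P \<in> space M" for P
    proof -
      have *: "indicator A P *\<^sub>R y = y * indicator A P" for y :: complex and A
        by (simp add: indicator_def)
      show ?thesis unfolding G_def
        by (rule trans[OF simple_function_indicator_representation_banach[OF F(1) that]]) (simp only: *)
    qed
    have sG: "square_integrable M G" using aG by (simp add: approximable_def)
    show ?thesis
    proof (rule approximable_dominated[of "F i" "\<lambda>_. G" "\<lambda>P. cmod (G P)"])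
      show "F i \<in> borel_measurable M" using F(1) by (rule borel_measurable_simple_function)
      show "AE P in M. (\<lambda>_::nat. G P) \<longlonglongrightarrow> F i P" using eq by (intro AE_I2) simp
    qed (use aG sG eq in \<open>auto simp: square_integrable_def\<close>)
  qed
  show ?thesis
  proof (rule approximable_dominated[OF fm aF])
    show "AE P in M. (\<lambda>i. F i P) \<longlonglongrightarrow> f P" using F(2) by (rule AE_I2)
    show "cmod (F i P) \<le> 2 * cmod (f P)" if "P \<in> space M" for i P using F(3)[OF that] by simp
    show "cmod (f P) \<le> 2 * cmod (f P)" for P by simp
    show "(\<lambda>P. 2 * cmod (f P)) \<in> borel_measurable M" using fm by simp
    show "integrable M (\<lambda>P. (2 * cmod (f P))\<^sup>2)" using f by (simp add: power_mult_distrib square_integrable_def)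
  qed
qed

theorem pure_point_dynamical: "pure_point_dynamical_spectrum M"
  unfolding pure_point_dynamical_spectrum_def
proof (intro allI impI)
  fix f and \<epsilon> :: real assume f: "square_integrable M f" and "\<epsilon> > 0"
  then have "\<epsilon>\<^sup>2 > 0" by simp
  then obtain g where g: "eigen_sum g" "sq_dist M f g < \<epsilon>\<^sup>2"
    using approximable_square_integrable[OF f] unfolding approximable_def by blast
  then obtain X c where X: "finite X" "X \<subseteq> dyadic_frequencies" "g = (\<lambda>P. \<Sum>\<xi>\<in>X. c \<xi> * eigenchar \<xi> P)"
    unfolding eigen_sum_def by blast
  (* collects the coefficients of frequencies whose eigenfunctions coincide *)
  define d where "d e = (\<Sum>\<xi> | \<xi> \<in> X \<and> eigenchar \<xi> = e. c \<xi>)" for e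
  have "g P = (\<Sum>e\<in>eigenchar ` X. d e * e P)" for P
  proof -
    have "g P = (\<Sum>e\<in>eigenchar ` X. \<Sum>\<xi> | \<xi> \<in> X \<and> eigenchar \<xi> = e. c \<xi> * eigenchar \<xi> P)"
      unfolding X(3) by (rule sum.image_gen[OF X(1)])
    also have "\<dots> = (\<Sum>e\<in>eigenchar ` X. d e * e P)"
      unfolding d_def sum_distrib_right by (intro sum.cong) auto
    finally show ?thesis .
  qed
  then have "(\<integral>P. (cmod (f P - (\<Sum>e\<in>eigenchar ` X. d e * e P)))\<^sup>2 \<partial>M) < \<epsilon>\<^sup>2"
    using g(2) by (simp add: sq_dist_def)
  moreover have "\<forall>e\<in>eigenchar ` X. eigenfunction M e" using X(2) eigenfunction_eigenchar by blast
  ultimately show "\<exists>E c. finite E \<and> (\<forall>e\<in>E. eigenfunction M e) \<and> (\<integral>P. (cmod (f P - (\<Sum>e\<in>E. c e * e P)))\<^sup>2 \<partial>M) < \<epsilon>\<^sup>2"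
    using X(1) by blast
qed

end

theorem theorem2:
  shows "(\<forall>P \<in> (paperfolding_hull :: ('d::{finite,linorder}) pattern set).
            pure_point_diffraction_spectrum P) \<and>
         (\<forall>\<P> :: 'd pattern measure.
            invariant_hull_measure \<P> \<longrightarrow> pure_point_dynamical_spectrum \<P>)"
proof (intro conjI ballI allI impI)
  fix P :: "'d pattern" assume "P \<in> paperfolding_hull"
  then show "pure_point_diffraction_spectrum P" by (rule hull_pure_point_diffraction)
next
  fix \<P> :: "'d pattern measure" assume "invariant_hull_measure \<P>"
  then interpret invariant_measure \<P> by unfold_locales
  show "pure_point_dynamical_spectrum \<P>" by (rule pure_point_dynamical)
qed

end
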